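(* Limit groups satisfy the following properties: (1) A limit group is torsion-free, commutative transitive, and CSA. (2) Any finitely generated subgroup of a limit group is a limit group. (3) If a limit group is non-trivial (resp. non-abelian), then its first Betti number is at least $1$ (resp. at least $2$). (4) Any two elements of a limit group generate a free abelian group ($\{1\}$, $\mathbb{Z}$ or $\mathbb{Z}^2$) or a non-abelian free group of rank $2$. (5) A limit group $G$ is bi-orderable: there is a total order on $G$ which is invariant under left and right multiplication.
   Context: A marked group $(G,S)$ is a group $G$ with an ordered finite generating family $S=(s_1,\dots,s_n)$ (repetitions allowed); two marked groups are identified if $s_i\mapsto s_i'$ extends to a group isomorphism. $\mathcal{G}_n$ is the set of groups marked by $n$ elements, identified with the set of normal subgroups of the free group $F_n=\langle e_1,\dots,e_n\rangle$ (kernel of $e_i\mapsto s_i$), with the topology induced by the product topology on $2^{F_n}$. A limit group is a finitely generated group some (equivalently, any) marking of which is a limit in $\mathcal{G}_n$ of markings of free groups (of any rank, including $0$ and $1$). A group $G$ is commutative transitive if for all $a,b,c\in G\setminus\{1\}$, $[a,b]=[b,c]=1$ implies $[a,c]=1$. A group $G$ is CSA if every maximal abelian subgroup $H<G$ is malnormal, i.e. $H\cap gHg^{-1}=\{1\}$ for all $g\in G\setminus H$. The first Betti number is the rank of the abelianization tensored with $\mathbb{Q}$. *)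

theory Defs
  imports
    "HOL-Analysis.Function_Topology"
    "HOL-Algebra.Free_Abelian_Groups"
    "Jordan_Normal_Form.VS_Connect"
begin

section \<open>Free groups\<close>

text \<open>The letter \<open>(i, True)\<close> stands for the generator \<open>e\<^sub>i\<close> and \<open>(i, False)\<close> for its inverse.
  The elements of the free group on \<open>X\<close> are the reduced words with letters in \<open>X\<close>;
  \<open>foldr push u v\<close> is the reduced form of the concatenation \<open>u @ v\<close> if \<open>v\<close> is reduced.\<close>

type_synonym 'x letter = "'x \<times> bool"

definition inv_letter :: "'x letter \<Rightarrow> 'x letter" where
  "inv_letter l = (fst l, \<not> snd l)"

fun reduced :: "'x letter list \<Rightarrow> bool" where
  "reduced (x # y # w) \<longleftrightarrow> y \<noteq> inv_letter x \<and> reduced (y # w)"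
| "reduced _ \<longleftrightarrow> True"

fun push :: "'x letter \<Rightarrow> 'x letter list \<Rightarrow> 'x letter list" where
  "push x [] = [x]"
| "push x (y # w) = (if y = inv_letter x then w else x # y # w)"

definition free_group :: "'x set \<Rightarrow> 'x letter list monoid" where
  "free_group X =
    \<lparr>carrier = {w. reduced w \<and> fst ` set w \<subseteq> X}, monoid.mult = foldr push, one = []\<rparr>"

definition word_eval :: "('a, 'm) monoid_scheme \<Rightarrow> ('x \<Rightarrow> 'a) \<Rightarrow> 'x letter list \<Rightarrow> 'a" where
  "word_eval G s w =
    foldr (\<lambda>(i, b) y. (if b then s i else inv\<^bsub>G\<^esub> s i) \<otimes>\<^bsub>G\<^esub> y) w \<one>\<^bsub>G\<^esub>"

lemma inv_letter_inv_letter [simp]: "inv_letter (inv_letter x) = x"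
  by (simp add: inv_letter_def)

lemma inv_letter_neq [simp]: "inv_letter x \<noteq> x"
  by (cases x) (simp add: inv_letter_def)

lemma fst_inv_letter [simp]: "fst (inv_letter x) = fst x"
  by (simp add: inv_letter_def)

lemma reduced_tl: "reduced (x # w) \<Longrightarrow> reduced w"
  by (cases w) auto

lemma reduced_push: "reduced w \<Longrightarrow> reduced (push x w)"
  by (cases w) (auto dest: reduced_tl)

lemma reduced_foldr_push: "reduced v \<Longrightarrow> reduced (foldr push u v)"
  by (induction u) (auto intro: reduced_push)

lemma letters_push: "fst ` set (push x w) \<subseteq> insert (fst x) (fst ` set w)"
  by (cases w) auto

lemma letters_foldr_push: "fst ` set (foldr push u v) \<subseteq> fst ` set u \<union> fst ` set v"
proof (induction u)
  case (Cons a u)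
  then show ?case
    using letters_push[of a "foldr push u v"]
    unfolding foldr.simps comp_apply list.set image_insert by blast
qed simp

lemma push_push_inv: "reduced w \<Longrightarrow> push x (push (inv_letter x) w) = w"
proof (cases w)
  case (Cons y v)
  assume "reduced w"
  then show ?thesis
    using Cons by (cases v) auto
qed simp

lemma foldr_push_push:
  assumes "reduced v"
  shows "foldr push (push x u) v = push x (foldr push u v)"
proof (cases u)
  case (Cons y w)
  then show ?thesis
    using push_push_inv[OF reduced_foldr_push[OF assms, of w], of x] by auto
qed simp

lemma foldr_push_assoc:
  "reduced w \<Longrightarrow> foldr push (foldr push u v) w = foldr push u (foldr push v w)"
  by (induction u) (auto simp: foldr_push_push)

lemma foldr_push_Nil: "reduced w \<Longrightarrow> foldr push w [] = w"
proof (induction w)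
  case (Cons x w)
  then show ?case
    by (cases w) auto
qed simp

lemma foldr_push_inverse:
  "reduced v \<Longrightarrow> foldr push (map inv_letter (rev u)) (foldr push u v) = v"
proof (induction u)
  case (Cons x u)
  then show ?case
    using push_push_inv[OF reduced_foldr_push[OF Cons.prems, of u], of "inv_letter x"] by simp
qed simp

lemma group_free_group: "group (free_group X)"
proof (rule groupI)
  fix u v assume "u \<in> carrier (free_group X)" "v \<in> carrier (free_group X)"
  then show "u \<otimes>\<^bsub>free_group X\<^esub> v \<in> carrier (free_group X)"
    using subset_trans[OF letters_foldr_push[of u v]] by (simp add: free_group_def reduced_foldr_push)
next
  fix u assume u: "u \<in> carrier (free_group X)"
  let ?v = "foldr push (map inv_letter (rev u)) []"
  have "?v \<in> carrier (free_group X)"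
    using u letters_foldr_push[of "map inv_letter (rev u)" "[]"]
    by (auto simp: free_group_def reduced_foldr_push image_image)
  moreover have "foldr push ?v u = []"
    using u foldr_push_inverse[of "[]" u]
    by (simp add: free_group_def foldr_push_assoc foldr_push_Nil)
  ultimately show "\<exists>v\<in>carrier (free_group X). v \<otimes>\<^bsub>free_group X\<^esub> u = \<one>\<^bsub>free_group X\<^esub>"
    by (auto simp: free_group_def)
qed (auto simp: free_group_def foldr_push_assoc)

lemma (in group) word_eval_closed:
  "s ` X \<subseteq> carrier G \<Longrightarrow> fst ` set w \<subseteq> X \<Longrightarrow> word_eval G s w \<in> carrier G"
  by (induction w) (auto simp: word_eval_def)

lemma (in group) word_eval_push:
  assumes "s ` X \<subseteq> carrier G" "fst x \<in> X" "fst ` set w \<subseteq> X"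
  shows "word_eval G s (push x w) = word_eval G s [x] \<otimes> word_eval G s w"
proof (cases w)
  case Nil
  then show ?thesis
    using assms by (cases x) (auto simp: word_eval_def)
next
  case (Cons y v)
  have c: "s (fst x) \<in> carrier G" "s (fst y) \<in> carrier G" "word_eval G s v \<in> carrier G"
    using assms Cons by (auto intro: word_eval_closed)
  show ?thesis
    using c Cons
    by (cases x; cases y) (auto simp: word_eval_def inv_letter_def m_assoc[symmetric])
qed

lemma (in group) word_eval_hom:
  assumes "s ` X \<subseteq> carrier G"
  shows "word_eval G s \<in> hom (free_group X) G"
proof (rule homI)
  fix w assume "w \<in> carrier (free_group X)"
  then show "word_eval G s w \<in> carrier G"
    using assms by (auto simp: free_group_def intro: word_eval_closed)
next
  have "word_eval G s (foldr push u v) = word_eval G s u \<otimes> word_eval G s v"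
    if "fst ` set u \<subseteq> X" "fst ` set v \<subseteq> X" for u v
    using that
  proof (induction u)
    case Nil
    then show ?case
      using word_eval_closed[OF assms, of v] by (simp add: word_eval_def)
  next
    case (Cons x u)
    have "fst ` set (foldr push u v) \<subseteq> X"
      using Cons.prems by (intro subset_trans[OF letters_foldr_push]) auto
    moreover have "word_eval G s (x # u) = word_eval G s [x] \<otimes> word_eval G s u"
      using assms Cons.prems word_eval_closed[OF assms, of u]
      by (cases x) (auto simp: word_eval_def)
    moreover have "word_eval G s [x] \<in> carrier G"
      using assms Cons.prems by (intro word_eval_closed) auto
    ultimately show ?case
      using Cons assms word_eval_closed[OF assms] by (simp add: word_eval_push m_assoc)
  qed
  then show "word_eval G s (u \<otimes>\<^bsub>free_group X\<^esub> v) = word_eval G s u \<otimes> word_eval G s v"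
    if "u \<in> carrier (free_group X)" "v \<in> carrier (free_group X)" for u v
    using that by (simp add: free_group_def)
qed


section \<open>The space of marked groups and limit groups\<close>

definition marking :: "('a, 'm) monoid_scheme \<Rightarrow> 'a list \<Rightarrow> bool" where
  "marking G S \<longleftrightarrow> set S \<subseteq> carrier G \<and> generate G (set S) = carrier G"

definition marking_kernel :: "('a, 'm) monoid_scheme \<Rightarrow> 'a list \<Rightarrow> nat letter list set" where
  "marking_kernel G S = kernel (free_group {..<length S}) G (word_eval G (\<lambda>i. S ! i))"

text \<open>A normal subgroup is identified with the restriction of its membership predicate to
  the free group, a point of the product space \<open>2\<^bsup>F\<^esup>\<close>.\<close>

definition marked_groups :: "nat \<Rightarrow> nat letter list set topology" where
  "marked_groups n =
    pullback_topology {N. N \<lhd> free_group {..<n}}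
      (\<lambda>N. \<lambda>w\<in>carrier (free_group {..<n}). w \<in> N)
      (product_topology (\<lambda>_. discrete_topology (UNIV :: bool set)) (carrier (free_group {..<n})))"

text \<open>A free group admitting a finite marking has finite rank, so the free groups
  \<open>free_group {..<m}\<close> suffice.\<close>

definition limit_group :: "('a, 'm) monoid_scheme \<Rightarrow> bool" where
  "limit_group G \<longleftrightarrow> group G \<and>
    (\<exists>S. marking G S \<and>
      (\<exists>(m :: nat \<Rightarrow> nat) (T :: nat \<Rightarrow> nat letter list list).
        (\<forall>k. marking (free_group {..<m k}) (T k) \<and> length (T k) = length S) \<and>
        limitin (marked_groups (length S))
          (\<lambda>k. marking_kernel (free_group {..<m k}) (T k)) (marking_kernel G S) sequentially))"

lemma marking_kernel_normal:
  assumes "group G" "marking G S"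
  shows "marking_kernel G S \<lhd> free_group {..<length S}"
proof -
  interpret G: group G by fact
  have "(\<lambda>i. S ! i) ` {..<length S} \<subseteq> carrier G"
    using assms by (auto simp: marking_def)
  then interpret h: group_hom "free_group {..<length S}" G "word_eval G (\<lambda>i. S ! i)"
    by (intro group_hom.intro group_hom_axioms.intro group_free_group G.word_eval_hom G.group_axioms)
  show ?thesis
    unfolding marking_kernel_def by (rule h.normal_kernel)
qed

lemma topspace_marked_groups: "topspace (marked_groups n) = {N. N \<lhd> free_group {..<n}}"
  by (auto simp: marked_groups_def topspace_pullback_topology)

lemma limitin_marked_groups:
  assumes "N \<lhd> free_group {..<n}" "\<And>k. Ns k \<lhd> free_group {..<n}"
  shows "limitin (marked_groups n) Ns N sequentially \<longleftrightarrow>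
    (\<forall>w\<in>carrier (free_group {..<n}). \<forall>\<^sub>F k in sequentially. w \<in> Ns k \<longleftrightarrow> w \<in> N)"
proof -
  let ?F = "carrier (free_group {..<n})"
  let ?f = "\<lambda>N. \<lambda>w\<in>?F. w \<in> N"
  let ?T = "product_topology (\<lambda>_. discrete_topology (UNIV :: bool set)) ?F"
  have 1: "limitin (marked_groups n) Ns N sequentially \<longleftrightarrow> limitin ?T (\<lambda>k. ?f (Ns k)) (?f N) sequentially"
  proof -
    let ?A = "{N. N \<lhd> free_group {..<n}}"
    have op: "openin (marked_groups n) U \<longleftrightarrow> (\<exists>V. openin ?T V \<and> U = ?f -` V \<inter> ?A)" for U
      unfolding marked_groups_def openin_pullback_topology ..
    have top: "?f N \<in> topspace ?T"
      by auto
    show ?thesis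
    proof
      assume lim: "limitin (marked_groups n) Ns N sequentially"
      show "limitin ?T (\<lambda>k. ?f (Ns k)) (?f N) sequentially"
        unfolding limitin_def
      proof (intro conjI allI impI)
        fix V assume V: "openin ?T V \<and> ?f N \<in> V"
        then have "openin (marked_groups n) (?f -` V \<inter> ?A)"
          unfolding op by (intro exI[of _ V] conjI refl) (rule conjunct1)
        moreover have "N \<in> ?f -` V \<inter> ?A"
          by (rule IntI, rule vimageI2) (use V assms(1) in simp_all)
        ultimately have "\<forall>\<^sub>F k in sequentially. Ns k \<in> ?f -` V \<inter> ?A"
          using lim by (simp add: limitin_def del: Int_iff vimage_eq)
        then show "\<forall>\<^sub>F k in sequentially. ?f (Ns k) \<in> V"
          by (rule eventually_mono) simp
      qed (rule top)
    next
      assume lim: "limitin ?T (\<lambda>k. ?f (Ns k)) (?f N) sequentially"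
      show "limitin (marked_groups n) Ns N sequentially"
        unfolding limitin_def topspace_marked_groups
      proof (intro conjI allI impI)
        fix U assume U: "openin (marked_groups n) U \<and> N \<in> U"
        then obtain V where V: "openin ?T V" "U = ?f -` V \<inter> ?A"
          using op by blast
        then have "\<forall>\<^sub>F k in sequentially. ?f (Ns k) \<in> V"
          using lim U by (simp add: limitin_def)
        then show "\<forall>\<^sub>F k in sequentially. Ns k \<in> U"
          by (rule eventually_mono) (simp add: V(2) assms(2))
      qed (simp add: assms(1))
    qed
  qed
  have 2: "limitin (discrete_topology UNIV) (\<lambda>k. ?f (Ns k) w) (?f N w) sequentially \<longleftrightarrow>
      (\<forall>\<^sub>F k in sequentially. w \<in> Ns k \<longleftrightarrow> w \<in> N)" if "w \<in> ?F" for w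
  proof
    assume "limitin (discrete_topology UNIV) (\<lambda>k. ?f (Ns k) w) (?f N w) sequentially"
    then have "\<forall>\<^sub>F k in sequentially. ?f (Ns k) w \<in> {?f N w}"
      unfolding limitin_def by (elim conjE allE[of _ "{?f N w}"] mp) simp
    then show "\<forall>\<^sub>F k in sequentially. w \<in> Ns k \<longleftrightarrow> w \<in> N"
      by (rule eventually_mono) (use that in simp)
  next
    assume ev: "\<forall>\<^sub>F k in sequentially. w \<in> Ns k \<longleftrightarrow> w \<in> N"
    show "limitin (discrete_topology UNIV) (\<lambda>k. ?f (Ns k) w) (?f N w) sequentially"
      unfolding limitin_def
    proof (intro conjI allI impI)
      fix U assume U: "openin (discrete_topology UNIV) U \<and> ?f N w \<in> U"
      show "\<forall>\<^sub>F k in sequentially. ?f (Ns k) w \<in> U"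
        using ev by (rule eventually_mono) (use U that in simp)
    qed simp
  qed
  show ?thesis
    unfolding 1 limitin_componentwise using 2 by simp
qed


section \<open>Group-theoretic properties\<close>

definition finitely_generated :: "('a, 'm) monoid_scheme \<Rightarrow> bool" where
  "finitely_generated G \<longleftrightarrow> (\<exists>A. finite A \<and> A \<subseteq> carrier G \<and> generate G A = carrier G)"

definition torsion_free :: "('a, 'm) monoid_scheme \<Rightarrow> bool" where
  "torsion_free G \<longleftrightarrow>
    (\<forall>x\<in>carrier G - {\<one>\<^bsub>G\<^esub>}. \<forall>n::nat. 0 < n \<longrightarrow> x [^]\<^bsub>G\<^esub> n \<noteq> \<one>\<^bsub>G\<^esub>)"

definition commutator :: "('a, 'm) monoid_scheme \<Rightarrow> 'a \<Rightarrow> 'a \<Rightarrow> 'a" where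
  "commutator G a b = a \<otimes>\<^bsub>G\<^esub> b \<otimes>\<^bsub>G\<^esub> inv\<^bsub>G\<^esub> a \<otimes>\<^bsub>G\<^esub> inv\<^bsub>G\<^esub> b"

definition commutative_transitive :: "('a, 'm) monoid_scheme \<Rightarrow> bool" where
  "commutative_transitive G \<longleftrightarrow>
    (\<forall>a\<in>carrier G - {\<one>\<^bsub>G\<^esub>}. \<forall>b\<in>carrier G - {\<one>\<^bsub>G\<^esub>}. \<forall>c\<in>carrier G - {\<one>\<^bsub>G\<^esub>}.
      commutator G a b = \<one>\<^bsub>G\<^esub> \<and> commutator G b c = \<one>\<^bsub>G\<^esub> \<longrightarrow> commutator G a c = \<one>\<^bsub>G\<^esub>)"

definition abelian_subgroup :: "'a set \<Rightarrow> ('a, 'm) monoid_scheme \<Rightarrow> bool" where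
  "abelian_subgroup H G \<longleftrightarrow> subgroup H G \<and> comm_group (G\<lparr>carrier := H\<rparr>)"

definition maximal_abelian_subgroup :: "'a set \<Rightarrow> ('a, 'm) monoid_scheme \<Rightarrow> bool" where
  "maximal_abelian_subgroup H G \<longleftrightarrow>
    abelian_subgroup H G \<and> (\<forall>K. abelian_subgroup K G \<and> H \<subseteq> K \<longrightarrow> K = H)"

definition malnormal :: "'a set \<Rightarrow> ('a, 'm) monoid_scheme \<Rightarrow> bool" where
  "malnormal H G \<longleftrightarrow>
    (\<forall>g\<in>carrier G - H. H \<inter> ((g <#\<^bsub>G\<^esub> H) #>\<^bsub>G\<^esub> inv\<^bsub>G\<^esub> g) = {\<one>\<^bsub>G\<^esub>})"

definition CSA :: "('a, 'm) monoid_scheme \<Rightarrow> bool" where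
  "CSA G \<longleftrightarrow> (\<forall>H. maximal_abelian_subgroup H G \<longrightarrow> malnormal H G)"

definition bi_orderable :: "('a, 'm) monoid_scheme \<Rightarrow> bool" where
  "bi_orderable G \<longleftrightarrow>
    (\<exists>r. linear_order_on (carrier G) r \<and>
      (\<forall>x\<in>carrier G. \<forall>y\<in>carrier G. \<forall>g\<in>carrier G. (x, y) \<in> r \<longrightarrow>
        (g \<otimes>\<^bsub>G\<^esub> x, g \<otimes>\<^bsub>G\<^esub> y) \<in> r \<and> (x \<otimes>\<^bsub>G\<^esub> g, y \<otimes>\<^bsub>G\<^esub> g) \<in> r))"


section \<open>The first Betti number\<close>

definition abelianization :: "('a, 'm) monoid_scheme \<Rightarrow> 'a set monoid" where
  "abelianization G = G Mod derived G (carrier G)"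

text \<open>For a (multiplicatively written) abelian group \<open>A\<close>, the tensor product of \<open>A\<close> with the
  rationals over the integers is the quotient of the free abelian group on the symbols \<open>(a, q)\<close>
  by the subgroup generated by the bilinearity relators. The rationals act by
  \<open>p \<odot> (a, q) = (a, p * q)\<close>.\<close>

definition tensor_symbols :: "('a, 'm) monoid_scheme \<Rightarrow> ('a \<times> rat \<Rightarrow>\<^sub>0 int) monoid" where
  "tensor_symbols A = free_Abelian_group (carrier A \<times> UNIV)"

definition bilinear_relators :: "('a, 'm) monoid_scheme \<Rightarrow> ('a \<times> rat \<Rightarrow>\<^sub>0 int) set" where
  "bilinear_relators A =
    {frag_of (a \<otimes>\<^bsub>A\<^esub> b, q) - frag_of (a, q) - frag_of (b, q) | a b q.
      a \<in> carrier A \<and> b \<in> carrier A} \<union>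
    {frag_of (a, p + q) - frag_of (a, p) - frag_of (a, q) | a p q. a \<in> carrier A}"

definition tensor_relations :: "('a, 'm) monoid_scheme \<Rightarrow> ('a \<times> rat \<Rightarrow>\<^sub>0 int) set" where
  "tensor_relations A = generate (tensor_symbols A) (bilinear_relators A)"

definition scale_symbols :: "rat \<Rightarrow> ('a \<times> rat \<Rightarrow>\<^sub>0 int) \<Rightarrow> ('a \<times> rat \<Rightarrow>\<^sub>0 int)" where
  "scale_symbols p = frag_extend (\<lambda>(a, q). frag_of (a, p * q))"

text \<open>A \<^theory>\<open>HOL-Algebra.Module\<close> record also has ring multiplication and unit fields; these are
  irrelevant for the module structure.\<close>

definition rat_tensor :: "('a, 'm) monoid_scheme \<Rightarrow> (rat, ('a \<times> rat \<Rightarrow>\<^sub>0 int) set) module" where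
  "rat_tensor A =
    (let F = tensor_symbols A; R = tensor_relations A in
      \<lparr>carrier = carrier (F Mod R), monoid.mult = undefined, one = undefined,
       zero = \<one>\<^bsub>F Mod R\<^esub>, add = (\<otimes>\<^bsub>F Mod R\<^esub>),
       module.smult = (\<lambda>p X. R <#>\<^bsub>F\<^esub> (scale_symbols p ` X))\<rparr>)"

text \<open>\<open>vectorspace.dim\<close> is meaningful only in finite dimension, which is the case here for
  finitely generated \<open>G\<close>.\<close>

definition first_betti :: "('a, 'm) monoid_scheme \<Rightarrow> nat" where
  "first_betti G = vectorspace.dim (class_ring :: rat ring) (rat_tensor (abelianization G))"

lemma comm_group_tensor_symbols: "comm_group (tensor_symbols A)"
  by (simp add: tensor_symbols_def abelian_free_Abelian_group)

lemma tensor_symbols_simps [simp]: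
  "c \<in> carrier (tensor_symbols A) \<longleftrightarrow> Poly_Mapping.keys c \<subseteq> carrier A \<times> UNIV"
  "c \<otimes>\<^bsub>tensor_symbols A\<^esub> d = c + d"
  "\<one>\<^bsub>tensor_symbols A\<^esub> = 0"
  by (auto simp: tensor_symbols_def)

lemma scale_symbols_simps [simp]:
  "scale_symbols p 0 = 0"
  "scale_symbols p (frag_of (a, q)) = frag_of (a, p * q)"
  "scale_symbols p (c + d) = scale_symbols p c + scale_symbols p d"
  "scale_symbols p (c - d) = scale_symbols p c - scale_symbols p d"
  "scale_symbols p (- c) = - scale_symbols p c"
  by (simp_all add: scale_symbols_def frag_extend_add frag_extend_diff frag_extend_minus)

lemma scale_symbols_closed:
  "c \<in> carrier (tensor_symbols A) \<Longrightarrow> scale_symbols p c \<in> carrier (tensor_symbols A)"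
  unfolding tensor_symbols_simps scale_symbols_def
  by (rule order_trans[OF keys_frag_extend]) auto

lemma keys_diff_subset:
  "Poly_Mapping.keys c \<subseteq> S \<Longrightarrow> Poly_Mapping.keys d \<subseteq> S \<Longrightarrow> Poly_Mapping.keys (c - d) \<subseteq> S"
  for c d :: "'b \<Rightarrow>\<^sub>0 int"
  using keys_diff[of c d] by blast

lemma bilinear_relators_cases:
  assumes "h \<in> bilinear_relators A"
  obtains a b q where "a \<in> carrier A" "b \<in> carrier A"
      "h = frag_of (a \<otimes>\<^bsub>A\<^esub> b, q) - frag_of (a, q) - frag_of (b, q)"
    | a p q where "a \<in> carrier A" "h = frag_of (a, p + q) - frag_of (a, p) - frag_of (a, q)"
  using assms unfolding bilinear_relators_def by blast

lemma bilinear_relatorsI1: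
  assumes "a \<in> carrier A" "b \<in> carrier A"
  shows "frag_of (a \<otimes>\<^bsub>A\<^esub> b, q) - frag_of (a, q) - frag_of (b, q) \<in> bilinear_relators A"
  unfolding bilinear_relators_def
  by (intro UnI1 CollectI exI[of _ a] exI[of _ b] exI[of _ q] conjI refl assms)

lemma bilinear_relatorsI2:
  assumes "a \<in> carrier A"
  shows "frag_of (a, p + q) - frag_of (a, p) - frag_of (a, q) \<in> bilinear_relators A"
  unfolding bilinear_relators_def
  by (intro UnI2 CollectI exI[of _ a] exI[of _ p] exI[of _ q] conjI refl assms)

lemma bilinear_relators_closed:
  assumes "group A" "h \<in> bilinear_relators A"
  shows "h \<in> carrier (tensor_symbols A)"
proof -
  interpret A: group A by fact
  show ?thesis
    using assms(2)
    by (cases rule: bilinear_relators_cases)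
       (simp_all only: tensor_symbols_simps, (intro keys_diff_subset; simp)+)
qed

lemma scale_bilinear_relators:
  assumes "h \<in> bilinear_relators A"
  shows "scale_symbols p h \<in> bilinear_relators A"
  using assms
  by (cases rule: bilinear_relators_cases)
     (simp_all add: distrib_left bilinear_relatorsI1 bilinear_relatorsI2)

lemma subgroup_tensor_relations:
  assumes "group A"
  shows "subgroup (tensor_relations A) (tensor_symbols A)"
proof -
  interpret F: comm_group "tensor_symbols A" by (rule comm_group_tensor_symbols)
  show ?thesis
    unfolding tensor_relations_def
    by (rule F.generate_is_subgroup) (rule subsetI, rule bilinear_relators_closed[OF assms])
qed

lemma inv_tensor_symbols:
  "h \<in> carrier (tensor_symbols A) \<Longrightarrow> inv\<^bsub>tensor_symbols A\<^esub> h = - h"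
  unfolding tensor_symbols_simps by (simp add: tensor_symbols_def)

lemma tensor_relations_diff:
  assumes "group A" "c \<in> tensor_relations A" "d \<in> tensor_relations A"
  shows "c - d \<in> tensor_relations A"
proof -
  interpret R: subgroup "tensor_relations A" "tensor_symbols A"
    using assms(1) by (rule subgroup_tensor_relations)
  show ?thesis
    using R.m_closed[OF assms(2) R.m_inv_closed[OF assms(3)]]
      inv_tensor_symbols[OF R.mem_carrier[OF assms(3)]] by simp
qed

lemma scale_tensor_relations:
  assumes "group A" "c \<in> tensor_relations A"
  shows "scale_symbols p c \<in> tensor_relations A"
  using assms(2) unfolding tensor_relations_def
proof (induction rule: generate.induct)
  case one
  then show ?case
    using generate.one[of "tensor_symbols A"] by simp
next
  case (incl h)
  then show ?case
    by (intro generate.incl scale_bilinear_relators)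
next
  case (inv h)
  then have "scale_symbols p (inv\<^bsub>tensor_symbols A\<^esub> h) = inv\<^bsub>tensor_symbols A\<^esub> (scale_symbols p h)"
    using bilinear_relators_closed[OF assms(1)] scale_bilinear_relators[of h A p]
    by (metis inv_tensor_symbols scale_symbols_simps(5))
  then show ?case
    using generate.inv[OF scale_bilinear_relators[OF inv]] by (simp only:)
next
  case (eng h k)
  have "scale_symbols p (h \<otimes>\<^bsub>tensor_symbols A\<^esub> k) =
      scale_symbols p h \<otimes>\<^bsub>tensor_symbols A\<^esub> scale_symbols p k"
    by simp
  then show ?case
    using generate.eng[OF eng.IH] by (simp only:)
qed

lemma scale_add_tensor_relations:
  assumes "group A" "c \<in> carrier (tensor_symbols A)"
  shows "scale_symbols (p + q) c - (scale_symbols p c + scale_symbols q c) \<in> tensor_relations A"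
proof -
  interpret R: subgroup "tensor_relations A" "tensor_symbols A"
    using assms(1) by (rule subgroup_tensor_relations)
  have "Poly_Mapping.keys c \<subseteq> carrier A \<times> UNIV"
    using assms(2) by simp
  then show ?thesis
  proof (induction c rule: frag_induction)
    case zero
    then show ?case
      using R.one_closed by simp
  next
    case (diff x y)
    then show ?case
      using tensor_relations_diff[OF assms(1) diff] by (simp add: algebra_simps)
  next
    case (one s)
    then obtain a r where s: "s = (a, r)" "a \<in> carrier A"
      by auto
    have "frag_of (a, p * r + q * r) - frag_of (a, p * r) - frag_of (a, q * r) \<in> tensor_relations A"
      unfolding tensor_relations_def by (intro generate.incl bilinear_relatorsI2 s)
    then show ?case
      by (simp add: s distrib_right diff_diff_eq)
  qed
qed

lemma scale_scale_symbols [simp]: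
  "scale_symbols p (scale_symbols q c) = scale_symbols (p * q) c"
  using subset_UNIV[of "Poly_Mapping.keys c"]
  by (induction c rule: frag_induction) (auto simp: mult.assoc)

lemma scale_one_symbols [simp]: "scale_symbols 1 c = c"
  using subset_UNIV[of "Poly_Mapping.keys c"]
  by (induction c rule: frag_induction) auto

lemma vectorspace_rat_tensor:
  assumes "group A"
  shows "vectorspace class_ring (rat_tensor A)"
proof -
  let ?F = "tensor_symbols A" and ?R = "tensor_relations A" and ?V = "rat_tensor A"
  interpret F: comm_group ?F by (rule comm_group_tensor_symbols)
  interpret R: subgroup ?R ?F using assms by (rule subgroup_tensor_relations)
  interpret N: normal ?R ?F
    using R.subgroup_axioms by (rule F.normal_iff_subgroup[THEN iffD2])
  interpret Q: comm_group "?F Mod ?R"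
    using R.subgroup_axioms by (rule F.abelian_FactGroup)
  define cl where "cl c = ?R #>\<^bsub>?F\<^esub> c" for c
  have carr: "carrier ?V = cl ` carrier ?F"
    by (auto simp: rat_tensor_def Let_def FactGroup_def RCOSETS_def cl_def)
  have carr': "carrier ?V = carrier (?F Mod ?R)"
    by (simp add: rat_tensor_def Let_def)
  have add': "X \<oplus>\<^bsub>?V\<^esub> Y = X \<otimes>\<^bsub>?F Mod ?R\<^esub> Y" for X Y
    by (simp add: rat_tensor_def Let_def)
  have zero': "\<zero>\<^bsub>?V\<^esub> = \<one>\<^bsub>?F Mod ?R\<^esub>"
    by (simp add: rat_tensor_def Let_def)
  have add: "cl c \<oplus>\<^bsub>?V\<^esub> cl d = cl (c + d)"
    if "c \<in> carrier ?F" "d \<in> carrier ?F" for c d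
    using N.rcos_sum[OF that] by (simp add: add' cl_def)
  have cl_eq: "cl c = cl d" if "c \<in> carrier ?F" "d \<in> carrier ?F" "c - d \<in> ?R" for c d
  proof -
    have "c = (c - d) \<otimes>\<^bsub>?F\<^esub> d" by simp
    then have "c \<in> cl d"
      using that(3) unfolding cl_def r_coset_def by blast
    then show ?thesis
      using F.repr_independence that(2) R.subgroup_axioms unfolding cl_def by blast
  qed
  have smult: "p \<odot>\<^bsub>?V\<^esub> cl c = cl (scale_symbols p c)" if "c \<in> carrier ?F" for p c
  proof -
    have "?R <#>\<^bsub>?F\<^esub> (scale_symbols p ` cl c) = cl (scale_symbols p c)"
    proof (intro equalityI subsetI)
      fix x assume "x \<in> ?R <#>\<^bsub>?F\<^esub> (scale_symbols p ` cl c)"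
      then obtain r r' where r: "r \<in> ?R" "r' \<in> ?R" "x = r + scale_symbols p (r' + c)"
        by (auto simp: set_mult_def cl_def r_coset_def)
      then have "x = (r \<otimes>\<^bsub>?F\<^esub> scale_symbols p r') \<otimes>\<^bsub>?F\<^esub> scale_symbols p c"
        by (simp add: add.assoc)
      moreover have "r \<otimes>\<^bsub>?F\<^esub> scale_symbols p r' \<in> ?R"
        using r(1) scale_tensor_relations[OF assms r(2)] by (rule R.m_closed)
      ultimately show "x \<in> cl (scale_symbols p c)"
        unfolding cl_def r_coset_def by blast
    next
      fix x assume "x \<in> cl (scale_symbols p c)"
      moreover have "c \<in> cl c"
        using R.one_closed by (auto simp: cl_def r_coset_def)
      ultimately show "x \<in> ?R <#>\<^bsub>?F\<^esub> (scale_symbols p ` cl c)"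
        unfolding set_mult_def cl_def[of "scale_symbols p c"] r_coset_def by blast
    qed
    then show ?thesis
      by (simp add: rat_tensor_def Let_def)
  qed
  have ab: "abelian_group ?V"
  proof (rule abelian_groupI)
    fix X assume "X \<in> carrier ?V"
    then show "\<exists>Y\<in>carrier ?V. Y \<oplus>\<^bsub>?V\<^esub> X = \<zero>\<^bsub>?V\<^esub>"
      unfolding add' zero' carr' using Q.inv_closed Q.l_inv by blast
  qed (simp_all add: add' zero' carr' Q.m_ac del: mult_FactGroup one_FactGroup)
  have "cring (class_ring :: rat ring)"
    by (rule domain.axioms(1)[OF field.axioms(1)[OF class_field]])
  then have "module class_ring ?V"
  proof (rule moduleI[OF _ ab])
    fix p :: rat and X assume "X \<in> carrier ?V"
    then show "p \<odot>\<^bsub>?V\<^esub> X \<in> carrier ?V"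
      using smult scale_symbols_closed unfolding carr by blast
  next
    fix p q :: rat and X assume "X \<in> carrier ?V"
    then obtain c where c: "c \<in> carrier ?F" "X = cl c"
      unfolding carr by blast
    have "cl (scale_symbols (p + q) c) = cl (scale_symbols p c + scale_symbols q c)"
      using scale_symbols_closed[OF c(1)] F.m_closed scale_add_tensor_relations[OF assms c(1)]
      by (intro cl_eq) (metis tensor_symbols_simps(2))+
    then show "(p \<oplus>\<^bsub>class_ring\<^esub> q) \<odot>\<^bsub>?V\<^esub> X = p \<odot>\<^bsub>?V\<^esub> X \<oplus>\<^bsub>?V\<^esub> q \<odot>\<^bsub>?V\<^esub> X"
      using scale_symbols_closed[OF c(1)] by (simp only: c smult add ring.simps)
    show "(p \<otimes>\<^bsub>class_ring\<^esub> q) \<odot>\<^bsub>?V\<^esub> X = p \<odot>\<^bsub>?V\<^esub> (q \<odot>\<^bsub>?V\<^esub> X)"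
      using scale_symbols_closed[OF c(1)]
      by (simp only: c smult scale_scale_symbols monoid.simps)
    show "\<one>\<^bsub>class_ring\<^esub> \<odot>\<^bsub>?V\<^esub> X = X"
      by (simp only: c smult scale_one_symbols monoid.simps)
  next
    fix p :: rat and X Y assume "X \<in> carrier ?V" "Y \<in> carrier ?V"
    then obtain c d where c: "c \<in> carrier ?F" "X = cl c" "d \<in> carrier ?F" "Y = cl d"
      unfolding carr by blast
    moreover have "c + d \<in> carrier ?F"
      using F.m_closed[OF c(1,3)] by simp
    ultimately show "p \<odot>\<^bsub>?V\<^esub> (X \<oplus>\<^bsub>?V\<^esub> Y) = p \<odot>\<^bsub>?V\<^esub> X \<oplus>\<^bsub>?V\<^esub> p \<odot>\<^bsub>?V\<^esub> Y"
      using scale_symbols_closed[OF c(1)] scale_symbols_closed[OF c(3)]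
      by (simp only: smult add scale_symbols_simps)
  qed
  then show ?thesis
    by (rule vectorspace.intro) (rule class_field)
qed

end

theory Submission
  imports Defs "HOL-Algebra.Sym_Groups" "HOL-Library.Diagonal_Subsequence"
begin

text \<open>The elementary properties pass from free groups to a limit \<open>G\<close> of
  free groups: an element of \<open>G\<close> is the value of a word, and finitely many equations and
  inequations between values of words hold in \<open>G\<close> iff they hold in all but finitely many of the
  approximating free groups.

  Free groups act on functions of words in non-commuting variables by \<open>e\<^sub>x \<mapsto> 1 + x\<close>; the sign of the
  leading coefficient of the Magnus expansion so obtained defines a bi-invariant order. The signs of a word
  in the approximating groups need not stabilise, but they do along a subsequence, uniformly for the
  countably many words; this orders \<open>G\<close>, so that \<open>G\<close> is also torsion-free.

  Finitely generated subgroups of free groups are free (Nielsen--Schreier), hence the statement on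
  subgroups. Two non-commuting elements of a free group generate a free group of rank at least 2,
  of which they are a basis because free groups are residually finite. That free groups are
  commutative transitive follows from Nielsen--Schreier and the triviality of the centre of free
  groups of rank at least 2; the CSA property holds because \<open>h\<close> and
  \<open>g h g\<^sup>-\<^sup>1\<close> do not commute if \<open>g\<close> and \<open>h\<close> are free generators.

  The abelianisation of \<open>G\<close> has finitely many defining relations, which eventually hold in the
  approximating groups; so their abelianisations are eventually quotients of that of \<open>G\<close>, and their
  ranks are at least 1 if \<open>G\<close> is non-trivial, and at least 2 if \<open>G\<close> is non-abelian.\<close>


section \<open>The Magnus action\<close>

text \<open>A property that quantifies over subgroups cannot be tested in the approximating groups.
  CSA is therefore reduced to pairs: if \<open>h\<close> commutes with its conjugate by
  \<open>g\<close>, then \<open>g\<close> commutes with \<open>h\<close>; together with commutative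
  transitivity this gives malnormality. Freeness of a pair is likewise tested one word at a time.

  The obstacle for the Betti number is that \<open>G\<close> is not known to be finitely presented:
  each relator holds from some index on, but this index depends on the relator, so that no
  approximating group need be a quotient of \<open>G\<close>. In the abelianisation finitely many
  relators imply all others over the rationals, and one index serves for all.

  Bi-invariance of the order rests on the lowest-degree part of a Magnus series minus 1:
  multiplication by a series with constant term 1, on either side, leaves that part alone.\<close>

fun magnus_act :: "'x letter \<Rightarrow> ('x list \<Rightarrow> int) \<Rightarrow> 'x list \<Rightarrow> int" where
  "magnus_act (x, b) f [] = f []"
| "magnus_act (x, b) f (y # v) =
    f (y # v) + (if y \<noteq> x then 0 else if b then f v else - magnus_act (x, b) f v)"

definition magnus :: "'x letter list \<Rightarrow> 'x list \<Rightarrow> int" where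
  "magnus w = foldr magnus_act w (\<lambda>v. if v = [] then 1 else 0)"

text \<open>On series in non-commuting variables, \<open>(x, True)\<close> is left multiplication by
  \<open>1 + x\<close>; the clause for \<open>(x, False)\<close> solves \<open>(1 + x) g = f\<close>
  for \<open>g\<close>, one letter of the word at a time. So the two undo each other.\<close>

lemma magnus_act_inv_letter [simp]: "magnus_act l (magnus_act (inv_letter l) f) = f"
proof
  fix v show "magnus_act l (magnus_act (inv_letter l) f) v = f v"
  proof (induction v)
    case (Cons y v)
    then show ?case by (cases l) (auto simp: inv_letter_def)
  qed (cases l, simp add: inv_letter_def)
qed

lemma magnus_act_add: "magnus_act l (\<lambda>v. f v + g v) v = magnus_act l f v + magnus_act l g v"
proof (induction v)
  case (Cons y v)
  then show ?case by (cases l) auto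
qed (cases l, simp)

lemma magnus_Nil: "magnus [] v = (if v = [] then 1 else 0)"
  by (simp add: magnus_def)

lemma magnus_Cons: "magnus (l # w) = magnus_act l (magnus w)"
  by (simp add: magnus_def)

lemma foldr_magnus_act_push:
  "foldr magnus_act (push l w) f = magnus_act l (foldr magnus_act w f)"
  by (cases w) auto

lemma foldr_magnus_act_mult:
  "foldr magnus_act (foldr push u w) f = foldr magnus_act u (foldr magnus_act w f)"
  by (induction u) (auto simp: foldr_magnus_act_push)

lemma foldr_magnus_act_add:
  "foldr magnus_act w (\<lambda>v. f v + g v) v = foldr magnus_act w f v + foldr magnus_act w g v"
proof (induction w arbitrary: v)
  case (Cons l w)
  have "foldr magnus_act w (\<lambda>v. f v + g v) = (\<lambda>v. foldr magnus_act w f v + foldr magnus_act w g v)"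
    using Cons by blast
  then show ?case by (simp add: magnus_act_add)
qed simp

lemma magnus_mult: "magnus (foldr push u w) = foldr magnus_act u (magnus w)"
  by (simp add: magnus_def foldr_magnus_act_mult)

text \<open>Multiplication by \<open>1 + x\<close> or its inverse changes the coefficient at a word
  only by coefficients at shorter words, and up to length \<open>n\<close> these vanish.\<close>

lemma magnus_act_leading:
  assumes "\<And>u. length u < n \<Longrightarrow> f u = 0" "length v \<le> n"
  shows "magnus_act l f v = f v"
  using assms(2)
proof (induction v)
  case (Cons y v)
  then show ?case
    using assms(1)[of v] by (cases l) auto
qed (cases l; simp)

lemma foldr_magnus_act_leading:
  assumes "\<And>u. length u < n \<Longrightarrow> f u = 0" "length v \<le> n"
  shows "foldr magnus_act w f v = f v"
  using assms(2)
proof (induction w arbitrary: v)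
  case (Cons l w)
  have "foldr magnus_act w f u = 0" if "length u < n" for u
    using Cons.IH[of u] assms(1)[of u] that by simp
  then show ?case
    using magnus_act_leading[of n "foldr magnus_act w f" v l] Cons by simp
qed simp

lemma foldr_magnus_act_uminus: "foldr magnus_act w (\<lambda>v. - f v) v = - foldr magnus_act w f v"
  using foldr_magnus_act_add[of w f "\<lambda>v. - f v" v]
    foldr_magnus_act_leading[of "length v" "\<lambda>v. 0" v w] by simp

text \<open>The Cauchy product of series: the recursion sums \<open>f\<close> of a prefix times
  \<open>g\<close> of the remaining suffix. It supplies the right multiplication that conjugation
  needs and that the left action lacks.\<close>

fun series_mult :: "('x list \<Rightarrow> int) \<Rightarrow> ('x list \<Rightarrow> int) \<Rightarrow> 'x list \<Rightarrow> int" where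
  "series_mult f g [] = f [] * g []"
| "series_mult f g (y # v) = f [] * g (y # v) + series_mult (\<lambda>u. f (y # u)) g v"

lemma series_mult_add:
  "series_mult (\<lambda>u. f u + f' u) g v = series_mult f g v + series_mult f' g v"
  by (induction v arbitrary: f f') (simp_all add: algebra_simps)

lemma series_mult_zero: "series_mult (\<lambda>u. 0) g v = 0"
  by (induction v) simp_all

lemma series_mult_uminus: "series_mult (\<lambda>u. - f u) g v = - series_mult f g v"
  by (induction v arbitrary: f) simp_all

lemma series_mult_magnus_act:
  "series_mult (magnus_act l f) g v = magnus_act l (series_mult f g) v"
proof (induction v)
  case (Cons y v)
  obtain x b where l: "l = (x, b)" by force
  have eq: "(\<lambda>u. magnus_act l f (y # u)) =
    (\<lambda>u. f (y # u) + (if y \<noteq> x then 0 else if b then f u else - magnus_act l f u))"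
    by (simp add: l fun_eq_iff)
  show ?case
  proof (cases "y = x")
    case True
    then show ?thesis
      using Cons unfolding series_mult.simps eq series_mult_add
      by (cases b) (simp_all add: l series_mult_uminus)
  next
    case False
    then show ?thesis
      unfolding series_mult.simps eq series_mult_add by (simp add: l series_mult_zero)
  qed
qed (cases l; simp)

lemma series_mult_one: "series_mult (\<lambda>v. if v = [] then 1 else 0) g v = g v"
  by (cases v) (simp_all add: series_mult_zero)

lemma series_mult_magnus: "series_mult (magnus w) g = foldr magnus_act w g"
proof (induction w)
  case Nil
  then show ?case by (simp add: magnus_def series_mult_one fun_eq_iff)
next
  case (Cons l w)
  then show ?case by (intro ext) (simp add: magnus_Cons series_mult_magnus_act)
qed

text \<open>Every splitting of \<open>v\<close> except the one with empty suffix evaluates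
  \<open>f\<close> at a word shorter than \<open>v\<close>.\<close>

lemma series_mult_leading:
  assumes "\<And>u. length u < length v \<Longrightarrow> f u = 0"
  shows "series_mult f g v = f v * g []"
  using assms
proof (induction v arbitrary: f)
  case (Cons y v)
  have "series_mult (\<lambda>u. f (y # u)) g v = f (y # v) * g []"
    by (rule Cons.IH) (simp add: Cons.prems)
  then show ?case using Cons.prems[of "[]"] by simp
qed simp

lemma magnus_at_Nil [simp]: "magnus w [] = 1"
proof (induction w)
  case (Cons l w)
  then show ?case by (cases l) (simp add: magnus_Cons)
qed (simp add: magnus_Nil)

lemma magnus_act_other: "v = [] \<or> hd v \<noteq> x \<Longrightarrow> magnus_act (x, b) f v = f v"
  by (cases v) auto

lemma magnus_act_same:
  assumes "distinct_adj (x # v)"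
  shows "magnus_act (x, b) f (x # v) = f (x # v) + (if b then f v else - f v)"
  using assms by (cases v) auto

text \<open>The coefficient at the syllable word of a reduced word is, up to sign, the product of the
  absolute values of the syllable exponents; the induction on letters tracks it together with the
  coefficient at its tail.\<close>

lemma magnus_syllables:
  fixes x :: 'x and b :: bool and w :: "'x letter list"
  defines "s \<equiv> remdups_adj (map fst ((x, b) # w))"
  assumes "reduced ((x, b) # w)"
  shows "(if b then 1 else - 1) * magnus ((x, b) # w) s * magnus ((x, b) # w) (tl s) > 0"
    and "distinct_adj v \<Longrightarrow> length v > length s \<or> length v = length s \<and> hd v \<noteq> x \<Longrightarrow>
      magnus ((x, b) # w) v = 0"
  using assms(2) unfolding s_def
proof (induction w arbitrary: x b v)
  case Nil
  {
    case 1
    show ?case by (simp add: magnus_def)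
  next
    case 2
    then obtain y v' where v: "v = y # v'" by (cases v) auto
    show ?case
    proof (cases "y = x")
      case True
      then have "v' \<noteq> []" "distinct_adj (x # v')" using 2 v by auto
      then show ?thesis using True v by (cases v') (auto simp: magnus_def magnus_act_same)
    next
      case False
      then show ?thesis using v by (simp add: magnus_def)
    qed
  }
next
  case (Cons l w)
  obtain y c where l: "l = (y, c)" by force
  define f where "f = magnus ((y, c) # w)"
  define t where "t = remdups_adj (map fst ((y, c) # w))"
  define t' where "t' = tl t"
  have t: "t = y # t'" unfolding t'_def t_def by (metis list.collapse list.sel(1) list.simps(9) fst_conv
      hd_remdups_adj remdups_adj_Nil_iff list.distinct(1))
  have dt: "distinct_adj t" unfolding t_def by (rule distinct_adj_remdups_adj)
  have red: "reduced ((y, c) # w)" if "reduced ((x, b) # l # w)" for x b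
    using that unfolding l by (rule reduced_tl)
  have mag: "magnus ((x, b) # l # w) = magnus_act (x, b) f" for x b
    by (simp add: magnus_Cons f_def l)
  {
    case 1
    have IH: "(if c then 1 else - 1) * f t * f t' > 0"
      using Cons.IH(1)[OF red[OF 1]] by (simp add: f_def t_def t'_def)
    have IH2: "f v = 0" if "distinct_adj v" "length v > length t \<or> length v = length t \<and> hd v \<noteq> y" for v
      using Cons.IH(2)[OF that(1) _ red[OF 1]] that(2) by (simp add: f_def t_def)
    show ?case
    proof (cases "x = y")
      case True
      then have "b = c" using 1 by (auto simp: l inv_letter_def)
      have s: "remdups_adj (map fst ((x, b) # l # w)) = t"
        using True by (simp add: l t_def)
      have ft: "magnus ((x, b) # l # w) t = f t + (if b then f t' else - f t')"
        using dt unfolding mag t True by (rule magnus_act_same)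
      have ft': "magnus ((x, b) # l # w) t' = f t'"
        unfolding mag by (rule magnus_act_other) (use dt t True in \<open>cases t'; auto\<close>)
      \<comment> \<open>Within a syllable the exponent only grows in absolute value: by the
        induction hypothesis \<open>f t\<close> and the term added to it have the same sign, so the
        sum cannot vanish.\<close>
      have "f t' * f t' > 0"
        using IH by (auto simp: zero_less_mult_iff split: if_splits)
      then show ?thesis
        using IH unfolding s ft t'_def[symmetric] ft' using \<open>b = c\<close>
        by (cases c) (simp_all add: algebra_simps)
    next
      case False
      then have s: "remdups_adj (map fst ((x, b) # l # w)) = x # t"
        by (simp add: l t_def)
      have d: "distinct_adj (x # t)" using dt t False by auto
      \<comment> \<open>A new syllable makes the syllable word longer than \<open>t\<close>, where
        \<open>f\<close> still vanishes; this is what the second claim is proved alongside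
        for.\<close>
      have "f (x # t) = 0" using IH2[OF d] by simp
      then have "magnus ((x, b) # l # w) (x # t) = (if b then f t else - f t)"
        unfolding mag magnus_act_same[OF d] by simp
      moreover have "magnus ((x, b) # l # w) t = f t"
        unfolding mag by (rule magnus_act_other) (use False t in auto)
      moreover have "f t * f t > 0"
        using IH by (auto simp: zero_less_mult_iff split: if_splits)
      ultimately show ?thesis unfolding s by simp
    qed
  next
    case 2
    have IH2: "f v = 0" if "distinct_adj v" "length v > length t \<or> length v = length t \<and> hd v \<noteq> y" for v
      using Cons.IH(2)[OF that(1) _ red[OF 2(3)]] that(2) by (simp add: f_def t_def)
    have len: "length (remdups_adj (map fst ((x, b) # l # w))) = (if x = y then 0 else 1) + length t"
      by (auto simp: l t_def)
    have fv: "f v = 0" using 2(1,2) unfolding len by (intro IH2) (auto split: if_splits)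
    show ?case
    proof (cases "v \<noteq> [] \<and> hd v = x")
      case True
      then obtain v' where v: "v = x # v'" by (metis list.collapse)
      \<comment> \<open>If \<open>v'\<close> is exactly as long as \<open>t\<close>, then
        \<open>x = y\<close>, and \<open>distinct_adj\<close> makes the head of \<open>v'\<close>
        differ from \<open>y\<close>: the origin of the head condition in the claim.\<close>
      have "f v' = 0"
        using 2(1,2) v t unfolding len
        by (intro IH2) (auto simp: distinct_adj_Cons split: if_splits)
      then show ?thesis using fv 2(1) unfolding mag v by (subst magnus_act_same) auto
    next
      case False
      then show ?thesis unfolding mag using fv by (subst magnus_act_other) auto
    qed
  }
qed

text \<open>The Magnus action is faithful: a non-empty reduced word has a non-empty syllable word,
  and the coefficient there is not zero.\<close>

lemma magnus_eq_one_iff: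
  assumes "reduced w"
  shows "magnus w = (\<lambda>v. if v = [] then 1 else 0) \<longleftrightarrow> w = []"
proof
  assume m: "magnus w = (\<lambda>v. if v = [] then 1 else 0)"
  show "w = []"
  proof (rule ccontr)
    assume "w \<noteq> []"
    then obtain x b w' where w: "w = (x, b) # w'" by (metis list.exhaust surj_pair)
    have "remdups_adj (map fst w) \<noteq> []" using w by simp
    then show False
      using magnus_syllables(1)[of x b w'] assms unfolding w[symmetric] m by simp
  qed
qed (simp add: magnus_def)


section \<open>Positive cones\<close>

text \<open>The order on words compares lengths before letters, so the leading coefficient lies in
  the lowest-degree part.\<close>

definition leading_pos :: "'x rel \<Rightarrow> ('x list \<Rightarrow> int) \<Rightarrow> bool" where
  "leading_pos r f \<longleftrightarrow> (\<exists>v. f v > 0 \<and> (\<forall>u. (u, v) \<in> lenlex r \<longrightarrow> f u = 0))"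

text \<open>The leading coefficient depends only on the part of lowest degree, and the second
  hypothesis says that \<open>g\<close> has the same such part as \<open>f\<close>.\<close>

lemma leading_pos_cong:
  assumes "leading_pos r f"
    and "\<And>n v. (\<And>u. length u < n \<Longrightarrow> f u = 0) \<Longrightarrow> length v \<le> n \<Longrightarrow> g v = f v"
  shows "leading_pos r g"
proof -
  obtain v where v: "f v > 0" "\<And>u. (u, v) \<in> lenlex r \<Longrightarrow> f u = 0"
    using assms(1) by (auto simp: leading_pos_def)
  have "f u = 0" if "length u < length v" for u
    using that by (intro v) (auto simp: lenlex_conv)
  then have "g u = f u" if "length u \<le> length v" for u
    using assms(2)[of "length v" u] that by blast
  then have "g v = f v" "\<And>u. (u, v) \<in> lenlex r \<Longrightarrow> g u = f u"
    by (auto dest: lenlex_length)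
  then show ?thesis
    using v unfolding leading_pos_def by (intro exI[of _ v]) simp
qed

lemma leading_pos_add:
  assumes r: "trans r" "total r" and "leading_pos r f" "leading_pos r g"
  shows "leading_pos r (\<lambda>v. f v + g v)"
proof -
  obtain v where v: "f v > 0" "\<And>u. (u, v) \<in> lenlex r \<Longrightarrow> f u = 0"
    using assms(3) by (auto simp: leading_pos_def)
  obtain w where w: "g w > 0" "\<And>u. (u, w) \<in> lenlex r \<Longrightarrow> g u = 0"
    using assms(4) by (auto simp: leading_pos_def)
  have trans: "(u, w) \<in> lenlex r" if "(u, v) \<in> lenlex r" "(v, w) \<in> lenlex r" for u v w
    using lenlex_transI[OF r(1)] that by (rule transD)
  consider "v = w" | "(v, w) \<in> lenlex r" | "(w, v) \<in> lenlex r"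
    using total_lenlex[OF r(2)] unfolding total_on_def by blast
  then show ?thesis
  proof cases
    case 1
    then have "f v + g v > 0" using v(1) w(1) by simp
    moreover have "f u + g u = 0" if "(u, v) \<in> lenlex r" for u
      using v(2) w(2) that 1 by simp
    ultimately show ?thesis unfolding leading_pos_def by blast
  next
    case 2
    then have "f v + g v > 0" using v(1) w(2) by simp
    moreover have "f u + g u = 0" if "(u, v) \<in> lenlex r" for u
      using v(2)[OF that] w(2)[OF trans[OF that 2]] by simp
    ultimately show ?thesis unfolding leading_pos_def by blast
  next
    case 3
    then have "f w + g w > 0" using w(1) v(2) by simp
    moreover have "f u + g u = 0" if "(u, w) \<in> lenlex r" for u
      using w(2)[OF that] v(2)[OF trans[OF that 3]] by simp
    ultimately show ?thesis unfolding leading_pos_def by blast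
  qed
qed

lemma leading_pos_uminus:
  assumes "trans r" "total r" "leading_pos r f"
  shows "\<not> leading_pos r (\<lambda>v. - f v)"
proof
  assume "leading_pos r (\<lambda>v. - f v)"
  from leading_pos_add[OF assms this] show False
    by (simp add: leading_pos_def)
qed

lemma leading_pos_cases:
  assumes "wf r" "total r" "f v \<noteq> 0"
  shows "leading_pos r f \<or> leading_pos r (\<lambda>v. - f v)"
proof -
  have "wf (lenlex r)" using assms(1) by (rule wf_lenlex)
  then obtain w where "w \<in> {w. f w \<noteq> 0}" "\<And>u. (u, w) \<in> lenlex r \<Longrightarrow> u \<notin> {w. f w \<noteq> 0}"
    by (rule wfE_min[where Q = "{w. f w \<noteq> 0}" and x = v]) (use assms(3) in auto)
  then show ?thesis
    unfolding leading_pos_def by (cases "f w > 0") (blast, intro disjI2 exI[of _ w], simp)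
qed

text \<open>The elements above the identity for a bi-order; the third clause excludes the identity,
  which is its own inverse. A predicate on elements passes to a limit word by word.\<close>

definition positive_cone :: "('a, 'm) monoid_scheme \<Rightarrow> ('a \<Rightarrow> bool) \<Rightarrow> bool" where
  "positive_cone G P \<longleftrightarrow>
    (\<forall>x\<in>carrier G. \<forall>y\<in>carrier G. P x \<longrightarrow> P y \<longrightarrow> P (x \<otimes>\<^bsub>G\<^esub> y)) \<and>
    (\<forall>x\<in>carrier G. \<forall>g\<in>carrier G. P x \<longrightarrow> P (g \<otimes>\<^bsub>G\<^esub> x \<otimes>\<^bsub>G\<^esub> inv\<^bsub>G\<^esub> g)) \<and>
    (\<forall>x\<in>carrier G. P x \<longrightarrow> \<not> P (inv\<^bsub>G\<^esub> x)) \<and>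
    (\<forall>x\<in>carrier G. P x \<or> P (inv\<^bsub>G\<^esub> x) \<or> x = \<one>\<^bsub>G\<^esub>)"

lemma mult_free_group: "u \<otimes>\<^bsub>free_group X\<^esub> v = foldr push u v"
  and one_free_group: "\<one>\<^bsub>free_group X\<^esub> = []"
  by (simp_all add: free_group_def)

lemma free_group_reduced: "w \<in> carrier (free_group X) \<Longrightarrow> reduced w"
  by (simp add: free_group_def)

lemma ex_positive_cone_free_group:
  fixes X :: "'x set"
  shows "\<exists>P. positive_cone (free_group X) P"
proof -
  obtain r :: "'x rel" where r: "trans r" "total r" "wf r"
  proof -
    obtain r :: "'x rel" where "well_order_on UNIV r" using well_order_on by blast
    then have "wf (r - Id)" "total (r - Id)" "trans (r - Id)"
      by (auto simp: well_order_on_def linear_order_on_def partial_order_on_def preorder_on_def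
          total_on_def trans_diff_Id)
    then show ?thesis using that by blast
  qed
  interpret F: group "free_group X" by (rule group_free_group)
  let ?one = "\<lambda>v. if v = [] then 1 else 0 :: int"
  define D where "D w v = magnus w v - ?one v" for w :: "'x letter list" and v
  define P where "P w = leading_pos r (D w)" for w
  have magnus_D: "magnus w = (\<lambda>v. D w v + ?one v)" for w
    by (simp add: D_def)
  \<comment> \<open>With \<open>M\<close> for the Magnus series,
    \<open>M(uw) - 1 = M(u) (M(w) - 1) + (M(u) - 1)\<close>.\<close>
  have D_mult: "D (foldr push u w) v = foldr magnus_act u (D w) v + D u v" for u w v
  proof -
    have "magnus (foldr push u w) v = foldr magnus_act u (D w) v + foldr magnus_act u ?one v"
      unfolding magnus_mult magnus_D[of w] foldr_magnus_act_add ..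
    then show ?thesis by (simp add: D_def magnus_def)
  qed
  have lead: "leading_pos r (foldr magnus_act w f)" if "leading_pos r f" for w f
    using that by (rule leading_pos_cong) (rule foldr_magnus_act_leading)
  \<comment> \<open>\<open>D_mult\<close> at the identity: the series of an element and of its
    inverse, minus 1, have opposite leading coefficients.\<close>
  have inv: "foldr magnus_act u (D w) v = - D u v" if "foldr push u w = []" for u w v
    using D_mult[of u w v] that by (simp add: D_def magnus_Nil)
  have mult: "P (foldr push u w)" if "P u" "P w" for u w
    using leading_pos_add[OF r(1,2) lead[OF that(2)[unfolded P_def]] that(1)[unfolded P_def]]
    unfolding P_def D_mult[abs_def] .
  \<comment> \<open>Here \<open>g'\<close> is the inverse of \<open>g\<close>. The series of
    \<open>g h g'\<close> minus 1 is \<open>D h\<close> multiplied on the left and on the right by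
    series with constant term 1, so its leading term is that of \<open>D h\<close>.\<close>
  have conj: "P (foldr push (foldr push g h) g')"
    if "P h" "foldr push g g' = []" "reduced g'" for g h g'
  proof -
    have "leading_pos r (series_mult (D h) (magnus g'))"
      using that(1) unfolding P_def
      by (rule leading_pos_cong) (simp add: series_mult_leading)
    then have "leading_pos r (foldr magnus_act g (series_mult (D h) (magnus g')))"
      by (rule lead)
    moreover have "foldr magnus_act g (series_mult (D h) (magnus g')) v =
      D (foldr push (foldr push g h) g') v" for v
    proof -
      have *: "series_mult (D h) (magnus g') = (\<lambda>v. foldr magnus_act h (magnus g') v + - magnus g' v)"
        using series_mult_add[of "D h" ?one "magnus g'"] series_mult_magnus[of h "magnus g'"]
        unfolding magnus_D[symmetric] series_mult_one by fastforce
      have "foldr magnus_act g (series_mult (D h) (magnus g')) v =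
        magnus (foldr push (foldr push g h) g') v - magnus (foldr push g g') v"
        using that(3) unfolding * foldr_magnus_act_add foldr_magnus_act_uminus by (simp add: foldr_push_assoc magnus_mult)
      then show ?thesis by (simp add: that(2) D_def magnus_Nil)
    qed
    ultimately show ?thesis unfolding P_def by (simp add: leading_pos_def)
  qed
  have asym: "\<not> P u" if "P w" "foldr push u w = []" for u w
    using leading_pos_uminus[OF r(1,2) lead[OF that(1)[unfolded P_def], of u]]
    unfolding P_def by (simp add: inv[OF that(2)])
  have tot: "P u \<or> P w \<or> w = []" if inv_u: "foldr push u w = []" and red: "reduced w" for u w
  proof (cases "w = []")
    case False
    then obtain v where "D w v \<noteq> 0"
      using magnus_eq_one_iff[OF red] by (auto simp: D_def fun_eq_iff)
    then show ?thesis
      using leading_pos_cases[OF r(3,2), of "D w" v] lead[of "\<lambda>v. - D w v" u]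
      unfolding P_def foldr_magnus_act_uminus[abs_def] by (auto simp: inv[OF inv_u])
  qed simp
  have "positive_cone (free_group X) P"
    unfolding positive_cone_def
  proof (intro conjI ballI impI)
    fix x g assume "x \<in> carrier (free_group X)" "g \<in> carrier (free_group X)" "P x"
    then show "P (g \<otimes>\<^bsub>free_group X\<^esub> x \<otimes>\<^bsub>free_group X\<^esub> inv\<^bsub>free_group X\<^esub> g)"
      using F.r_inv[of g] free_group_reduced[OF F.inv_closed[of g]]
      by (simp add: mult_free_group one_free_group conj)
  next
    fix x assume x: "x \<in> carrier (free_group X)"
    then have "foldr push (inv\<^bsub>free_group X\<^esub> x) x = []"
      using F.l_inv[of x] by (simp add: mult_free_group one_free_group)
    then show "P x \<Longrightarrow> \<not> P (inv\<^bsub>free_group X\<^esub> x)"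
        and "P x \<or> P (inv\<^bsub>free_group X\<^esub> x) \<or> x = \<one>\<^bsub>free_group X\<^esub>"
      using asym tot free_group_reduced[OF x] by (auto simp: one_free_group)
  qed (simp add: mult_free_group mult)
  then show ?thesis by blast
qed

text \<open>Put \<open>x\<close> below \<open>y\<close> if \<open>inv x \<otimes> y\<close> is
  positive. Multiplying both on the left changes nothing; multiplying both by \<open>g\<close> on
  the right conjugates \<open>inv x \<otimes> y\<close> by \<open>inv g\<close>.\<close>

lemma (in group) positive_cone_bi_orderable:
  assumes P: "positive_cone G P"
  shows "bi_orderable G"
proof -
  have mult: "P (x \<otimes> y)" if "x \<in> carrier G" "y \<in> carrier G" "P x" "P y" for x y
    using P that by (auto simp: positive_cone_def)
  have conj: "P (g \<otimes> x \<otimes> inv g)" if "x \<in> carrier G" "g \<in> carrier G" "P x" for x g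
    using P that by (auto simp: positive_cone_def)
  have asym: "\<not> P (inv x)" if "x \<in> carrier G" "P x" for x
    using P that by (auto simp: positive_cone_def)
  have tot: "P x \<or> P (inv x) \<or> x = \<one>" if "x \<in> carrier G" for x
    using P that by (auto simp: positive_cone_def)
  define r where "r = {(x, y). x \<in> carrier G \<and> y \<in> carrier G \<and> (x = y \<or> P (inv x \<otimes> y))}"
  have inv: "inv (inv x \<otimes> y) = inv y \<otimes> x" if "x \<in> carrier G" "y \<in> carrier G" for x y
    using that by (simp add: inv_mult_group)
  have tr: "P (inv x \<otimes> z)" if "x \<in> carrier G" "y \<in> carrier G" "z \<in> carrier G"
    "P (inv x \<otimes> y)" "P (inv y \<otimes> z)" for x y z
  proof -
    have "(inv x \<otimes> y) \<otimes> (inv y \<otimes> z) = inv x \<otimes> z"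
      using that m_assoc[of y "inv y" z] by (simp add: m_assoc)
    then show ?thesis using mult[OF _ _ that(4,5)] that(1-3) by simp
  qed
  have "linear_order_on (carrier G) r"
    unfolding linear_order_on_def partial_order_on_def preorder_on_def
  proof (intro conjI)
    show "refl_on (carrier G) r" by (auto simp: refl_on_def r_def)
    show "trans r" by (rule transI) (use tr in \<open>auto simp: r_def\<close>)
    show "antisym r"
      using asym inv by (auto simp: antisym_def r_def) (metis inv_closed m_closed)
    show "total_on (carrier G) r"
    proof (rule total_onI)
      fix x y assume xy: "x \<in> carrier G" "y \<in> carrier G" "x \<noteq> y"
      then have "inv x \<otimes> y \<noteq> \<one>" by (metis inv_closed inv_equality inv_inv)
      then show "(x, y) \<in> r \<or> (y, x) \<in> r"
        using tot[of "inv x \<otimes> y"] inv xy by (auto simp: r_def)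
    qed
    show "r \<subseteq> carrier G \<times> carrier G" by (auto simp: r_def)
  qed
  moreover have "(g \<otimes> x, g \<otimes> y) \<in> r" "(x \<otimes> g, y \<otimes> g) \<in> r"
    if "x \<in> carrier G" "y \<in> carrier G" "g \<in> carrier G" "(x, y) \<in> r" for x y g
  proof -
    have "inv (g \<otimes> x) \<otimes> (g \<otimes> y) = inv x \<otimes> y"
      using that by (simp add: inv_mult_group m_assoc) (simp add: m_assoc[symmetric])
    then show "(g \<otimes> x, g \<otimes> y) \<in> r" using that by (auto simp: r_def)
    have "inv (x \<otimes> g) \<otimes> (y \<otimes> g) = inv g \<otimes> (inv x \<otimes> y) \<otimes> inv (inv g)"
      using that by (simp add: inv_mult_group m_assoc)
    then show "(x \<otimes> g, y \<otimes> g) \<in> r"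
      using that conj[of "inv x \<otimes> y" "inv g"] by (auto simp: r_def)
  qed
  ultimately show ?thesis unfolding bi_orderable_def by blast
qed

lemma (in group) positive_cone_torsion_free:
  assumes P: "positive_cone G P"
  shows "torsion_free G"
proof -
  have mult: "P (x \<otimes> y)" if "x \<in> carrier G" "y \<in> carrier G" "P x" "P y" for x y
    using P that by (auto simp: positive_cone_def)
  have nP: "\<not> P \<one>"
    using P unfolding positive_cone_def by (metis inv_one one_closed)
  have pow: "P (x [^] Suc n)" if "x \<in> carrier G" "P x" for x n
    by (induction n) (use that mult in auto)
  have "x [^] n \<noteq> \<one>" if x: "x \<in> carrier G" "x \<noteq> \<one>" and "0 < n" for x and n :: nat
  proof -
    obtain m where n: "n = Suc m" using \<open>0 < n\<close> gr0_implies_Suc by blast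
    consider "P x" | "P (inv x)" using P x unfolding positive_cone_def by blast
    then show ?thesis
    proof cases
      case 1
      then show ?thesis using pow[OF x(1) 1, of m] nP unfolding n by metis
    next
      case 2
      then show ?thesis using pow[OF inv_closed[OF x(1)] 2, of m] nP x(1)
        unfolding n by (metis inv_one nat_pow_inv)
    qed
  qed
  then show ?thesis by (auto simp: torsion_free_def)
qed


section \<open>The Nielsen--Schreier theorem\<close>

lemma letter_in_free_group [simp]: "[l] \<in> carrier (free_group X) \<longleftrightarrow> fst l \<in> X"
  by (simp add: free_group_def)

lemma Nil_in_free_group [simp]: "[] \<in> carrier (free_group X)"
  by (simp add: free_group_def)

lemma push_in_free_group:
  assumes "fst l \<in> X" "w \<in> carrier (free_group X)"
  shows "push l w \<in> carrier (free_group X)"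
proof -
  have "fst ` set (push l w) \<subseteq> X"
    by (rule order_trans[OF letters_push]) (use assms in \<open>simp add: free_group_def\<close>)
  then show ?thesis using assms by (simp add: free_group_def reduced_push)
qed

lemma push_eq_mult: "push l w = [l] \<otimes>\<^bsub>free_group X\<^esub> w"
  by (simp add: mult_free_group)

lemma push_Cons: "reduced (l # w) \<Longrightarrow> push l w = l # w"
  by (cases w) auto

lemma Cons_in_free_groupD:
  assumes "l # w \<in> carrier (free_group X)"
  shows "fst l \<in> X" "w \<in> carrier (free_group X)" "push l w = l # w"
  using assms by (auto simp: free_group_def push_Cons intro: reduced_tl)

lemma inv_letter_free_group:
  assumes "fst l \<in> X"
  shows "inv\<^bsub>free_group X\<^esub> [l] = [inv_letter l]"
  by (rule group.inv_equality[OF group_free_group]) (use assms in \<open>simp_all add: mult_free_group one_free_group\<close>)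

text \<open>Serves as induction over a free group: applied to equalisers it gives uniqueness of
  homomorphisms, applied to images it gives surjectivity.\<close>

lemma free_group_subgroup_eq:
  assumes "subgroup K (free_group X)" "\<And>x. x \<in> X \<Longrightarrow> [(x, True)] \<in> K"
  shows "K = carrier (free_group X)"
proof
  interpret K: subgroup K "free_group X" by fact
  show "K \<subseteq> carrier (free_group X)" by (rule K.subset)
  have letter: "[l] \<in> K" if "fst l \<in> X" for l
    using K.m_inv_closed[OF assms(2)[OF that]] assms(2)[OF that] that
    by (cases l; cases "snd l") (auto simp: inv_letter_free_group inv_letter_def)
  show "carrier (free_group X) \<subseteq> K"
  proof
    fix w assume "w \<in> carrier (free_group X)"
    then show "w \<in> K"
    proof (induction w)
      case Nil
      then show ?case using K.one_closed by (simp add: one_free_group)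
    next
      case (Cons l w)
      then show ?case
        using Cons_in_free_groupD[OF Cons.prems] K.m_closed[OF letter] push_eq_mult[of l w X] by metis
    qed
  qed
qed

section \<open>Schreier transversals, rewriting and free generators of a subgroup\<close>

locale free_subgroup =
  fixes X :: "'x set" and H :: "'x letter list set" and r :: "'x letter rel"
  assumes subgroup: "subgroup H (free_group X)" and r: "wf r" "total r"
begin

sublocale F: group "free_group X" by (rule group_free_group)
sublocale H: subgroup H "free_group X" by (rule subgroup)

text \<open>A least word of the coset, lengths compared first. Left cosets are used because words
  grow on the left; the representatives are then closed under suffixes.\<close>

definition rep :: "'x letter list \<Rightarrow> 'x letter list" where
  "rep u = (SOME v. v \<in> u <#\<^bsub>free_group X\<^esub> H \<and>
    (\<forall>v'\<in>u <#\<^bsub>free_group X\<^esub> H. (v', v) \<notin> lenlex r))"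

lemma mem_coset: "u \<in> carrier (free_group X) \<Longrightarrow> u \<in> u <#\<^bsub>free_group X\<^esub> H"
  unfolding l_coset_def using F.r_one[of u] H.one_closed by force

lemma coset_eq: 
  "v \<in> u <#\<^bsub>free_group X\<^esub> H \<Longrightarrow> u \<in> carrier (free_group X) \<Longrightarrow>
    v <#\<^bsub>free_group X\<^esub> H = u <#\<^bsub>free_group X\<^esub> H"
  using F.l_repr_independence[OF _ _ subgroup] by blast

lemma rep_coset:
  assumes "u \<in> carrier (free_group X)"
  shows "rep u \<in> u <#\<^bsub>free_group X\<^esub> H"
    and "v \<in> u <#\<^bsub>free_group X\<^esub> H \<Longrightarrow> (v, rep u) \<notin> lenlex r"
proof -
  have "wf (lenlex r)" using r(1) by (rule wf_lenlex)
  then have "\<exists>v. v \<in> u <#\<^bsub>free_group X\<^esub> H \<and> (\<forall>v'\<in>u <#\<^bsub>free_group X\<^esub> H. (v', v) \<notin> lenlex r)"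
    using mem_coset[OF assms] by (rule wfE_min) blast
  from someI_ex[OF this, folded rep_def]
  show "rep u \<in> u <#\<^bsub>free_group X\<^esub> H"
    and "v \<in> u <#\<^bsub>free_group X\<^esub> H \<Longrightarrow> (v, rep u) \<notin> lenlex r" by blast+
qed

lemma rep_closed: "u \<in> carrier (free_group X) \<Longrightarrow> rep u \<in> carrier (free_group X)"
  using rep_coset(1) F.l_coset_subset_G[OF H.subset] by blast

lemma rep_coset_eq:
  "u \<in> carrier (free_group X) \<Longrightarrow> rep u <#\<^bsub>free_group X\<^esub> H = u <#\<^bsub>free_group X\<^esub> H"
  using rep_coset(1) by (rule coset_eq)

lemma rep_cong: "u <#\<^bsub>free_group X\<^esub> H = v <#\<^bsub>free_group X\<^esub> H \<Longrightarrow> rep u = rep v"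
  by (simp add: rep_def)

lemma rep_rep: "u \<in> carrier (free_group X) \<Longrightarrow> rep (rep u) = rep u"
  by (rule rep_cong) (rule rep_coset_eq)

lemma push_coset: 
  assumes "fst l \<in> X" "u \<in> carrier (free_group X)"
  shows "push l u <#\<^bsub>free_group X\<^esub> H = [l] <#\<^bsub>free_group X\<^esub> (u <#\<^bsub>free_group X\<^esub> H)"
  unfolding push_eq_mult[of l u X] using assms by (intro F.lcos_m_assoc[symmetric] H.subset) auto

lemma rep_push_rep:
  assumes "fst l \<in> X" "u \<in> carrier (free_group X)"
  shows "rep (push l (rep u)) = rep (push l u)"
  by (rule rep_cong) (simp add: push_coset rep_coset_eq rep_closed assms)

lemma coset_mult:
  assumes "u \<in> carrier (free_group X)" "h \<in> H"
  shows "foldr push u h <#\<^bsub>free_group X\<^esub> H = u <#\<^bsub>free_group X\<^esub> H"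
  using assms by (intro coset_eq) (auto simp: l_coset_def mult_free_group)

lemma rep_Nil: "rep [] = []"
  using rep_coset(2)[of "[]" "[]"] mem_coset[of "[]"] by simp

lemma rep_H: "h \<in> H \<Longrightarrow> rep h = []"
  using rep_cong[OF coset_mult[of "[]" h]] rep_Nil by simp

text \<open>If the coset of \<open>t\<close> had a smaller word, putting it in place of
  \<open>t\<close> in \<open>l # t\<close> would give a smaller word there too. Cancellation with
  \<open>l\<close> only shortens the result.\<close>

lemma rep_suffix:
  assumes t: "l # t \<in> carrier (free_group X)" and rep: "rep (l # t) = l # t"
  shows "rep t = t"
proof (rule ccontr)
  note t' = Cons_in_free_groupD[OF t]
  assume ne: "rep t \<noteq> t"
  have "(t, rep t) \<notin> lenlex r"
    using rep_coset(2)[OF t'(2)] mem_coset[OF t'(2)] by blast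
  then have less: "(rep t, t) \<in> lenlex r"
    using total_lenlex[OF r(2)] ne by (auto simp: total_on_def)
  have "push l (rep t) \<in> (l # t) <#\<^bsub>free_group X\<^esub> H"
    using rep_coset_eq[OF t'(2)] push_coset[OF t'(1,2)] push_coset[OF t'(1) rep_closed[OF t'(2)]]
      mem_coset[OF push_in_free_group[OF t'(1) rep_closed[OF t'(2)]]] t'(3) by metis
  then have "(push l (rep t), l # t) \<notin> lenlex r"
    using rep_coset(2)[OF t] rep by metis
  moreover have "(push l (rep t), l # t) \<in> lenlex r"
  proof (cases "push l (rep t) = l # rep t")
    case True
    then show ?thesis using less by (auto simp: lenlex_conv)
  next
    case False
    then have "length (push l (rep t)) < length (rep t)"
      by (cases "rep t") (auto split: if_splits)
    then show ?thesis using lenlex_length[OF less] by (auto simp: lenlex_conv)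
  qed
  ultimately show False by blast
qed

text \<open>A pair \<open>(x, t)\<close> stands for the edge of the coset graph that leaves the
  representative \<open>t\<close> by the generator \<open>x\<close>. The representatives form a
  spanning tree, and only the edges outside it are kept.\<close>

definition generators :: "('x \<times> 'x letter list) set" where
  "generators = {(x, t). x \<in> X \<and> t \<in> carrier (free_group X) \<and> rep t = t \<and>
    rep (push (x, True) t) \<noteq> push (x, True) t}"

definition gen :: "'x \<Rightarrow> 'x letter list \<Rightarrow> ('x \<times> 'x letter list) letter list" where
  "gen x t = (if rep (push (x, True) t) = push (x, True) t then [] else [((x, t), True)])"

text \<open>The label of the step from the coset of \<open>w\<close> to that of
  \<open>push l w\<close>. An inverse letter runs backwards along the edge that starts where the
  step ends, hence \<open>rep (push l w)\<close>.\<close>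

definition edge :: "'x letter \<Rightarrow> 'x letter list \<Rightarrow> ('x \<times> 'x letter list) letter list" where
  "edge l w = (if snd l then gen (fst l) (rep w)
     else map inv_letter (gen (fst l) (rep (push l w))))"

text \<open>Reidemeister rewriting: the word, read from its right end, is a path in the coset graph
  starting at \<open>H\<close>, and the labels along this path are multiplied.\<close>

fun rewrite :: "'x letter list \<Rightarrow> ('x \<times> 'x letter list) letter list" where
  "rewrite [] = []"
| "rewrite (l # w) = foldr push (edge l w) (rewrite w)"

sublocale Y: group "free_group generators" by (rule group_free_group)

lemma edge_closed:
  assumes "fst l \<in> X" "w \<in> carrier (free_group X)"
  shows "edge l w \<in> carrier (free_group generators)"
  using assms by (auto simp: edge_def gen_def generators_def rep_closed rep_rep push_in_free_group)

lemma rewrite_closed: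
  "w \<in> carrier (free_group X) \<Longrightarrow> rewrite w \<in> carrier (free_group generators)"
proof (induction w)
  case (Cons l w)
  note w = Cons_in_free_groupD[OF Cons.prems]
  then show ?case
    using Y.m_closed[OF edge_closed[OF w(1,2)] Cons.IH[OF w(2)]] by (simp add: mult_free_group)
qed simp

lemma rewrite_reduced: "w \<in> carrier (free_group X) \<Longrightarrow> reduced (rewrite w)"
  using rewrite_closed free_group_reduced by blast

lemma edge_inv_letter:
  assumes "reduced w"
  shows "foldr push (edge l (push (inv_letter l) w)) (edge (inv_letter l) w) = []"
  using push_push_inv[OF assms, of l]
  by (cases l; cases "snd l") (auto simp: edge_def gen_def inv_letter_def)

lemma rewrite_push:
  assumes "fst l \<in> X" "w \<in> carrier (free_group X)"
  shows "rewrite (push l w) = foldr push (edge l w) (rewrite w)"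
proof (cases w)
  case (Cons y v)
  show ?thesis
  proof (cases "y = inv_letter l")
    case True
    note v = Cons_in_free_groupD[OF assms(2)[unfolded Cons]]
    have "foldr push (edge l w) (rewrite w) =
        foldr push (foldr push (edge l w) (edge (inv_letter l) v)) (rewrite v)"
      using Cons True by (simp add: foldr_push_assoc rewrite_reduced[OF v(2)])
    also have "\<dots> = rewrite v"
      using edge_inv_letter[of v l] v free_group_reduced[OF v(2)] Cons True by simp
    finally show ?thesis using Cons True by simp
  qed (use Cons in simp)
qed simp

text \<open>Labels depend only on cosets. The path of \<open>h\<close> returns to the coset
  \<open>H\<close>, so the letters of \<open>u\<close> then meet the same cosets as if
  \<open>h\<close> were absent.\<close>

lemma rewrite_mult:
  assumes "u \<in> carrier (free_group X)" "h \<in> H"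
  shows "rewrite (foldr push u h) = foldr push (rewrite u) (rewrite h)"
  using assms(1)
proof (induction u)
  case (Cons l u)
  note u = Cons_in_free_groupD[OF Cons.prems]
  have h: "h \<in> carrier (free_group X)" using assms(2) H.subset by blast
  have uh: "foldr push u h \<in> carrier (free_group X)"
    using F.m_closed[OF u(2) h] by (simp add: mult_free_group)
  have "rep (foldr push u h) = rep u"
    using coset_mult[OF u(2) assms(2)] by (rule rep_cong)
  moreover have "rep (push l (foldr push u h)) = rep (push l u)"
    by (rule rep_cong) (simp add: push_coset coset_mult assms u(1,2) uh)
  ultimately have "edge l (foldr push u h) = edge l u"
    by (simp add: edge_def)
  then show ?case
    using Cons.IH[OF u(2)]
    by (simp add: rewrite_push[OF u(1) uh] foldr_push_assoc rewrite_reduced[OF h])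
qed (simp add: foldr_push_Nil)

text \<open>Closure under suffixes keeps the whole path in the spanning tree, whose edges have empty
  labels.\<close>

lemma rewrite_transversal:
  "t \<in> carrier (free_group X) \<Longrightarrow> rep t = t \<Longrightarrow> rewrite t = []"
proof (induction t)
  case (Cons l t)
  note t = Cons_in_free_groupD[OF Cons.prems(1)]
  have rep: "rep t = t" by (rule rep_suffix[OF Cons.prems])
  have "edge l t = []"
  proof (cases l)
    case (Pair x b)
    then show ?thesis
      using t rep Cons.prems push_push_inv[OF free_group_reduced[OF t(2)], of "inv_letter l"]
      by (cases b) (auto simp: edge_def gen_def inv_letter_def)
  qed
  then show ?case using Cons.IH[OF t(2) rep] by simp
qed simp

text \<open>The Schreier generator: the edge closed to a loop at \<open>H\<close> through the
  tree.\<close>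

definition gen_value :: "'x \<times> 'x letter list \<Rightarrow> 'x letter list" where
  "gen_value y = inv\<^bsub>free_group X\<^esub> rep (push (fst y, True) (snd y)) \<otimes>\<^bsub>free_group X\<^esub>
     push (fst y, True) (snd y)"

lemma gen_value_closed: "gen_value ` generators \<subseteq> carrier (free_group X)"
  by (auto simp: gen_value_def generators_def intro!: F.m_closed F.inv_closed rep_closed push_in_free_group)

sublocale val: group_hom "free_group generators" "free_group X" "word_eval (free_group X) gen_value"
  by (intro group_hom.intro group_hom_axioms.intro group_free_group F.word_eval_hom gen_value_closed)

lemma val_gen:
  assumes "x \<in> X" "t \<in> carrier (free_group X)"
  shows "word_eval (free_group X) gen_value (gen x t) =
    inv\<^bsub>free_group X\<^esub> rep (push (x, True) t) \<otimes>\<^bsub>free_group X\<^esub> push (x, True) t"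
proof -
  have "push (x, True) t \<in> carrier (free_group X)" using assms by (intro push_in_free_group) auto
  then show ?thesis using rep_closed F.l_inv
    by (auto simp: gen_def word_eval_def gen_value_def simp del: F.l_inv_ex)
qed

lemma val_edge:
  assumes "fst l \<in> X" "w \<in> carrier (free_group X)"
  shows "word_eval (free_group X) gen_value (edge l w) =
    inv\<^bsub>free_group X\<^esub> rep (push l w) \<otimes>\<^bsub>free_group X\<^esub> ([l] \<otimes>\<^bsub>free_group X\<^esub> rep w)"
proof (cases "snd l")
  case True
  then have l: "l = (fst l, True)" by (cases l) auto
  have "edge l w = gen (fst l) (rep w)" using True by (simp add: edge_def)
  then show ?thesis
    using val_gen[OF assms(1) rep_closed[OF assms(2)]] rep_push_rep[OF assms]
    unfolding push_eq_mult[of l "rep w" X, symmetric] l[symmetric] by simp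
next
  case False
  then have l: "(fst l, True) = inv_letter l" by (cases l) (auto simp: inv_letter_def)
  let ?t = "rep (push l w)"
  have lw: "push l w \<in> carrier (free_group X)" using assms by (rule push_in_free_group)
  then have t: "?t \<in> carrier (free_group X)" by (rule rep_closed)
  have c: "[inv_letter l] \<in> carrier (free_group X)" "[l] \<in> carrier (free_group X)" using assms(1) by simp_all
  have g: "gen (fst l) ?t \<in> carrier (free_group generators)"
    using edge_closed[of "(fst l, True)" "push l w"] assms lw by (simp add: edge_def)
  have "map inv_letter (gen (fst l) ?t) = inv\<^bsub>free_group generators\<^esub> (gen (fst l) ?t)"
  proof (cases "gen (fst l) ?t = []")
    case True
    then show ?thesis using Y.inv_one by (simp add: one_free_group)
  next
    case False
    then have "gen (fst l) ?t = [((fst l, ?t), True)]" by (auto simp: gen_def)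
    then show ?thesis using g by (simp add: inv_letter_free_group)
  qed
  then have e: "edge l w = inv\<^bsub>free_group generators\<^esub> (gen (fst l) ?t)"
    using False by (simp add: edge_def)
  have rw: "rep (push (inv_letter l) ?t) = rep w"
    using rep_push_rep[of "inv_letter l" "push l w"] assms lw
      push_push_inv[OF free_group_reduced[OF assms(2)], of "inv_letter l"] by simp
  have "word_eval (free_group X) gen_value (edge l w) =
      inv\<^bsub>free_group X\<^esub> (inv\<^bsub>free_group X\<^esub> rep w \<otimes>\<^bsub>free_group X\<^esub> ([inv_letter l] \<otimes>\<^bsub>free_group X\<^esub> ?t))"
    using val.hom_inv[OF g] val_gen[OF assms(1) t] rw
    unfolding e l by (simp add: push_eq_mult[of "inv_letter l" ?t X])
  also have "\<dots> = inv\<^bsub>free_group X\<^esub> ?t \<otimes>\<^bsub>free_group X\<^esub> ([l] \<otimes>\<^bsub>free_group X\<^esub> rep w)"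
    using t c rep_closed[OF assms(2)] assms(1)
    by (simp add: F.inv_mult_group F.m_assoc inv_letter_free_group)
  finally show ?thesis .
qed

text \<open>The product telescopes: representatives of the intermediate cosets cancel, the first one
  is empty and the last one remains. On \<open>H\<close> it is empty too, so evaluation undoes
  \<open>rewrite\<close> there.\<close>

lemma val_rewrite:
  "w \<in> carrier (free_group X) \<Longrightarrow>
    word_eval (free_group X) gen_value (rewrite w) = inv\<^bsub>free_group X\<^esub> rep w \<otimes>\<^bsub>free_group X\<^esub> w"
proof (induction w)
  case Nil
  then show ?case
    using F.l_one[of "[]"] F.inv_one by (simp add: word_eval_def rep_Nil one_free_group)
next
  case (Cons l w)
  note w = Cons_in_free_groupD[OF Cons.prems]
  have c: "[l] \<in> carrier (free_group X)" using w by simp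
  have "word_eval (free_group X) gen_value (rewrite (l # w)) =
    word_eval (free_group X) gen_value (edge l w) \<otimes>\<^bsub>free_group X\<^esub>
    word_eval (free_group X) gen_value (rewrite w)"
    using val.hom_mult[OF edge_closed[OF w(1,2)] rewrite_closed[OF w(2)]] by (simp add: mult_free_group)
  also have "\<dots> = inv\<^bsub>free_group X\<^esub> rep (push l w) \<otimes>\<^bsub>free_group X\<^esub> ([l] \<otimes>\<^bsub>free_group X\<^esub> rep w)
    \<otimes>\<^bsub>free_group X\<^esub> (inv\<^bsub>free_group X\<^esub> rep w \<otimes>\<^bsub>free_group X\<^esub> w)"
    using val_edge[OF w(1,2)] Cons.IH[OF w(2)] by simp
  also have "\<dots> = inv\<^bsub>free_group X\<^esub> rep (push l w) \<otimes>\<^bsub>free_group X\<^esub> ([l] \<otimes>\<^bsub>free_group X\<^esub> w)"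
    using c w(2) rep_closed[OF w(2)] rep_closed[OF Cons.prems] F.m_assoc[of "rep w" "inv\<^bsub>free_group X\<^esub> rep w" w]
    by (simp add: F.m_assoc w(3))
  also have "[l] \<otimes>\<^bsub>free_group X\<^esub> w = l # w"
    using push_eq_mult[of l w X] w(3) by simp
  finally show ?case using w(3) by simp
qed

lemma rewrite_iso: "rewrite \<in> iso ((free_group X)\<lparr>carrier := H\<rparr>) (free_group generators)"
proof -
  have hom: "rewrite \<in> hom ((free_group X)\<lparr>carrier := H\<rparr>) (free_group generators)"
    using rewrite_closed rewrite_mult H.subset by (intro homI) (auto simp: mult_free_group)
  then interpret h: group_hom "(free_group X)\<lparr>carrier := H\<rparr>" "free_group generators" rewrite
    using H.subgroup_is_group[OF F.group_axioms] Y.group_axioms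
    by (simp add: group_hom_def group_hom_axioms_def)
  have "word_eval (free_group X) gen_value (rewrite w) = w" if "w \<in> H" for w
    using val_rewrite[of w] that H.subset rep_H[OF that] F.inv_one F.l_one[of w] by (auto simp: one_free_group)
  then have "inj_on rewrite H" by (metis inj_on_inverseI)
  moreover have "rewrite ` H = carrier (free_group generators)"
  proof (rule free_group_subgroup_eq)
    show "subgroup (rewrite ` H) (free_group generators)"
      using h.img_is_subgroup by simp
    fix y assume y: "y \<in> generators"
    then obtain x t where xt: "y = (x, t)" "x \<in> X" "t \<in> carrier (free_group X)" "rep t = t"
      "rep (push (x, True) t) \<noteq> push (x, True) t" by (auto simp: generators_def)
    define s where "s = push (x, True) t"
    have s: "s \<in> carrier (free_group X)" unfolding s_def using xt by (intro push_in_free_group) auto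
    \<comment> \<open>The loop belonging to the edge \<open>y\<close>. Both \<open>rep s\<close> and
      \<open>t\<close> rewrite to the empty word, so that only the label of \<open>y\<close>
      survives.\<close>
    define h where "h = inv\<^bsub>free_group X\<^esub> rep s \<otimes>\<^bsub>free_group X\<^esub> s"
    obtain h' where h': "h' \<in> H" "rep s = s \<otimes>\<^bsub>free_group X\<^esub> h'"
      using rep_coset(1)[OF s] by (auto simp: l_coset_def)
    then have "h = inv\<^bsub>free_group X\<^esub> h'"
      unfolding h_def using s H.subset by (auto simp: F.inv_mult_group F.m_assoc)
    then have h: "h \<in> H" using h' by simp
    have sh: "s = foldr push (rep s) h"
      using s rep_closed[OF s] F.m_assoc[of "rep s" "inv\<^bsub>free_group X\<^esub> rep s" s]
      by (simp add: h_def mult_free_group[where X = X, symmetric])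
    have "rewrite s = foldr push (rewrite (rep s)) (rewrite h)"
      by (subst sh) (rule rewrite_mult[OF rep_closed[OF s] h])
    then have "rewrite h = rewrite s"
      using rewrite_transversal[OF rep_closed[OF s] rep_rep[OF s]] by simp
    also have "\<dots> = [(y, True)]"
      using xt rewrite_push[of "(x, True)" t] rewrite_transversal[OF xt(3,4)]
      by (simp add: s_def edge_def gen_def)
    finally show "[(y, True)] \<in> rewrite ` H" using h by (metis imageI)
  qed
  ultimately show ?thesis using hom by (simp add: iso_def bij_betw_def)
qed

end

section \<open>Homomorphisms from free groups, and finite rank\<close>

lemma hom_word_eval:
  assumes "group G" "group K" "h \<in> hom G K" "s ` X \<subseteq> carrier G" "fst ` set w \<subseteq> X"
  shows "h (word_eval G s w) = word_eval K (\<lambda>x. h (s x)) w"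
proof -
  interpret h: group_hom G K h
    using assms by (simp add: group_hom_def group_hom_axioms_def)
  show ?thesis
    using assms(5)
  proof (induction w)
    case (Cons l w)
    have "s (fst l) \<in> carrier G" "word_eval G s w \<in> carrier G"
      using Cons.prems assms(4) h.G.word_eval_closed[OF assms(4)] by auto
    then show ?case
      using Cons by (cases l) (auto simp: word_eval_def)
  qed (simp add: word_eval_def)
qed

lemma word_eval_cong:
  "(\<And>x. x \<in> fst ` set w \<Longrightarrow> s x = s' x) \<Longrightarrow> word_eval G s w = word_eval G s' w"
  by (induction w) (auto simp: word_eval_def)

lemma (in group) word_eval_subgroup:
  assumes "subgroup H G" "s ` X \<subseteq> H" "fst ` set w \<subseteq> X"
  shows "word_eval (G\<lparr>carrier := H\<rparr>) s w = word_eval G s w"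
proof -
  have "(\<lambda>x. x) \<in> hom (G\<lparr>carrier := H\<rparr>) G"
    using subgroup.mem_carrier[OF assms(1)] by (intro homI) auto
  then show ?thesis
    using hom_word_eval[OF subgroup.subgroup_is_group[OF assms(1) group_axioms] group_axioms, of "\<lambda>x. x" s X w]
      assms by simp
qed

lemma word_eval_letter: "group G \<Longrightarrow> s x \<in> carrier G \<Longrightarrow> word_eval G s [(x, True)] = s x"
  by (simp add: word_eval_def group.is_monoid monoid.r_one)

lemma free_group_letters: "w \<in> carrier (free_group X) \<Longrightarrow> fst ` set w \<subseteq> X"
  by (simp add: free_group_def)

lemma hom_eq_subgroup:
  assumes "group G" "group K" "f \<in> hom G K" "g \<in> hom G K"
  shows "subgroup {x \<in> carrier G. f x = g x} G"
proof -
  interpret f: group_hom G K f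
    using assms by (simp add: group_hom_def group_hom_axioms_def)
  interpret g: group_hom G K g
    using assms by (simp add: group_hom_def group_hom_axioms_def)
  show ?thesis by (rule f.G.subgroupI) auto
qed

lemma free_group_hom_eq:
  assumes "group K" "f \<in> hom (free_group X) K" "g \<in> hom (free_group X) K"
    and "\<And>x. x \<in> X \<Longrightarrow> f [(x, True)] = g [(x, True)]" and "w \<in> carrier (free_group X)"
  shows "f w = g w"
  using free_group_subgroup_eq[OF hom_eq_subgroup[OF group_free_group assms(1-3)]] assms(4,5) by auto

lemma generate_hom_eq:
  assumes "group G" "group K" "f \<in> hom G K" "g \<in> hom G K" "A \<subseteq> carrier G"
    and "\<And>x. x \<in> A \<Longrightarrow> f x = g x" and "x \<in> generate G A"
  shows "f x = g x"
  using group.generate_subgroup_incl[OF assms(1) _ hom_eq_subgroup[OF assms(1-4)], of A] assms(5-7) by auto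

lemma subgroup_free_group_mono:
  assumes "X \<subseteq> Z"
  shows "subgroup (carrier (free_group X)) (free_group Z)"
proof -
  interpret Z: group "free_group Z" by (rule group_free_group)
  interpret X: group "free_group X" by (rule group_free_group)
  have sub: "carrier (free_group X) \<subseteq> carrier (free_group Z)"
    using assms by (auto simp: free_group_def)
  show ?thesis
  proof (rule Z.subgroupI)
    fix w assume w: "w \<in> carrier (free_group X)"
    have "inv\<^bsub>free_group Z\<^esub> w = inv\<^bsub>free_group X\<^esub> w"
      using X.l_inv[OF w] X.inv_closed[OF w] w sub
      by (intro Z.inv_equality) (auto simp: mult_free_group one_free_group)
    then show "inv\<^bsub>free_group Z\<^esub> w \<in> carrier (free_group X)" using w by simp
  next
    fix u w assume "u \<in> carrier (free_group X)" "w \<in> carrier (free_group X)"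
    then show "u \<otimes>\<^bsub>free_group Z\<^esub> w \<in> carrier (free_group X)"
      using X.m_closed[of u w] by (simp add: mult_free_group)
  qed (use sub Nil_in_free_group in blast)+
qed

text \<open>Finitely many generating words use finitely many letters, and a letter outside these is
  not in the subgroup that they generate.\<close>

lemma finite_rank:
  assumes "finite B" "B \<subseteq> carrier (free_group X)" "generate (free_group X) B = carrier (free_group X)"
  shows "finite X"
proof -
  define Z where "Z = (\<Union>w\<in>B. fst ` set w)"
  have "Z \<subseteq> X" using assms(2) free_group_letters unfolding Z_def by blast
  have "B \<subseteq> carrier (free_group Z)"
    using assms(2) by (auto simp: Z_def free_group_def)
  then have "carrier (free_group X) \<subseteq> carrier (free_group Z)"
    using group.generate_subgroup_incl[OF group_free_group _ subgroup_free_group_mono[OF \<open>Z \<subseteq> X\<close>]] assms(3)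
    by blast
  moreover have "[(x, True)] \<in> carrier (free_group X)" if "x \<in> X" for x
    using that by simp
  ultimately have "X \<subseteq> Z" by (metis fst_conv letter_in_free_group subsetD subsetI)
  moreover have "finite Z" using assms(1) by (simp add: Z_def)
  ultimately show ?thesis by (rule finite_subset)
qed

lemma free_group_iso:
  assumes "bij_betw f X Z"
  shows "free_group X \<cong> free_group Z"
proof -
  interpret X: group "free_group X" by (rule group_free_group)
  interpret Z: group "free_group Z" by (rule group_free_group)
  define g where "g = the_inv_into X f"
  have f: "f x \<in> Z" "g (f x) = x" if "x \<in> X" for x
    using that assms by (auto simp: bij_betw_def g_def the_inv_into_f_f)
  have g: "g z \<in> X" "f (g z) = z" if "z \<in> Z" for z
    using that assms by (auto simp: bij_betw_def g_def the_inv_into_into f_the_inv_into_f)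
  let ?\<phi> = "word_eval (free_group Z) (\<lambda>x. [(f x, True)])"
  let ?\<psi> = "word_eval (free_group X) (\<lambda>z. [(g z, True)])"
  have \<phi>: "?\<phi> \<in> hom (free_group X) (free_group Z)"
    using f by (intro Z.word_eval_hom) auto
  have \<psi>: "?\<psi> \<in> hom (free_group Z) (free_group X)"
    using g by (intro X.word_eval_hom) auto
  have "?\<psi> (?\<phi> w) = w" if "w \<in> carrier (free_group X)" for w
    by (rule free_group_hom_eq[OF X.group_axioms, of "\<lambda>w. ?\<psi> (?\<phi> w)" X "\<lambda>w. w"])
      (use hom_compose[OF \<phi> \<psi>] that f in
        \<open>auto simp: comp_def word_eval_letter X.group_axioms Z.group_axioms intro!: homI\<close>)
  moreover have "?\<phi> (?\<psi> w) = w" if "w \<in> carrier (free_group Z)" for w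
    by (rule free_group_hom_eq[OF Z.group_axioms, of "\<lambda>w. ?\<phi> (?\<psi> w)" Z "\<lambda>w. w"])
      (use hom_compose[OF \<psi> \<phi>] that g in
        \<open>auto simp: comp_def word_eval_letter X.group_axioms Z.group_axioms intro!: homI\<close>)
  ultimately have "bij_betw ?\<phi> (carrier (free_group X)) (carrier (free_group Z))"
    using hom_carrier[OF \<phi>] hom_carrier[OF \<psi>] by (intro bij_betw_byWitness[where f' = ?\<psi>]) auto
  then show ?thesis using \<phi> by (auto simp: is_iso_def iso_def)
qed

theorem nielsen_schreier:
  fixes X :: "'x set"
  assumes "subgroup H (free_group X)"
  shows "\<exists>Y :: ('x \<times> 'x letter list) set. (free_group X)\<lparr>carrier := H\<rparr> \<cong> free_group Y"
proof -
  obtain r :: "'x letter rel" where "well_order_on UNIV r" using well_order_on by blast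
  then have "wf (r - Id)" "total (r - Id)"
    by (auto simp: well_order_on_def linear_order_on_def total_on_def)
  then interpret free_subgroup X H "r - Id"
    by (rule free_subgroup.intro[OF assms])
  show ?thesis using rewrite_iso by (auto simp: is_iso_def)
qed

lemma (in group) finitely_generated_iso:
  assumes "finite B" "B \<subseteq> carrier G" "generate G B = carrier G" "h \<in> iso G K" "group K"
  shows "finite (h ` B) \<and> h ` B \<subseteq> carrier K \<and> generate K (h ` B) = carrier K"
proof -
  interpret h: group_hom G K h
    using assms group_axioms by (simp add: group_hom_def group_hom_axioms_def iso_def)
  show ?thesis
    using assms h.generate_img[OF assms(2)] by (auto simp: iso_def bij_betw_def)
qed

text \<open>The basis found by Nielsen--Schreier consists of pairs. Finite generation makes it
  finite, and renaming it to \<open>{..<m}\<close> yields the shape that the definition of limit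
  groups asks for.\<close>

lemma finitely_generated_subgroup_free:
  assumes "finite B" "B \<subseteq> carrier (free_group X)"
  shows "\<exists>m::nat. (free_group X)\<lparr>carrier := generate (free_group X) B\<rparr> \<cong> free_group {..<m}"
proof -
  interpret X: group "free_group X" by (rule group_free_group)
  let ?H = "(free_group X)\<lparr>carrier := generate (free_group X) B\<rparr>"
  have sub: "subgroup (generate (free_group X) B) (free_group X)"
    by (rule X.generate_is_subgroup[OF assms(2)])
  interpret H: group ?H using sub X.group_axioms by (rule subgroup.subgroup_is_group)
  obtain Y :: "('a \<times> 'a letter list) set" and h where h: "h \<in> iso ?H (free_group Y)"
    using nielsen_schreier[OF sub] by (auto simp: is_iso_def)
  have "B \<subseteq> generate (free_group X) B" by (auto intro: generate.incl)
  then have "finite Y"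
    using H.finitely_generated_iso[OF assms(1) _ _ h group_free_group] X.generate_consistent[OF _ sub] 
    by (auto intro: finite_rank)
  then obtain f where "bij_betw f Y {..<card Y}"
    using ex_bij_betw_finite_nat[of Y] by (auto simp: atLeast0LessThan)
  from free_group_iso[OF this] have "?H \<cong> free_group {..<card Y}"
    using h by (auto simp: is_iso_def intro: iso_set_trans)
  then show ?thesis ..
qed

section \<open>Residual finiteness and the Hopf property\<close>

lemma partial_bij_extends_permutes:
  assumes "finite S" "R \<subseteq> S \<times> S" "single_valued R" "single_valued (R\<inverse>)"
  obtains p where "p permutes S" "\<And>a b. (a, b) \<in> R \<Longrightarrow> p a = b"
proof -
  define f where "f a = (THE b. (a, b) \<in> R)" for a
  have f: "f a = b" if "(a, b) \<in> R" for a b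
    using that assms(3) unfolding f_def single_valued_def by blast
  have "inj_on f (Domain R)"
    using assms(4) f by (auto simp: inj_on_def single_valued_def)
  moreover have "f ` Domain R = Range R"
    using f by force
  ultimately have bf: "bij_betw f (Domain R) (Range R)"
    by (simp add: bij_betw_def)
  have sub: "Domain R \<subseteq> S" "Range R \<subseteq> S" using assms(2) by auto
  then have fin: "finite (Domain R)" "finite (Range R)"
    using assms(1) by (blast intro: finite_subset)+
  have "card (S - Domain R) = card (S - Range R)"
    using bij_betw_same_card[OF bf] fin sub by (simp add: card_Diff_subset)
  then obtain g where bg: "bij_betw g (S - Domain R) (S - Range R)"
    using finite_same_card_bij assms(1) by (metis finite_Diff)
  define p where "p a = (if a \<in> S then if a \<in> Domain R then f a else g a else a)" for a
  have "bij_betw p (Domain R) (Range R)"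
    using bf sub by (subst bij_betw_cong[where g = f]) (auto simp: p_def)
  moreover have "bij_betw p (S - Domain R) (S - Range R)"
    using bg by (subst bij_betw_cong[where g = g]) (auto simp: p_def)
  ultimately have "bij_betw p (Domain R \<union> (S - Domain R)) (Range R \<union> (S - Range R))"
    by (rule bij_betw_combine) auto
  moreover have "Domain R \<union> (S - Domain R) = S" "Range R \<union> (S - Range R) = S" using sub by auto
  ultimately have "p permutes S"
    by (intro bij_imp_permutes) (auto simp: p_def)
  moreover have "p a = b" if "(a, b) \<in> R" for a b
    using that f sub by (auto simp: p_def)
  ultimately show ?thesis by (rule that)
qed

lemma reduced_nth: "reduced w \<Longrightarrow> Suc j < length w \<Longrightarrow> w ! Suc j \<noteq> inv_letter (w ! j)"
proof (induction w arbitrary: j)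
  case (Cons l w)
  then show ?case
    by (cases w; cases j) (auto dest: reduced_tl)
qed simp

text \<open>A reduced word of length \<open>n\<close> is made to act on \<open>{1..n + 1}\<close> so that its letters, read from
  the right, move \<open>n + 1\<close> step by step down to \<open>1\<close>.\<close>

lemma free_group_residually_finite:
  assumes "reduced w" "w \<noteq> []"
  obtains N s where "range s \<subseteq> carrier (sym_group N)" "word_eval (sym_group N) s w \<noteq> id"
proof -
  define n where "n = length w"
  interpret S: group "sym_group (Suc n)" by (rule sym_group_is_group)
  define R where "R x = {(Suc (Suc j), Suc j) |j. j < n \<and> w ! j = (x, True)} \<union>
    {(Suc j, Suc (Suc j)) |j. j < n \<and> w ! j = (x, False)}" for x
  have "\<exists>p. p permutes {1..Suc n} \<and> (\<forall>a b. (a, b) \<in> R x \<longrightarrow> p a = b)" for x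
  proof -
    \<comment> \<open>Two prescribed moves of \<open>s x\<close> can clash only if they come from
      neighbouring letters that are inverse to each other, and a reduced word has none.\<close>
    have no: "w ! Suc j = (x, False) \<Longrightarrow> w ! j = (x, True) \<Longrightarrow> \<not> Suc j < n"
      "w ! Suc j = (x, True) \<Longrightarrow> w ! j = (x, False) \<Longrightarrow> \<not> Suc j < n" for j
      using reduced_nth[OF assms(1), of j] by (auto simp: n_def inv_letter_def)
    have "R x \<subseteq> {1..Suc n} \<times> {1..Suc n}" by (auto simp: R_def)
    moreover have "single_valued (R x)" "single_valued ((R x)\<inverse>)"
      using no by (auto simp: single_valued_def R_def)
    ultimately show ?thesis
      using partial_bij_extends_permutes[of "{1..Suc n}" "R x"] by blast
  qed
  then obtain s where s: "\<And>x. s x permutes {1..Suc n}" "\<And>x a b. (a, b) \<in> R x \<Longrightarrow> s x a = b"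
    by metis
  have "word_eval (sym_group (Suc n)) s (drop j w) (Suc n) = Suc j" if "j \<le> n" for j
    using that
  proof (induction j rule: inc_induct)
    case base
    then show ?case by (simp add: n_def word_eval_def sym_group_one)
  next
    case (step j)
    obtain x b where wj: "w ! j = (x, b)" by force
    have "drop j w = (x, b) # drop (Suc j) w"
      using step(2) wj by (simp add: n_def Cons_nth_drop_Suc[symmetric])
    then have "word_eval (sym_group (Suc n)) s (drop j w) (Suc n) =
        (if b then s x else inv_into UNIV (s x)) (Suc (Suc j))"
      using step.IH s(1)[of x] by (simp add: word_eval_def sym_group_mult sym_group_carrier)
    moreover have "s x (Suc (Suc j)) = Suc j" if b
      using that step(2) wj by (intro s(2)) (auto simp: R_def)
    moreover have "s x (Suc j) = Suc (Suc j)" if "\<not> b"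
      using that step(2) wj by (intro s(2)) (auto simp: R_def)
    ultimately show ?case
      using permutes_inverses(2)[OF s(1)] by (cases b) (auto simp: permutes_inv_eq[OF s(1)])
  qed
  from this[of 0] have "word_eval (sym_group (Suc n)) s w \<noteq> id"
    using assms(2) by (auto simp: n_def)
  then show ?thesis
    using s(1) by (intro that[of s "Suc n"]) (auto simp: sym_group_carrier)
qed

text \<open>Evaluation at the \<open>n\<close> generators embeds the homomorphisms from the free group to a finite group
  \<open>K\<close>, of which there are \<open>card K ^ card X\<close>, into the \<open>n\<close>-tuples of \<open>K\<close>. So every \<open>n\<close>-tuple is attained
  and satisfies all relations of the generators, against residual finiteness.\<close>

lemma hopfian_free_group:
  fixes a :: "nat \<Rightarrow> 'x letter list"
  assumes "finite X" "n \<le> card X" "a ` {..<n} \<subseteq> carrier (free_group X)"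
    and gen: "generate (free_group X) (a ` {..<n}) = carrier (free_group X)"
    and w: "w \<in> carrier (free_group {..<n})" "w \<noteq> []"
  shows "word_eval (free_group X) a w \<noteq> []"
proof
  assume w1: "word_eval (free_group X) a w = []"
  obtain N s where s: "range s \<subseteq> carrier (sym_group N)" "word_eval (sym_group N) s w \<noteq> id"
    using free_group_residually_finite[OF free_group_reduced[OF w(1)] w(2)] by blast
  interpret K: group "sym_group N" by (rule sym_group_is_group)
  interpret F: group "free_group X" by (rule group_free_group)
  let ?K = "carrier (sym_group N)"
  have fin: "finite ?K" unfolding sym_group_def by (simp add: finite_permutations)
  have card: "card ?K \<ge> 1"
    using fin K.one_closed by (metis One_nat_def Suc_leI card_gt_0_iff empty_iff)
  define \<Theta> where "\<Theta> q = (\<lambda>i\<in>{..<n}. word_eval (sym_group N) q (a i))" for q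
  have hom: "word_eval (sym_group N) q \<in> hom (free_group X) (sym_group N)" if "q \<in> X \<rightarrow>\<^sub>E ?K" for q
    using that by (intro K.word_eval_hom) auto
  have \<Theta>: "\<Theta> ` (X \<rightarrow>\<^sub>E ?K) \<subseteq> {..<n} \<rightarrow>\<^sub>E ?K"
    using hom_in_carrier[OF hom] assms(3) by (auto simp: \<Theta>_def)
  have inj: "inj_on \<Theta> (X \<rightarrow>\<^sub>E ?K)"
  proof (rule inj_onI)
    fix q q' assume q: "q \<in> X \<rightarrow>\<^sub>E ?K" "q' \<in> X \<rightarrow>\<^sub>E ?K" "\<Theta> q = \<Theta> q'"
    have "word_eval (sym_group N) q (a i) = word_eval (sym_group N) q' (a i)" if "i < n" for i
      using fun_cong[OF q(3), of i] that by (simp add: \<Theta>_def)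
    then have eq: "word_eval (sym_group N) q v = word_eval (sym_group N) q' v"
      if "v \<in> carrier (free_group X)" for v
      using generate_hom_eq[OF F.group_axioms K.group_axioms hom[OF q(1)] hom[OF q(2)] assms(3)]
        that gen by blast
    show "q = q'"
    proof (rule PiE_ext[OF q(1,2)])
      fix x assume x: "x \<in> X"
      then have "q x \<in> ?K" "q' x \<in> ?K" using q by auto
      then show "q x = q' x"
        using eq[of "[(x, True)]"] x by (simp add: word_eval_letter K.group_axioms)
    qed
  qed
  have "card (\<Theta> ` (X \<rightarrow>\<^sub>E ?K)) = card ?K ^ card X"
    using inj assms(1) by (simp add: card_image card_PiE)
  moreover have "card ({..<n} \<rightarrow>\<^sub>E ?K) = card ?K ^ n"
    by (simp add: card_PiE)
  moreover have "card ?K ^ n \<le> card ?K ^ card X"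
    using card assms(2) by (intro power_increasing)
  ultimately have "\<Theta> ` (X \<rightarrow>\<^sub>E ?K) = {..<n} \<rightarrow>\<^sub>E ?K"
    using \<Theta> fin by (intro card_seteq finite_PiE) auto
  moreover have "restrict s {..<n} \<in> {..<n} \<rightarrow>\<^sub>E ?K" using s(1) by auto
  ultimately have "restrict s {..<n} \<in> \<Theta> ` (X \<rightarrow>\<^sub>E ?K)"
    by (simp only:)
  then obtain q where q: "q \<in> X \<rightarrow>\<^sub>E ?K" "restrict s {..<n} = \<Theta> q"
    by (rule imageE) (rule that)
  have q': "word_eval (sym_group N) q (a i) = s i" if "i < n" for i
    using fun_cong[OF q(2), of i] that by (simp add: \<Theta>_def)
  have letters: "fst ` set w \<subseteq> {..<n}" using w(1) by (rule free_group_letters)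
  have "id = word_eval (sym_group N) q (word_eval (free_group X) a w)"
    unfolding w1 by (simp add: word_eval_def sym_group_one)
  also have "\<dots> = word_eval (sym_group N) (\<lambda>i. word_eval (sym_group N) q (a i)) w"
    by (rule hom_word_eval[OF F.group_axioms K.group_axioms hom[OF q(1)] assms(3) letters])
  also have "\<dots> = word_eval (sym_group N) s w"
    using letters q' by (intro word_eval_cong) auto
  finally show False using s(2) by simp
qed


section \<open>Commuting elements of free groups\<close>

lemma (in group) generate_commute:
  assumes "A \<subseteq> carrier G" "z \<in> carrier G" "\<And>a. a \<in> A \<Longrightarrow> z \<otimes> a = a \<otimes> z" "x \<in> generate G A"
  shows "z \<otimes> x = x \<otimes> z"
proof -
  have "subgroup {x \<in> carrier G. z \<otimes> x = x \<otimes> z} G"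
  proof (rule subgroupI)
    fix x assume "x \<in> {x \<in> carrier G. z \<otimes> x = x \<otimes> z}"
    then show "inv x \<in> {x \<in> carrier G. z \<otimes> x = x \<otimes> z}"
      using assms(2) by (auto) (metis inv_closed inv_solve_left inv_solve_right m_assoc m_closed)
  next
    fix x y assume "x \<in> {x \<in> carrier G. z \<otimes> x = x \<otimes> z}" "y \<in> {x \<in> carrier G. z \<otimes> x = x \<otimes> z}"
    then show "x \<otimes> y \<in> {x \<in> carrier G. z \<otimes> x = x \<otimes> z}"
      using assms(2) by (auto) (metis m_assoc)
  qed (use assms(2) in auto)
  then show ?thesis
    using generate_subgroup_incl[of A "{x \<in> carrier G. z \<otimes> x = x \<otimes> z}"] assms by auto
qed

lemma (in group) generate_commuting:
  assumes "A \<subseteq> carrier G" "\<And>a b. a \<in> A \<Longrightarrow> b \<in> A \<Longrightarrow> a \<otimes> b = b \<otimes> a"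
    and "x \<in> generate G A" "y \<in> generate G A"
  shows "x \<otimes> y = y \<otimes> x"
proof -
  have "x \<in> carrier G" using generate_incl[OF assms(1)] assms(3) by blast
  moreover have "x \<otimes> a = a \<otimes> x" if "a \<in> A" for a
    using generate_commute[OF assms(1) _ _ assms(3), of a] assms(1,2) that by (metis subsetD)
  ultimately show ?thesis using generate_commute[OF assms(1) _ _ assms(4)] by blast
qed

lemma generate_letters:
  "generate (free_group X) ((\<lambda>x. [(x, True)]) ` X) = carrier (free_group X)"
  by (rule free_group_subgroup_eq)
    (auto intro!: group.generate_is_subgroup[OF group_free_group] generate.incl)

lemma free_group_rank_le_1_commute:
  assumes "card X \<le> 1" "finite X" "u \<in> carrier (free_group X)" "v \<in> carrier (free_group X)"
  shows "foldr push u v = foldr push v u"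
proof -
  interpret F: group "free_group X" by (rule group_free_group)
  have "x = y" if "x \<in> X" "y \<in> X" for x y
    using that assms(1,2) card_le_Suc0_iff_eq[of X] by simp
  then have "a \<otimes>\<^bsub>free_group X\<^esub> b = b \<otimes>\<^bsub>free_group X\<^esub> a"
    if "a \<in> (\<lambda>x. [(x, True)]) ` X" "b \<in> (\<lambda>x. [(x, True)]) ` X" for a b
    using that by (metis imageE)
  then have "u \<otimes>\<^bsub>free_group X\<^esub> v = v \<otimes>\<^bsub>free_group X\<^esub> u"
    by (rule F.generate_commuting[of "(\<lambda>x. [(x, True)]) ` X", rotated])
      (use assms(3,4) in \<open>simp_all add: generate_letters image_subset_iff\<close>)
  then show ?thesis by (simp add: mult_free_group)
qed

lemma reduced_snoc: "reduced (w @ [k]) \<longleftrightarrow> reduced w \<and> (w = [] \<or> k \<noteq> inv_letter (last w))"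
  by (induction w rule: reduced.induct) auto

lemma foldr_push_append: "reduced (u @ v) \<Longrightarrow> foldr push u v = u @ v"
proof (induction u)
  case (Cons l u)
  then show ?case using push_Cons[of l "u @ v"] reduced_tl[of l "u @ v"] by simp
qed simp

text \<open>Take a generator \<open>x\<close> other than that of the first letter of
  \<open>w\<close>. Then \<open>x w\<close> is reduced and begins with \<open>x\<close>, whereas
  \<open>w x\<close> either begins with the first letter of \<open>w\<close> or is shorter than
  \<open>w\<close>.\<close>

lemma free_group_center_trivial:
  assumes "y \<in> X" "z \<in> X" "y \<noteq> z" "w \<in> carrier (free_group X)"
    and comm: "\<And>x. x \<in> X \<Longrightarrow> foldr push [(x, True)] w = foldr push w [(x, True)]"
  shows "w = []"
proof (rule ccontr)
  assume "w \<noteq> []"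
  then obtain l v where w: "w = l # v" by (cases w) auto
  have red: "reduced w" using assms(4) by (rule free_group_reduced)
  obtain x where x: "x \<in> X" "x \<noteq> fst l" using assms(1-3) by metis
  have eq: "foldr push w [(x, True)] = (x, True) # w"
  proof -
    have "push (x, True) w = (x, True) # w"
      using x(2) w by (auto simp: inv_letter_def)
    then show ?thesis using comm[OF x(1)] by simp
  qed
  show False
  proof (cases "(x, True) = inv_letter (last w)")
    case False
    then have "foldr push w [(x, True)] = w @ [(x, True)]"
      using red by (intro foldr_push_append) (simp add: reduced_snoc)
    then show False using eq x(2) w by auto
  next
    case True
    then have last: "last w = inv_letter (x, True)" by simp
    have w': "w = butlast w @ [last w]" using \<open>w \<noteq> []\<close> by simp
    then have "reduced (butlast w)" using red reduced_snoc by metis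
    then have "foldr push w [(x, True)] = butlast w"
      by (subst w', subst last) (simp add: foldr_push_Nil)
    then have "length (butlast w) = length ((x, True) # w)" using eq by (simp only:)
    then show False by simp
  qed
qed

lemma (in group) iso_commute_iff:
  assumes "h \<in> iso G K" "x \<in> carrier G" "y \<in> carrier G"
  shows "h x \<otimes>\<^bsub>K\<^esub> h y = h y \<otimes>\<^bsub>K\<^esub> h x \<longleftrightarrow> x \<otimes> y = y \<otimes> x"
proof -
  have "h x \<otimes>\<^bsub>K\<^esub> h y = h (x \<otimes> y)" "h y \<otimes>\<^bsub>K\<^esub> h x = h (y \<otimes> x)" "inj_on h (carrier G)"
    using assms by (auto simp: iso_def hom_def bij_betw_def)
  then show ?thesis using assms(2,3) by (metis inj_onD m_closed)
qed

text \<open>Freeness of the pair is stated for one word at a time, the form in which it passes to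
  limits.\<close>

lemma noncommuting_free_pair:
  fixes s :: "nat \<Rightarrow> 'x letter list"
  assumes s: "s 0 \<in> carrier (free_group X)" "s 1 \<in> carrier (free_group X)"
    and nc: "foldr push (s 0) (s 1) \<noteq> foldr push (s 1) (s 0)"
    and w: "w \<in> carrier (free_group {..<2})" "w \<noteq> []"
  shows "word_eval (free_group X) s w \<noteq> []"
proof
  assume w1: "word_eval (free_group X) s w = []"
  let ?B = "s ` {..<2}"
  let ?H = "(free_group X)\<lparr>carrier := generate (free_group X) ?B\<rparr>"
  interpret F: group "free_group X" by (rule group_free_group)
  have B: "?B \<subseteq> carrier (free_group X)"
    using s by (auto simp: less_2_cases_iff)
  have sub: "subgroup (generate (free_group X) ?B) (free_group X)"
    by (rule F.generate_is_subgroup[OF B])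
  interpret H: group ?H using sub F.group_axioms by (rule subgroup.subgroup_is_group)
  obtain m :: nat and h where h: "h \<in> iso ?H (free_group {..<m})"
    using finitely_generated_subgroup_free[OF _ B] by (auto simp: is_iso_def)
  interpret M: group "free_group {..<m}" by (rule group_free_group)
  have BH: "?B \<subseteq> carrier ?H" by (auto intro: generate.incl)
  have gen: "generate (free_group {..<m}) ((\<lambda>i. h (s i)) ` {..<2}) = carrier (free_group {..<m})"
      "(\<lambda>i. h (s i)) ` {..<2} \<subseteq> carrier (free_group {..<m})"
    using H.finitely_generated_iso[OF _ BH _ h M.group_axioms] F.generate_consistent[OF _ sub, of ?B] BH
    by (simp_all add: image_image)
  have s01: "s 0 \<in> ?B" "s 1 \<in> ?B" by auto
  have "foldr push (h (s 0)) (h (s 1)) \<noteq> foldr push (h (s 1)) (h (s 0))"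
    using H.iso_commute_iff[OF h subsetD[OF BH s01(1)] subsetD[OF BH s01(2)]] nc by (simp add: mult_free_group)
  then have "2 \<le> card {..<m}"
    using free_group_rank_le_1_commute[of "{..<m}" "h (s 0)" "h (s 1)"] gen(2) s01 by force
  then have "word_eval (free_group {..<m}) (\<lambda>i. h (s i)) w \<noteq> []"
    using hopfian_free_group[OF _ _ gen(2,1) w] by simp
  moreover have "word_eval (free_group {..<m}) (\<lambda>i. h (s i)) w = h (word_eval ?H s w)"
    by (rule hom_word_eval[symmetric, OF H.group_axioms M.group_axioms _ BH])
      (use h free_group_letters[OF w(1)] in \<open>auto simp: iso_def\<close>)
  moreover have "word_eval ?H s w = word_eval (free_group X) s w"
    using BH free_group_letters[OF w(1)] by (intro F.word_eval_subgroup[OF sub]) auto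
  moreover have "h [] = []"
    using hom_one[of h ?H "free_group {..<m}"] h H.group_axioms M.group_axioms
    by (simp add: iso_def one_free_group)
  ultimately show False by (simp add: w1)
qed

text \<open>\<open>b\<close> commutes with all three generators of the subgroup generated by
  \<open>a\<close>, \<open>b\<close> and \<open>c\<close>. A central element other than the identity
  forces the rank of this free group down to at most 1.\<close>

lemma free_group_commute_trans:
  assumes abc: "a \<in> carrier (free_group X)" "b \<in> carrier (free_group X)" "c \<in> carrier (free_group X)"
    and "b \<noteq> []" and ab: "foldr push a b = foldr push b a" and bc: "foldr push b c = foldr push c b"
  shows "foldr push a c = foldr push c a"
proof -
  let ?B = "{a, b, c}"
  let ?H = "(free_group X)\<lparr>carrier := generate (free_group X) ?B\<rparr>"
  interpret F: group "free_group X" by (rule group_free_group)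
  have B: "?B \<subseteq> carrier (free_group X)" using abc by auto
  have sub: "subgroup (generate (free_group X) ?B) (free_group X)"
    by (rule F.generate_is_subgroup[OF B])
  interpret H: group ?H using sub F.group_axioms by (rule subgroup.subgroup_is_group)
  obtain m :: nat and h where h: "h \<in> iso ?H (free_group {..<m})"
    using finitely_generated_subgroup_free[OF _ B] by (auto simp: is_iso_def)
  interpret M: group "free_group {..<m}" by (rule group_free_group)
  have BH: "a \<in> carrier ?H" "b \<in> carrier ?H" "c \<in> carrier ?H" by (auto intro: generate.incl)
  have h_image: "h ` carrier ?H = carrier (free_group {..<m})"
    using h unfolding iso_def bij_betw_def by blast
  have h_closed: "h x \<in> carrier (free_group {..<m})" if "x \<in> carrier ?H" for x
    using h that by (auto simp: iso_def hom_def)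
  show ?thesis
  proof (cases "m \<le> 1")
    case True
    then have "foldr push (h a) (h c) = foldr push (h c) (h a)"
      by (intro free_group_rank_le_1_commute[of "{..<m}"] h_closed BH) auto
    then show ?thesis
      using H.iso_commute_iff[OF h BH(1,3)] by (simp add: mult_free_group)
  next
    case False
    have "foldr push (h b) v = foldr push v (h b)" if v: "v \<in> carrier (free_group {..<m})" for v
    proof -
      have "v \<in> h ` carrier ?H" using v by (simp only: h_image)
      then obtain x where x: "x \<in> carrier ?H" "v = h x" by blast
      have "b \<otimes>\<^bsub>free_group X\<^esub> x = x \<otimes>\<^bsub>free_group X\<^esub> b"
      proof (rule F.generate_commute[OF B abc(2)])
        fix d assume "d \<in> ?B"
        then have "foldr push b d = foldr push d b"
          using ab[symmetric] bc by (elim insertE emptyE) (simp_all only:)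
        then show "b \<otimes>\<^bsub>free_group X\<^esub> d = d \<otimes>\<^bsub>free_group X\<^esub> b"
          by (simp only: mult_free_group)
      qed (use x(1) in simp)
      then show ?thesis using H.iso_commute_iff[OF h BH(2) x(1)] x(2) by (simp add: mult_free_group)
    qed
    then have "h b = []"
      using free_group_center_trivial[of 0 "{..<m}" 1 "h b"] False h_closed[OF BH(2)] by simp
    moreover have "h [] = []"
      using hom_one[of h ?H "free_group {..<m}"] h H.group_axioms M.group_axioms
      by (simp add: iso_def one_free_group)
    moreover have "[] \<in> carrier ?H" using H.one_closed by (simp add: one_free_group)
    ultimately have "b = []"
      using h BH(2) by (auto simp: iso_def bij_betw_def inj_on_def)
    then show ?thesis using assms(4) by simp
  qed
qed

lemma free_group_commute_conjugate:
  assumes gh: "g \<in> carrier (free_group X)" "h \<in> carrier (free_group X)"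
    and comm: "h \<otimes>\<^bsub>free_group X\<^esub> (g \<otimes>\<^bsub>free_group X\<^esub> h \<otimes>\<^bsub>free_group X\<^esub> inv\<^bsub>free_group X\<^esub> g) =
      (g \<otimes>\<^bsub>free_group X\<^esub> h \<otimes>\<^bsub>free_group X\<^esub> inv\<^bsub>free_group X\<^esub> g) \<otimes>\<^bsub>free_group X\<^esub> h"
  shows "foldr push g h = foldr push h g"
proof (rule ccontr)
  assume nc: "foldr push g h \<noteq> foldr push h g"
  interpret F: group "free_group X" by (rule group_free_group)
  define s where "s i = (if i = 0 then h else g)" for i :: nat
  \<comment> \<open>The commutator of \<open>h\<close> and \<open>g h g^-1\<close>, with 0 for
    \<open>h\<close> and 1 for \<open>g\<close>. It is reduced as it stands, hence not trivial in
    the free group on 0 and 1.\<close>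
  define w :: "nat letter list" where
    "w = [(0, True), (1, True), (0, True), (1, False), (0, False), (1, True), (0, False), (1, False)]"
  have "w \<in> carrier (free_group {..<2})" "w \<noteq> []"
    by (auto simp: w_def free_group_def inv_letter_def)
  then have "word_eval (free_group X) s w \<noteq> []"
    using gh nc by (intro noncommuting_free_pair) (auto simp: s_def)
  moreover have "word_eval (free_group X) s w =
    (h \<otimes>\<^bsub>free_group X\<^esub> (g \<otimes>\<^bsub>free_group X\<^esub> h \<otimes>\<^bsub>free_group X\<^esub> inv\<^bsub>free_group X\<^esub> g)) \<otimes>\<^bsub>free_group X\<^esub>
    inv\<^bsub>free_group X\<^esub> ((g \<otimes>\<^bsub>free_group X\<^esub> h \<otimes>\<^bsub>free_group X\<^esub> inv\<^bsub>free_group X\<^esub> g) \<otimes>\<^bsub>free_group X\<^esub> h)"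
    using gh by (simp add: word_eval_def w_def s_def F.inv_mult_group F.m_assoc)
  ultimately show False
    using gh by (simp add: comm one_free_group)
qed


section \<open>Limits of free groups\<close>

lemma (in group) mult_inv_eq_one_iff:
  "x \<in> carrier G \<Longrightarrow> y \<in> carrier G \<Longrightarrow> x \<otimes> inv y = \<one> \<longleftrightarrow> x = y"
  by (metis inv_closed inv_equality inv_inv r_inv)

lemma (in group) commutator_eq_one_iff:
  assumes "a \<in> carrier G" "b \<in> carrier G"
  shows "commutator G a b = \<one> \<longleftrightarrow> a \<otimes> b = b \<otimes> a"
proof -
  have "commutator G a b = a \<otimes> b \<otimes> inv (b \<otimes> a)"
    using assms by (simp add: commutator_def inv_mult_group m_assoc)
  then show ?thesis using assms by (simp add: mult_inv_eq_one_iff)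
qed

lemma word_eval_image:
  assumes "group G" "marking G S"
  shows "word_eval G ((!) S) ` carrier (free_group {..<length S}) = carrier G"
proof -
  interpret G: group G by fact
  have S: "(!) S ` {..<length S} = set S" by (auto simp: in_set_conv_nth)
  have sub: "set S \<subseteq> carrier G" using assms(2) by (simp add: marking_def)
  interpret h: group_hom "free_group {..<length S}" G "word_eval G ((!) S)"
    using sub S by (intro group_hom.intro group_hom_axioms.intro group_free_group G.group_axioms
        G.word_eval_hom) simp
  have "set S \<subseteq> word_eval G ((!) S) ` carrier (free_group {..<length S})"
  proof
    fix x assume "x \<in> set S"
    then obtain i where i: "i < length S" "x = S ! i" by (auto simp: in_set_conv_nth)
    then have "word_eval G ((!) S) [(i, True)] = x"
      using sub by (intro trans[OF word_eval_letter[OF G.group_axioms]]) auto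
    then show "x \<in> word_eval G ((!) S) ` carrier (free_group {..<length S})"
      using i(1) by (intro image_eqI[of _ _ "[(i, True)]"]) auto
  qed
  then have "generate G (set S) \<subseteq> word_eval G ((!) S) ` carrier (free_group {..<length S})"
    by (intro G.generate_subgroup_incl h.img_is_subgroup)
  then show ?thesis using assms(2) hom_carrier[OF h.homh] unfolding marking_def by blast
qed

lemma mem_marking_kernel_iff:
  "w \<in> marking_kernel G S \<longleftrightarrow>
    w \<in> carrier (free_group {..<length S}) \<and> word_eval G ((!) S) w = \<one>\<^bsub>G\<^esub>"
  by (simp add: marking_kernel_def kernel_def)

text \<open>Convergence of the marking kernels, spelled out for each word separately; the index from
  which the equivalence holds depends on the word.\<close>

locale limit_of_free_groups = group G for G (structure) +
  fixes S :: "'a list" and m :: "nat \<Rightarrow> nat" and T :: "nat \<Rightarrow> nat letter list list"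
  assumes marking: "marking G S"
    and marking_T: "\<And>k. marking (free_group {..<m k}) (T k)"
    and length_T: "\<And>k. length (T k) = length S"
    and eventually_one: "\<And>w. w \<in> carrier (free_group {..<length S}) \<Longrightarrow>
      \<forall>\<^sub>F k in sequentially. word_eval (free_group {..<m k}) ((!) (T k)) w = [] \<longleftrightarrow>
        word_eval G ((!) S) w = \<one>"

lemma limit_group_iff:
  "limit_group G \<longleftrightarrow> (\<exists>S m T. limit_of_free_groups G S m T)"
proof -
  have *: "limitin (marked_groups (length S))
      (\<lambda>k. marking_kernel (free_group {..<m k}) (T k)) (marking_kernel G S) sequentially \<longleftrightarrow>
    (\<forall>w\<in>carrier (free_group {..<length S}). \<forall>\<^sub>F k in sequentially.
      word_eval (free_group {..<m k}) ((!) (T k)) w = [] \<longleftrightarrow> word_eval G ((!) S) w = \<one>\<^bsub>G\<^esub>)"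
    if "group G" "marking G S" "\<And>k. marking (free_group {..<m k}) (T k)" "\<And>k. length (T k) = length S"
    for S and m :: "nat \<Rightarrow> nat" and T :: "nat \<Rightarrow> nat letter list list"
  proof -
    have "marking_kernel (free_group {..<m k}) (T k) \<lhd> free_group {..<length S}" for k
      using marking_kernel_normal[OF group_free_group that(3), of k] that(4) by simp
    then show ?thesis
      using limitin_marked_groups[OF marking_kernel_normal[OF that(1,2)]] that(4)
      by (simp add: mem_marking_kernel_iff one_free_group)
  qed
  show ?thesis
    unfolding limit_group_def limit_of_free_groups_def limit_of_free_groups_axioms_def
    using * by (safe; blast)
qed

context limit_of_free_groups
begin

abbreviation "F \<equiv> free_group {..<length S}"
abbreviation "F' k \<equiv> free_group {..<m k}"

definition eval :: "nat letter list \<Rightarrow> 'a" where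
  "eval w = word_eval G ((!) S) w"

definition eval_approx :: "nat \<Rightarrow> nat letter list \<Rightarrow> nat letter list" where
  "eval_approx k w = word_eval (F' k) ((!) (T k)) w"

lemma S_closed: "(!) S ` {..<length S} \<subseteq> carrier G"
  using marking by (auto simp: marking_def)

lemma T_closed: "(!) (T k) ` {..<length S} \<subseteq> carrier (F' k)"
  using marking_T[of k] length_T[of k] by (auto simp: marking_def)

sublocale F: group F by (rule group_free_group)
sublocale F': group "F' k" for k by (rule group_free_group)

sublocale eval: group_hom F G eval
  unfolding eval_def[abs_def]
  by (intro group_hom.intro group_hom_axioms.intro group_free_group group_axioms word_eval_hom S_closed)

sublocale eval_approx: group_hom F "F' k" "eval_approx k" for k
  unfolding eval_approx_def[abs_def]
  by (intro group_hom.intro group_hom_axioms.intro group_free_group F'.word_eval_hom T_closed)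

lemma eval_image: "eval ` carrier F = carrier G"
  using word_eval_image[OF group_axioms marking] by (simp add: eval_def[abs_def])

lemma eval_approx_image: "eval_approx k ` carrier F = carrier (F' k)"
  using word_eval_image[OF group_free_group marking_T, of k] length_T[of k]
  by (simp add: eval_approx_def[abs_def])

lemma obtain_word:
  assumes "x \<in> carrier G"
  obtains w where "w \<in> carrier F" "eval w = x"
  using assms eval_image by (metis imageE)

lemma eventually_eq:
  assumes "u \<in> carrier F" "v \<in> carrier F"
  shows "\<forall>\<^sub>F k in sequentially. eval_approx k u = eval_approx k v \<longleftrightarrow> eval u = eval v"
proof -
  have uv: "u \<otimes>\<^bsub>F\<^esub> inv\<^bsub>F\<^esub> v \<in> carrier F" using assms by simp
  have "\<forall>\<^sub>F k in sequentially. eval_approx k (u \<otimes>\<^bsub>F\<^esub> inv\<^bsub>F\<^esub> v) = \<one>\<^bsub>F' k\<^esub> \<longleftrightarrow>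
      eval (u \<otimes>\<^bsub>F\<^esub> inv\<^bsub>F\<^esub> v) = \<one>"
    using eventually_one[OF uv] by (simp only: eval_def eval_approx_def one_free_group)
  then show ?thesis
  proof eventually_elim
    case (elim k)
    then show ?case
      using assms by (simp add: F'.mult_inv_eq_one_iff mult_inv_eq_one_iff)
  qed
qed

lemma commute_trans:
  assumes abc: "a \<in> carrier G" "b \<in> carrier G" "c \<in> carrier G"
    and b: "b \<noteq> \<one>" and ab: "a \<otimes> b = b \<otimes> a" and bc: "b \<otimes> c = c \<otimes> b"
  shows "a \<otimes> c = c \<otimes> a"
proof -
  obtain u where u: "u \<in> carrier F" "eval u = a" using abc(1) by (rule obtain_word)
  obtain v where v: "v \<in> carrier F" "eval v = b" using abc(2) by (rule obtain_word)
  obtain w where w: "w \<in> carrier F" "eval w = c" using abc(3) by (rule obtain_word)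
  \<comment> \<open>The claim does not mention \<open>k\<close>, so a single index at which all four
    equivalences hold proves it.\<close>
  have "\<forall>\<^sub>F k in sequentially. a \<otimes> c = c \<otimes> a"
    using eventually_eq[OF v(1) F.one_closed]
      eventually_eq[OF F.m_closed[OF u(1) v(1)] F.m_closed[OF v(1) u(1)]]
      eventually_eq[OF F.m_closed[OF v(1) w(1)] F.m_closed[OF w(1) v(1)]]
      eventually_eq[OF F.m_closed[OF u(1) w(1)] F.m_closed[OF w(1) u(1)]]
  proof eventually_elim
    case (elim k)
    have "foldr push (eval_approx k u) (eval_approx k w) = foldr push (eval_approx k w) (eval_approx k u)"
    proof (rule free_group_commute_trans)
      show "eval_approx k v \<noteq> []"
        using elim(1) b v u by (simp add: one_free_group[of "{..<m k}", symmetric])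
      show "foldr push (eval_approx k u) (eval_approx k v) = foldr push (eval_approx k v) (eval_approx k u)"
        using elim(2) u v ab by (simp add: mult_free_group[where X = "{..<m k}", symmetric])
      show "foldr push (eval_approx k v) (eval_approx k w) = foldr push (eval_approx k w) (eval_approx k v)"
        using elim(3) v w bc by (simp add: mult_free_group[where X = "{..<m k}", symmetric])
    qed (use u v w in \<open>auto intro: eval_approx.hom_closed\<close>)
    then show ?case
      using elim(4) u w by (simp add: mult_free_group[where X = "{..<m k}", symmetric])
  qed
  then show ?thesis by simp
qed

lemma commute_conjugate:
  assumes gh: "g \<in> carrier G" "h \<in> carrier G"
    and comm: "h \<otimes> (g \<otimes> h \<otimes> inv g) = (g \<otimes> h \<otimes> inv g) \<otimes> h"
  shows "g \<otimes> h = h \<otimes> g"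
proof -
  obtain u where u: "u \<in> carrier F" "eval u = g" using gh(1) by (rule obtain_word)
  obtain v where v: "v \<in> carrier F" "eval v = h" using gh(2) by (rule obtain_word)
  let ?c = "u \<otimes>\<^bsub>F\<^esub> v \<otimes>\<^bsub>F\<^esub> inv\<^bsub>F\<^esub> u"
  have c: "?c \<in> carrier F" using u v by simp
  have "\<forall>\<^sub>F k in sequentially. g \<otimes> h = h \<otimes> g"
    using eventually_eq[OF F.m_closed[OF v(1) c] F.m_closed[OF c v(1)]]
      eventually_eq[OF F.m_closed[OF u(1) v(1)] F.m_closed[OF v(1) u(1)]]
  proof eventually_elim
    case (elim k)
    have "foldr push (eval_approx k u) (eval_approx k v) = foldr push (eval_approx k v) (eval_approx k u)"
      using elim(1) u v c comm by (intro free_group_commute_conjugate) auto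
    then show ?case
      using elim(2) u v by (simp add: mult_free_group[where X = "{..<m k}", symmetric])
  qed
  then show ?thesis by simp
qed

lemma noncommuting_free:
  fixes s :: "nat \<Rightarrow> 'a"
  assumes s: "s 0 \<in> carrier G" "s 1 \<in> carrier G" and nc: "s 0 \<otimes> s 1 \<noteq> s 1 \<otimes> s 0"
    and w: "w \<in> carrier (free_group {..<2})" "w \<noteq> []"
  shows "word_eval G s w \<noteq> \<one>"
proof
  assume w1: "word_eval G s w = \<one>"
  obtain u0 where u0: "u0 \<in> carrier F" "eval u0 = s 0" using s(1) by (rule obtain_word)
  obtain u1 where u1: "u1 \<in> carrier F" "eval u1 = s 1" using s(2) by (rule obtain_word)
  define u where "u i = (if i = 0 then u0 else u1)" for i :: nat
  have u: "u ` {..<2} \<subseteq> carrier F" using u0 u1 by (auto simp: u_def)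
  note letters = free_group_letters[OF w(1)]
  have us: "eval (u i) = s i" if "i < 2" for i
    using u0(2) u1(2) that by (auto simp: u_def less_2_cases_iff)
  have e: "eval (word_eval F u w) = word_eval G s w"
    unfolding hom_word_eval[OF F.group_axioms group_axioms eval.homh u letters]
    by (rule word_eval_cong) (use letters us in blast)
  have "\<forall>\<^sub>F k in sequentially. False"
    using eventually_eq[OF F.word_eval_closed[OF u letters] F.one_closed]
      eventually_eq[OF F.m_closed[OF u0(1) u1(1)] F.m_closed[OF u1(1) u0(1)]]
  proof eventually_elim
    case (elim k)
    have "eval_approx k (word_eval F u w) = word_eval (F' k) (\<lambda>i. eval_approx k (u i)) w"
      by (rule hom_word_eval[OF F.group_axioms F'.group_axioms eval_approx.homh u letters])
    also have "\<dots> \<noteq> []"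
      using elim(2) u0 u1 nc
      by (intro noncommuting_free_pair w) (auto simp: u_def mult_free_group[where X = "{..<m k}", symmetric])
    finally show False
      using elim(1) by (simp add: e w1 one_free_group[of "{..<m k}", symmetric])
  qed
  then show False by simp
qed

end

text \<open>For each of the countably many \<open>w\<close> one truth value occurs infinitely often,
  so passing to a further subsequence makes \<open>Q\<close> constant at \<open>w\<close>; the
  diagonal sequence does this for all \<open>w\<close>.\<close>

lemma bool_diagonal_subsequence:
  fixes Q :: "nat \<Rightarrow> 'b :: countable \<Rightarrow> bool"
  obtains r where "strict_mono r"
    "\<And>w. (\<forall>\<^sub>F k in sequentially. Q (r k) w) \<or> (\<forall>\<^sub>F k in sequentially. \<not> Q (r k) w)"
proof -
  define P where "P n s \<longleftrightarrow> (\<forall>k. Q (s k) (from_nat n)) \<or> (\<forall>k. \<not> Q (s k) (from_nat n))" for n and s :: "nat \<Rightarrow> nat"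
  interpret subseqs P
  proof
    fix n and s :: "nat \<Rightarrow> nat"
    let ?A = "{k. Q (s k) (from_nat n)}"
    have "infinite ?A \<or> infinite (- ?A)" by (metis finite_compl infinite_UNIV_nat)
    then show "\<exists>r'. strict_mono r' \<and> P n (s \<circ> r')"
    proof
      assume "infinite ?A"
      then show ?thesis
        using enumerate_in_set[of ?A] strict_mono_enumerate[of ?A] by (auto simp: P_def)
    next
      assume "infinite (- ?A)"
      then show ?thesis
        using enumerate_in_set[of "- ?A"] strict_mono_enumerate[of "- ?A"] by (auto simp: P_def)
    qed
  qed
  show ?thesis
  proof (rule that)
    show "strict_mono diagseq" by (rule subseq_diagseq)
    fix w :: 'b
    \<comment> \<open>The diagonal sequence lies in the subsequence chosen for \<open>w\<close> only
      after its initial terms, hence the shift.\<close>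
    have "P (to_nat w) (diagseq \<circ> (+) (Suc (to_nat w)))"
      by (rule diagseq_holds) (auto simp: P_def)
    then have "(\<forall>\<^sub>F k in sequentially. Q (diagseq (k + Suc (to_nat w))) w) \<or>
        (\<forall>\<^sub>F k in sequentially. \<not> Q (diagseq (k + Suc (to_nat w))) w)"
      unfolding P_def comp_def from_nat_to_nat add.commute[of _ "Suc (to_nat w)"]
      by (auto intro: always_eventually)
    then show "(\<forall>\<^sub>F k in sequentially. Q (diagseq k) w) \<or> (\<forall>\<^sub>F k in sequentially. \<not> Q (diagseq k) w)"
      by (simp only: eventually_sequentially_seg[where P = "\<lambda>k. Q (diagseq k) w"]
          eventually_sequentially_seg[where P = "\<lambda>k. \<not> Q (diagseq k) w"])
  qed
qed

section \<open>Order, commutative transitivity and CSA in the limit\<close>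

context limit_of_free_groups
begin

lemma ex_positive_cone: "\<exists>P. positive_cone G P"
proof -
  have "\<forall>k. \<exists>P. positive_cone (F' k) P"
    using ex_positive_cone_free_group by blast
  from choice[OF this] obtain P where P: "\<And>k. positive_cone (F' k) (P k)" by blast
  obtain r where r: "strict_mono r"
    "\<And>w. (\<forall>\<^sub>F k in sequentially. P (r k) (eval_approx (r k) w)) \<or>
      (\<forall>\<^sub>F k in sequentially. \<not> P (r k) (eval_approx (r k) w))"
    using bool_diagonal_subsequence[of "\<lambda>k w. P k (eval_approx k w)"] by blast
  define pos where "pos w \<longleftrightarrow> (\<forall>\<^sub>F k in sequentially. P (r k) (eval_approx (r k) w))" for w
  define Q where "Q x \<longleftrightarrow> (\<exists>w\<in>carrier F. eval w = x \<and> pos w)" for x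
  \<comment> \<open>Positivity does not depend on the word chosen, as two words with the same value
    in \<open>G\<close> eventually have the same image in the approximating groups.\<close>
  have Q: "Q (eval w) \<longleftrightarrow> pos w" if w: "w \<in> carrier F" for w
  proof
    assume "Q (eval w)"
    then obtain u where u: "u \<in> carrier F" "eval u = eval w" "pos u" by (auto simp: Q_def)
    show "pos w"
      using u(3) eventually_subseq[OF r(1) eventually_eq[OF u(1) w]] unfolding pos_def
      by eventually_elim (use u(2) in simp)
  qed (use w in \<open>auto simp: Q_def\<close>)
  have "positive_cone G Q"
    unfolding positive_cone_def
  proof (intro conjI ballI impI)
    fix x y assume xy: "x \<in> carrier G" "y \<in> carrier G" "Q x" "Q y"
    obtain u where u: "u \<in> carrier F" "eval u = x" using xy(1) by (rule obtain_word)
    obtain v where v: "v \<in> carrier F" "eval v = y" using xy(2) by (rule obtain_word)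
    have "pos u" "pos v" using xy(3,4) Q u v by auto
    then have "pos (u \<otimes>\<^bsub>F\<^esub> v)"
      unfolding pos_def
    proof eventually_elim
      case (elim k)
      then show ?case
        using P[of "r k"] u v eval_approx.hom_closed[of _ "r k"] by (simp add: positive_cone_def)
    qed
    then show "Q (x \<otimes> y)" using Q[OF F.m_closed[OF u(1) v(1)]] u v by simp
  next
    fix x g assume xg: "x \<in> carrier G" "g \<in> carrier G" "Q x"
    obtain u where u: "u \<in> carrier F" "eval u = x" using xg(1) by (rule obtain_word)
    obtain v where v: "v \<in> carrier F" "eval v = g" using xg(2) by (rule obtain_word)
    have "pos u" using xg(3) Q u by auto
    then have "pos (v \<otimes>\<^bsub>F\<^esub> u \<otimes>\<^bsub>F\<^esub> inv\<^bsub>F\<^esub> v)"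
      unfolding pos_def
    proof eventually_elim
      case (elim k)
      then show ?case
        using P[of "r k"] u v eval_approx.hom_closed[of _ "r k"] by (simp add: positive_cone_def)
    qed
    moreover have "v \<otimes>\<^bsub>F\<^esub> u \<otimes>\<^bsub>F\<^esub> inv\<^bsub>F\<^esub> v \<in> carrier F" using u v by simp
    ultimately show "Q (g \<otimes> x \<otimes> inv g)" using Q u v by fastforce
  next
    fix x assume x: "x \<in> carrier G"
    then obtain u where u: "u \<in> carrier F" "eval u = x" by (rule obtain_word)
    have Qx: "Q x \<longleftrightarrow> pos u" and Qi: "Q (inv x) \<longleftrightarrow> pos (inv\<^bsub>F\<^esub> u)"
      using Q[OF u(1)] Q[OF F.inv_closed[OF u(1)]] u by simp_all
    show "\<not> Q (inv x)" if "Q x"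
    proof
      assume "Q (inv x)"
      then have "pos u" "pos (inv\<^bsub>F\<^esub> u)" using that Qx Qi by auto
      then have "\<forall>\<^sub>F k in sequentially. False"
        unfolding pos_def
      proof eventually_elim
        case (elim k)
        then show False
          using P[of "r k"] u eval_approx.hom_closed[of _ "r k"] by (simp add: positive_cone_def)
      qed
      then show False by simp
    qed
    show "Q x \<or> Q (inv x) \<or> x = \<one>"
    proof (rule ccontr)
      assume neg: "\<not> (Q x \<or> Q (inv x) \<or> x = \<one>)"
      \<comment> \<open>Here the subsequence matters: along it, a word that is not eventually
        positive is eventually not positive.\<close>
      then have "\<forall>\<^sub>F k in sequentially. \<not> P (r k) (eval_approx (r k) u)"
        using r(2)[of u] Qx by (auto simp: pos_def)
      then have "pos (inv\<^bsub>F\<^esub> u)"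
        using eventually_subseq[OF r(1) eventually_eq[OF u(1) F.one_closed]] unfolding pos_def
      proof eventually_elim
        case (elim k)
        then show ?case
          using P[of "r k"] u neg eval_approx.hom_closed[of _ "r k"] by (auto simp: positive_cone_def)
      qed
      then show False using neg Qi by simp
    qed
  qed
  then show ?thesis by blast
qed

lemma commutative_transitive: "commutative_transitive G"
  unfolding commutative_transitive_def
  using commute_trans by (auto simp: commutator_eq_one_iff)

text \<open>If \<open>x = g y g^-1\<close> with \<open>x\<close> and \<open>y\<close> non-trivial in
  \<open>H\<close>, then \<open>x\<close> and \<open>y\<close> commute, so \<open>g\<close> commutes
  with \<open>y\<close>. The centraliser of \<open>y\<close> is abelian by commutative transitivity
  and contains \<open>H\<close>; by maximality it is \<open>H\<close>, and \<open>g\<close> lies in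
  it.\<close>

lemma CSA: "CSA G"
  unfolding CSA_def malnormal_def
proof (intro allI impI ballI)
  fix H g assume H: "maximal_abelian_subgroup H G" and g: "g \<in> carrier G - H"
  interpret H: subgroup H G using H by (simp add: maximal_abelian_subgroup_def abelian_subgroup_def)
  interpret A: comm_group "G\<lparr>carrier := H\<rparr>"
    using H by (simp add: maximal_abelian_subgroup_def abelian_subgroup_def)
  have comm: "x \<otimes> y = y \<otimes> x" if "x \<in> H" "y \<in> H" for x y
    using A.m_comm that by simp
  have "x = \<one>" if x: "x \<in> H" and xg: "x \<in> (g <#\<^bsub>G\<^esub> H) #> inv g" for x
  proof (rule ccontr)
    assume "x \<noteq> \<one>"
    obtain y where y: "y \<in> H" "x = g \<otimes> y \<otimes> inv g"
      using xg by (auto simp: l_coset_def r_coset_def)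
    then have "y \<noteq> \<one>" using \<open>x \<noteq> \<one>\<close> g by auto
    have gy: "g \<otimes> y = y \<otimes> g"
    proof (rule commute_conjugate)
      show "y \<otimes> (g \<otimes> y \<otimes> inv g) = (g \<otimes> y \<otimes> inv g) \<otimes> y"
        using comm[OF y(1) x] unfolding y(2) .
    qed (use y g in auto)
    define C where "C = {z \<in> carrier G. y \<otimes> z = z \<otimes> y}"
    have "subgroup C G"
    proof (rule subgroupI)
      fix z assume z: "z \<in> C"
      then show "inv z \<in> C"
        using y(1) unfolding C_def
        by auto (metis H.mem_carrier inv_closed inv_solve_left inv_solve_right m_assoc m_closed)
    next
      fix z z' assume "z \<in> C" "z' \<in> C"
      then show "z \<otimes> z' \<in> C"
        using y(1) unfolding C_def by auto (metis H.mem_carrier m_assoc)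
    qed (use y(1) in \<open>auto simp: C_def\<close>)
    moreover have "comm_group (G\<lparr>carrier := C\<rparr>)"
    proof (rule group.group_comm_groupI)
      show "group (G\<lparr>carrier := C\<rparr>)"
        using \<open>subgroup C G\<close> group_axioms by (rule subgroup.subgroup_is_group)
      fix z z' assume "z \<in> carrier (G\<lparr>carrier := C\<rparr>)" "z' \<in> carrier (G\<lparr>carrier := C\<rparr>)"
      then show "z \<otimes>\<^bsub>G\<lparr>carrier := C\<rparr>\<^esub> z' = z' \<otimes>\<^bsub>G\<lparr>carrier := C\<rparr>\<^esub> z"
        using commute_trans[of z y z'] y(1) \<open>y \<noteq> \<one>\<close> by (simp add: C_def)
    qed
    moreover have "H \<subseteq> C" using comm[OF y(1)] by (auto simp: C_def)
    ultimately have "C = H"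
      using H by (simp add: maximal_abelian_subgroup_def abelian_subgroup_def)
    moreover have "g \<in> C"
      unfolding C_def using g gy[symmetric] by blast
    ultimately show False using g by blast
  qed
  moreover have "\<one> \<in> (g <#\<^bsub>G\<^esub> H) #> inv g"
    using g H.one_closed by (auto simp: l_coset_def r_coset_def intro!: bexI[of _ \<one>])
  ultimately show "H \<inter> ((g <#\<^bsub>G\<^esub> H) #> inv g) = {\<one>}" by auto
qed

end

text \<open>Words for the generators of \<open>H\<close> are evaluated in the approximating groups.
  The subgroups \<open>L k\<close> which they generate there are free, with ranks
  \<open>m' k\<close> that may vary, and the isomorphisms \<open>f k\<close> leave the kernels of
  the markings unchanged.\<close>

lemma (in limit_of_free_groups) limit_group_subgroup:
  assumes H: "subgroup H G" and fg: "finitely_generated (G\<lparr>carrier := H\<rparr>)"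
  shows "limit_group (G\<lparr>carrier := H\<rparr>)"
proof -
  let ?H = "G\<lparr>carrier := H\<rparr>"
  interpret H: group ?H using H group_axioms by (rule subgroup.subgroup_is_group)
  obtain A where A: "finite A" "A \<subseteq> H" "generate ?H A = H"
    using fg by (auto simp: finitely_generated_def)
  obtain S' where S': "set S' = A" using finite_list[OF A(1)] by blast
  let ?p = "length S'"
  let ?P = "free_group {..<?p}"
  interpret P: group ?P by (rule group_free_group)
  have S'_closed: "(!) S' ` {..<?p} \<subseteq> H" using S' A(2) nth_mem by blast
  have "\<forall>i. \<exists>w. i < ?p \<longrightarrow> w \<in> carrier F \<and> eval w = S' ! i"
    using S'_closed subgroup.mem_carrier[OF H] obtain_word by (metis image_subset_iff lessThan_iff)
  from choice[OF this] obtain u where u: "\<And>i. i < ?p \<Longrightarrow> u i \<in> carrier F \<and> eval (u i) = S' ! i"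
    by blast
  have u_closed: "u ` {..<?p} \<subseteq> carrier F" using u by blast
  define s where "s k i = eval_approx k (u i)" for k i
  have s_closed: "s k ` {..<?p} \<subseteq> carrier (F' k)" for k
    using u_closed by (auto simp: s_def)
  define L where "L k = (F' k)\<lparr>carrier := generate (F' k) (s k ` {..<?p})\<rparr>" for k
  have L_sub: "subgroup (carrier (L k)) (F' k)" for k
    unfolding L_def using F'.generate_is_subgroup[OF s_closed] by simp
  have L_group: "group (L k)" for k
    using subgroup.subgroup_is_group[OF L_sub F'.group_axioms] by (simp add: L_def)
  have s_L: "s k ` {..<?p} \<subseteq> carrier (L k)" for k
    by (auto simp: L_def intro: generate.incl)
  have "\<exists>(n :: nat) g. g \<in> iso (L k) (free_group {..<n})" for k
    using finitely_generated_subgroup_free[OF _ s_closed, of k] unfolding L_def is_iso_def by blast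
  then obtain m' :: "nat \<Rightarrow> nat" and f where f: "\<And>k. f k \<in> iso (L k) (free_group {..<m' k})"
    by metis
  define T' where "T' k = map (\<lambda>i. f k (s k i)) [0..<?p]" for k
  have "limit_of_free_groups ?H S' m' T'"
  proof (intro limit_of_free_groups.intro limit_of_free_groups_axioms.intro H.group_axioms)
    show "marking ?H S'"
      using A S' by (simp add: marking_def)
    show "length (T' k) = ?p" for k by (simp add: T'_def)
    show "marking (free_group {..<m' k}) (T' k)" for k
    proof -
      have "generate (L k) (s k ` {..<?p}) = carrier (L k)"
        using F'.generate_consistent[OF s_L L_sub] by (simp add: L_def)
      from group.finitely_generated_iso[OF L_group _ s_L this f group_free_group]
      show ?thesis by (simp add: T'_def marking_def image_image atLeast0LessThan)
    qed
    fix w assume w: "w \<in> carrier ?P"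
    note letters = free_group_letters[OF w]
    \<comment> \<open>\<open>?v\<close> substitutes the words \<open>u i\<close> into
      \<open>w\<close>: convergence for \<open>H\<close> at \<open>w\<close> is convergence for
      \<open>G\<close> at \<open>?v\<close>.\<close>
    let ?v = "word_eval F u w"
    have v: "?v \<in> carrier F" using u_closed letters by (rule F.word_eval_closed)
    have eval_v: "eval ?v = word_eval ?H ((!) S') w"
    proof -
      have "eval ?v = word_eval G (\<lambda>i. eval (u i)) w"
        by (rule hom_word_eval[OF F.group_axioms group_axioms eval.homh u_closed letters])
      also have "\<dots> = word_eval G ((!) S') w"
        by (rule word_eval_cong) (use u letters in blast)
      also have "\<dots> = word_eval ?H ((!) S') w"
        by (rule word_eval_subgroup[OF H S'_closed letters, symmetric])
      finally show ?thesis .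
    qed
    have approx_v: "word_eval (free_group {..<m' k}) ((!) (T' k)) w = [] \<longleftrightarrow> eval_approx k ?v = []" for k
    proof -
      have hom: "f k \<in> hom (L k) (free_group {..<m' k})" and inj: "inj_on (f k) (carrier (L k))"
        using f[of k] by (auto simp: iso_def bij_betw_def)
      have "word_eval (free_group {..<m' k}) ((!) (T' k)) w =
          word_eval (free_group {..<m' k}) (\<lambda>i. f k (s k i)) w"
        by (rule word_eval_cong) (use letters in \<open>auto simp: T'_def\<close>)
      also have "\<dots> = f k (word_eval (L k) (s k) w)"
        by (rule hom_word_eval[OF L_group group_free_group hom s_L letters, symmetric])
      finally have 1: "word_eval (free_group {..<m' k}) ((!) (T' k)) w = f k (word_eval (L k) (s k) w)" .
      have "word_eval (L k) (s k) w = word_eval (F' k) (s k) w"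
        using F'.word_eval_subgroup[OF L_sub s_L letters] by (simp add: L_def)
      also have "\<dots> = eval_approx k ?v"
        unfolding s_def
        by (rule hom_word_eval[OF F.group_axioms F'.group_axioms eval_approx.homh u_closed letters, symmetric])
      finally have 2: "word_eval (L k) (s k) w = eval_approx k ?v" .
      have "word_eval (L k) (s k) w \<in> carrier (L k)"
        using group.word_eval_closed[OF L_group s_L letters] .
      moreover have "f k [] = []" "[] \<in> carrier (L k)"
        using hom_one[OF hom L_group group_free_group] monoid.one_closed[OF group.is_monoid[OF L_group]]
        by (simp_all add: L_def one_free_group)
      ultimately show ?thesis
        unfolding 1 2 using inj by (metis inj_onD)
    qed
    show "\<forall>\<^sub>F k in sequentially. word_eval (free_group {..<m' k}) ((!) (T' k)) w = [] \<longleftrightarrow>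
        word_eval ?H ((!) S') w = \<one>\<^bsub>?H\<^esub>"
      using eventually_eq[OF v F.one_closed]
    proof eventually_elim
      case (elim k)
      then show ?case
        unfolding approx_v eval_v[symmetric]
        by (simp add: one_free_group[of "{..<m k}", symmetric])
    qed
  qed
  then show ?thesis by (auto simp: limit_group_iff)
qed


section \<open>Commuting pairs in torsion-free groups\<close>

text \<open>Ranks 0, 1 and 2 are treated together: the generators beyond the first \<open>r\<close>
  are trivial, and the first \<open>r\<close> satisfy no relation.\<close>

lemma (in comm_group) free_Abelian_group_iso:
  fixes r :: nat
  assumes ab: "a \<in> carrier G" "b \<in> carrier G" "generate G {a, b} = carrier G" and "r \<le> 2"
    and a: "r = 0 \<Longrightarrow> a = \<one>" and b: "r \<le> 1 \<Longrightarrow> b = \<one>"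
    and ker: "\<And>(p::int) (q::int). a [^] p \<otimes> b [^] q = \<one> \<Longrightarrow> (0 < r \<longrightarrow> p = 0) \<and> (1 < r \<longrightarrow> q = 0)"
  shows "G \<cong> free_Abelian_group {..<r}"
proof -
  let ?A = "free_Abelian_group {..<r}"
  define h where "h c = a [^] Poly_Mapping.lookup c 0 \<otimes> b [^] Poly_Mapping.lookup c 1" for c :: "nat \<Rightarrow>\<^sub>0 int"
  interpret h: group_hom ?A G h
    using ab by (intro group_hom.intro group_hom_axioms.intro homI)
      (auto simp: h_def lookup_add int_pow_mult m_ac)
  have "inj_on h (carrier ?A)"
  proof (rule h.inj_iff_trivial_ker[THEN iffD2])
    show "kernel ?A G h = {\<one>\<^bsub>?A\<^esub>}"
    proof (intro equalityI subsetI)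
      fix c assume "c \<in> kernel ?A G h"
      then have keys: "Poly_Mapping.keys c \<subseteq> {..<r}" and hc: "h c = \<one>" by (auto simp: kernel_def)
      have "Poly_Mapping.lookup c i = 0" for i
      proof (cases "i < r")
        case True
        then have "i = 0 \<or> i = 1" using \<open>r \<le> 2\<close> by auto
        then show ?thesis using ker[OF hc[unfolded h_def]] True by auto
      next
        case False
        then show ?thesis using keys by (auto simp: in_keys_iff)
      qed
      then have "c = 0" by (intro poly_mapping_eqI) simp
      then show "c \<in> {\<one>\<^bsub>?A\<^esub>}" by simp
    qed (use h.one_closed in \<open>auto simp: kernel_def h_def\<close>)
  qed
  moreover have "h ` carrier ?A = carrier G"
  proof
    have one: "\<one> \<in> h ` carrier ?A" by (intro image_eqI[of _ _ 0]) (simp_all add: h_def)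
    have "subgroup (h ` carrier ?A) G" by (rule h.img_is_subgroup)
    moreover have "a \<in> h ` carrier ?A"
    proof (cases "r = 0")
      case True
      then show ?thesis using a one by simp
    next
      case False
      then show ?thesis using ab by (intro image_eqI[of _ _ "frag_of 0"]) (auto simp: h_def lookup_one)
    qed
    moreover have "b \<in> h ` carrier ?A"
    proof (cases "r \<le> 1")
      case True
      then show ?thesis using b one by simp
    next
      case False
      then show ?thesis using ab by (intro image_eqI[of _ _ "frag_of 1"]) (auto simp: h_def)
    qed
    ultimately show "carrier G \<subseteq> h ` carrier ?A"
      using generate_subgroup_incl[of "{a, b}"] ab(3) by blast
  qed auto
  ultimately have "?A \<cong> G"
    using h.homh by (auto simp: is_iso_def iso_def bij_betw_def)
  then show ?thesis by (rule group.iso_sym[OF group_free_Abelian_group])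
qed

lemma (in group) torsion_free_int_pow:
  assumes "torsion_free G" "x \<in> carrier G" "x [^] (n::int) = \<one>"
  shows "x = \<one> \<or> n = 0"
proof (rule ccontr)
  assume neg: "\<not> (x = \<one> \<or> n = 0)"
  obtain k :: nat where k: "0 < k" "n = int k \<or> n = - int k"
    using neg int_cases2[of n] by (metis of_nat_0 neg_0_equal_iff_equal not_gr0)
  then have "x [^] k = \<one>"
    using assms(2,3) by (metis int_pow_int int_pow_neg_int inv_eq_1_iff nat_pow_closed)
  then show False using neg k(1) assms(1,2) unfolding torsion_free_def by blast
qed

text \<open>Without torsion, the exponents of a relation may be divided by their gcd. A change of
  generators over the integers then makes the coprime relation one of the generators, leaving a
  cyclic group.\<close>

lemma (in comm_group) torsion_free_two_generated:
  assumes tf: "torsion_free G" and ab: "a \<in> carrier G" "b \<in> carrier G" "generate G {a, b} = carrier G"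
  shows "\<exists>r\<le>2::nat. G \<cong> free_Abelian_group {..<r}"
proof (cases "\<forall>(p::int) (q::int). a [^] p \<otimes> b [^] q = \<one> \<longrightarrow> p = 0 \<and> q = 0")
  case True
  then have "G \<cong> free_Abelian_group {..<2::nat}"
    by (intro free_Abelian_group_iso[OF ab]) auto
  then show ?thesis by blast
next
  case False
  then obtain p q :: int where pq: "a [^] p \<otimes> b [^] q = \<one>" "p \<noteq> 0 \<or> q \<noteq> 0" by blast
  define d where "d = gcd p q"
  have "d \<noteq> 0" using pq(2) by (simp add: d_def)
  obtain p' q' where p': "p = p' * d" and q': "q = q' * d"
    unfolding d_def by (metis dvd_div_mult_self gcd_dvd1 gcd_dvd2)
  obtain u v where "u * p + v * q = d" unfolding d_def using bezout_int by blast
  then have "(u * p' + v * q') * d = 1 * d" by (simp add: p' q' algebra_simps)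
  then have uv: "u * p' + v * q' = 1" using \<open>d \<noteq> 0\<close> by (metis mult_right_cancel)
  have "(a [^] p' \<otimes> b [^] q') [^] d = \<one>"
    using pq(1) ab by (simp add: p' q' int_pow_distrib int_pow_pow)
  then have rel: "a [^] p' \<otimes> b [^] q' = \<one>"
    using torsion_free_int_pow[OF tf] ab \<open>d \<noteq> 0\<close> by blast
  \<comment> \<open>The row \<open>(v, - u)\<close> completes \<open>(p', q')\<close> to an integer
    matrix of determinant \<open>-1\<close>. The other new generator is trivial by
    \<open>rel\<close>, so \<open>a\<close> and \<open>b\<close> are powers of
    \<open>c\<close>.\<close>
  define c where "c = a [^] v \<otimes> b [^] (- u)"
  have c: "c \<in> carrier G" using ab by (simp add: c_def)
  have pow: "a [^] (p' * k) \<otimes> b [^] (q' * k) = \<one>" for k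
    using rel ab by (simp add: int_pow_pow[symmetric] int_pow_distrib[symmetric])
  have add: "(a [^] i \<otimes> b [^] j) \<otimes> (a [^] k \<otimes> b [^] l) = a [^] (i + k) \<otimes> b [^] (j + l)"
    for i j k l :: int
    using ab by (simp add: int_pow_mult m_ac)
  have cpow: "c [^] i = a [^] (v * i + p' * k) \<otimes> b [^] (- u * i + q' * k)" for i k
  proof -
    have "c [^] i = a [^] (v * i) \<otimes> b [^] (- u * i)"
      using ab by (simp only: c_def int_pow_distrib int_pow_pow int_pow_closed)
    then show ?thesis
      using add[of "v * i" "- u * i" "p' * k" "q' * k"] pow[of k] ab by simp
  qed
  have ca: "c [^] q' = a"
    using cpow[of q' u] uv ab by (simp add: algebra_simps)
  have cb: "c [^] (- p') = b"
    using cpow[of "- p'" v] uv ab by (simp add: algebra_simps)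
  \<comment> \<open>\<open>\<one>\<close> takes the place of the second generator in
    \<open>free_Abelian_group_iso\<close>.\<close>
  have sub: "subgroup (generate G {c, \<one>}) G" using c by (intro generate_is_subgroup) auto
  have "c \<in> generate G {c, \<one>}" by (auto intro: generate.incl)
  then have "{a, b} \<subseteq> generate G {c, \<one>}"
    using subgroup_int_pow_closed[OF sub] ca cb by (metis empty_subsetI insert_subset)
  then have "carrier G \<subseteq> generate G {c, \<one>}"
    using generate_subgroup_incl[OF _ sub] ab(3) by blast
  then have gen: "generate G {c, \<one>} = carrier G"
    using generate_incl[of "{c, \<one>}"] c by blast
  show ?thesis
  proof (cases "c = \<one>")
    case True
    then have "G \<cong> free_Abelian_group {..<0::nat}"
      using gen by (intro free_Abelian_group_iso[OF c one_closed]) auto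
    then show ?thesis by blast
  next
    case False
    then have "G \<cong> free_Abelian_group {..<1::nat}"
      using gen c torsion_free_int_pow[OF tf c]
      by (intro free_Abelian_group_iso[OF c one_closed]) auto
    then show ?thesis by (metis one_le_numeral)
  qed
qed

lemma (in group) commuting_pair_free_abelian:
  assumes tf: "torsion_free G" and ab: "a \<in> carrier G" "b \<in> carrier G" "a \<otimes> b = b \<otimes> a"
  shows "\<exists>r\<le>2::nat. G\<lparr>carrier := generate G {a, b}\<rparr> \<cong> free_Abelian_group {..<r}"
proof -
  let ?H = "G\<lparr>carrier := generate G {a, b}\<rparr>"
  have sub: "subgroup (generate G {a, b}) G" using ab by (intro generate_is_subgroup) auto
  have com: "x \<otimes> y = y \<otimes> x" if "x \<in> generate G {a, b}" "y \<in> generate G {a, b}" for x y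
    by (rule generate_commuting[OF _ _ that]) (use ab(1,2) ab(3)[symmetric] ab(3) in \<open>blast+\<close>)
  interpret H: group ?H using sub group_axioms by (rule subgroup.subgroup_is_group)
  interpret H: comm_group ?H
    by (rule H.group_comm_groupI) (use com in simp)
  have "x [^]\<^bsub>?H\<^esub> n = x [^] n" for x and n :: nat
    by (induction n) auto
  then have "torsion_free ?H"
    using tf subgroup.mem_carrier[OF sub] by (auto simp: torsion_free_def)
  moreover have "a \<in> carrier ?H" "b \<in> carrier ?H" by (auto intro: generate.incl)
  moreover have "generate ?H {a, b} = carrier ?H"
    using generate_consistent[OF _ sub, of "{a, b}"] by (auto intro: generate.incl)
  ultimately show ?thesis by (rule H.torsion_free_two_generated)
qed


section \<open>Lower bounds for the first Betti number\<close>

text \<open>\<open>\<psi> n\<close> kills the preceding vectors and hence their span, but not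
  \<open>v n\<close>. So duality up to non-zero scalars yields independence.\<close>

lemma (in vectorspace) le_dim_functionals:
  fixes v :: "nat \<Rightarrow> 'c" and \<psi> :: "nat \<Rightarrow> 'c \<Rightarrow> 'a"
  assumes "fin_dim" and v: "\<And>j. j < m \<Longrightarrow> v j \<in> carrier V"
    and add: "\<And>i x y. i < m \<Longrightarrow> x \<in> carrier V \<Longrightarrow> y \<in> carrier V \<Longrightarrow> \<psi> i (x \<oplus>\<^bsub>V\<^esub> y) = \<psi> i x \<oplus>\<^bsub>K\<^esub> \<psi> i y"
    and smult: "\<And>i c x. i < m \<Longrightarrow> c \<in> carrier K \<Longrightarrow> x \<in> carrier V \<Longrightarrow> \<psi> i (c \<odot>\<^bsub>V\<^esub> x) = c \<otimes>\<^bsub>K\<^esub> \<psi> i x"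
    and closed: "\<And>i x. i < m \<Longrightarrow> x \<in> carrier V \<Longrightarrow> \<psi> i x \<in> carrier K"
    and dual: "\<And>i j. i < m \<Longrightarrow> j < m \<Longrightarrow> \<psi> i (v j) = \<zero>\<^bsub>K\<^esub> \<longleftrightarrow> i \<noteq> j"
  shows "m \<le> dim"
proof -
  have inj: "inj_on v {..<m}"
  proof (rule inj_onI)
    fix i j assume ij: "i \<in> {..<m}" "j \<in> {..<m}" "v i = v j"
    then show "i = j" using dual[of i i] dual[of i j] by auto
  qed
  have "lin_indpt (v ` {..<n})" if "n \<le> m" for n
    using that
  proof (induction n)
    case 0
    then show ?case by (simp add: lin_dep_def)
  next
    case (Suc n)
    let ?ker = "{x \<in> carrier V. \<psi> n x = \<zero>\<^bsub>K\<^esub>}"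
    have n: "n < m" using Suc.prems by simp
    have sub: "v ` {..<n} \<subseteq> carrier V" using v Suc.prems by auto
    have "\<psi> n \<zero>\<^bsub>V\<^esub> = \<zero>\<^bsub>K\<^esub>"
      using smult[OF n, of "\<zero>\<^bsub>K\<^esub>" "\<zero>\<^bsub>V\<^esub>"] closed[OF n, of "\<zero>\<^bsub>V\<^esub>"] by simp
    then have "LinearCombinations.submodule K ?ker V"
      by unfold_locales (use add[OF n] smult[OF n] in auto)
    moreover have "v ` {..<n} \<subseteq> ?ker" using sub dual[OF n] n by auto
    ultimately have "span (v ` {..<n}) \<subseteq> ?ker" by (intro span_is_subset)
    moreover have "v n \<notin> ?ker" using dual[OF n n] by simp
    ultimately have "v n \<notin> span (v ` {..<n})" by blast
    moreover have "v n \<notin> v ` {..<n}" using n by (subst inj_on_image_mem_iff[OF inj]) auto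
    ultimately show ?case
      using lin_dep_iff_in_span[OF sub Suc.IH v[OF n]] Suc.prems
      by (simp add: lessThan_Suc)
  qed
  then have "card (v ` {..<m}) \<le> dim"
    using v by (intro li_le_dim(2)[OF assms(1)]) auto
  then show ?thesis using inj by (simp add: card_image)
qed

section \<open>The tensor product with the rationals\<close>

locale rational_tensor = group A for A :: "('a, 'm) monoid_scheme" (structure)
begin

sublocale S: comm_group "tensor_symbols A" by (rule comm_group_tensor_symbols)
sublocale R: subgroup "tensor_relations A" "tensor_symbols A"
  using group_axioms by (rule subgroup_tensor_relations)
sublocale N: normal "tensor_relations A" "tensor_symbols A"
  using R.subgroup_axioms by (rule S.normal_iff_subgroup[THEN iffD2])

definition tensor_class :: "('a \<times> rat \<Rightarrow>\<^sub>0 int) \<Rightarrow> ('a \<times> rat \<Rightarrow>\<^sub>0 int) set" where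
  "tensor_class c = tensor_relations A #>\<^bsub>tensor_symbols A\<^esub> c"

lemma carrier_rat_tensor: "carrier (rat_tensor A) = tensor_class ` carrier (tensor_symbols A)"
  by (auto simp: rat_tensor_def Let_def FactGroup_def RCOSETS_def tensor_class_def)

lemma add_tensor_class:
  assumes "c \<in> carrier (tensor_symbols A)" "d \<in> carrier (tensor_symbols A)"
  shows "tensor_class c \<oplus>\<^bsub>rat_tensor A\<^esub> tensor_class d = tensor_class (c + d)"
  using N.rcos_sum[OF assms] by (simp add: rat_tensor_def Let_def tensor_class_def)

lemma zero_rat_tensor: "\<zero>\<^bsub>rat_tensor A\<^esub> = tensor_class 0"
  using S.coset_mult_one[OF R.subset] by (simp add: rat_tensor_def Let_def tensor_class_def)

lemma tensor_class_eqI: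
  assumes "d \<in> carrier (tensor_symbols A)" "c - d \<in> tensor_relations A"
  shows "tensor_class c = tensor_class d"
proof -
  have "c = (c - d) \<otimes>\<^bsub>tensor_symbols A\<^esub> d" by simp
  then have "c \<in> tensor_class d"
    using assms(2) unfolding tensor_class_def r_coset_def by blast
  then show ?thesis
    using S.repr_independence assms(1) R.subgroup_axioms unfolding tensor_class_def by blast
qed

lemma smult_tensor_class:
  "p \<odot>\<^bsub>rat_tensor A\<^esub> tensor_class c = tensor_class (scale_symbols p c)"
proof -
  have "tensor_relations A <#>\<^bsub>tensor_symbols A\<^esub> (scale_symbols p ` tensor_class c) =
      tensor_class (scale_symbols p c)"
  proof (intro equalityI subsetI)
    fix x assume "x \<in> tensor_relations A <#>\<^bsub>tensor_symbols A\<^esub> (scale_symbols p ` tensor_class c)"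
    then obtain r r' where r: "r \<in> tensor_relations A" "r' \<in> tensor_relations A"
        "x = r + scale_symbols p (r' + c)"
      by (auto simp: set_mult_def tensor_class_def r_coset_def)
    then have "x = (r \<otimes>\<^bsub>tensor_symbols A\<^esub> scale_symbols p r') \<otimes>\<^bsub>tensor_symbols A\<^esub> scale_symbols p c"
      by (simp add: add.assoc)
    moreover have "r \<otimes>\<^bsub>tensor_symbols A\<^esub> scale_symbols p r' \<in> tensor_relations A"
      using r(1) scale_tensor_relations[OF group_axioms r(2)] by (rule R.m_closed)
    ultimately show "x \<in> tensor_class (scale_symbols p c)"
      unfolding tensor_class_def r_coset_def by blast
  next
    fix x assume "x \<in> tensor_class (scale_symbols p c)"
    moreover have "c \<in> tensor_class c"
      using R.one_closed by (auto simp: tensor_class_def r_coset_def)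
    ultimately show "x \<in> tensor_relations A <#>\<^bsub>tensor_symbols A\<^esub> (scale_symbols p ` tensor_class c)"
      unfolding set_mult_def tensor_class_def[of "scale_symbols p c"] r_coset_def by blast
  qed
  then show ?thesis by (simp add: rat_tensor_def Let_def)
qed

lemma tensor_class_frag_mult:
  assumes "a \<in> carrier A" "b \<in> carrier A"
  shows "tensor_class (frag_of (a \<otimes> b, q)) =
    tensor_class (frag_of (a, q)) \<oplus>\<^bsub>rat_tensor A\<^esub> tensor_class (frag_of (b, q))"
proof -
  have c: "frag_of (a, q) \<in> carrier (tensor_symbols A)" "frag_of (b, q) \<in> carrier (tensor_symbols A)"
    using assms by auto
  have "frag_of (a \<otimes> b, q) - frag_of (a, q) - frag_of (b, q) \<in> tensor_relations A"
    unfolding tensor_relations_def by (intro generate.incl bilinear_relatorsI1 assms)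
  then show ?thesis
    unfolding add_tensor_class[OF c] using S.m_closed[OF c]
    by (intro tensor_class_eqI) (simp_all only: tensor_symbols_simps diff_diff_eq)
qed

text \<open>A lower bound on \<open>vectorspace.dim\<close> presupposes finite dimension. The
  classes of the symbols \<open>(b, 1)\<close> with \<open>b\<close> in \<open>B\<close>
  span.\<close>

lemma fin_dim_rat_tensor:
  assumes B: "finite B" "B \<subseteq> carrier A" "generate A B = carrier A"
  shows "vectorspace.fin_dim (class_ring :: rat ring) (rat_tensor A)"
proof -
  interpret V: vectorspace "class_ring :: rat ring" "rat_tensor A"
    using group_axioms by (rule vectorspace_rat_tensor)
  let ?C = "(\<lambda>b. tensor_class (frag_of (b, 1))) ` B"
  have C: "?C \<subseteq> carrier (rat_tensor A)"
    using B(2) by (auto simp: carrier_rat_tensor)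
  interpret W: LinearCombinations.submodule "class_ring :: rat ring" "V.span ?C" "rat_tensor A"
    by (rule V.span_is_submodule[OF C])
  have smult: "p \<odot>\<^bsub>rat_tensor A\<^esub> x \<in> V.span ?C" if "x \<in> V.span ?C" for p x
    using W.smult_closed[of p x] that by simp
  have one: "tensor_class (frag_of (\<one>, q)) = \<zero>\<^bsub>rat_tensor A\<^esub>" for q
  proof -
    have "tensor_class (frag_of (\<one>, q)) \<in> carrier (rat_tensor A)"
      by (auto simp: carrier_rat_tensor)
    then show ?thesis
      using tensor_class_frag_mult[of \<one> \<one> q] by simp
  qed
  have frag: "tensor_class (frag_of (a, q)) \<in> V.span ?C" if "a \<in> generate A B" for a q
    using that
  proof (induction arbitrary: q)
    case one
    then show ?case by (simp add: \<open>\<And>q. tensor_class (frag_of (\<one>, q)) = _\<close>)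
  next
    case (incl b)
    then have "tensor_class (frag_of (b, 1)) \<in> V.span ?C"
      using V.in_own_span[OF C] by blast
    from smult[OF this, of q] show ?case by (simp add: smult_tensor_class)
  next
    case (inv b)
    then have b: "b \<in> carrier A" "tensor_class (frag_of (b, 1)) \<in> V.span ?C"
      using V.in_own_span[OF C] B(2) by blast+
    let ?x = "tensor_class (frag_of (inv b, q))" and ?y = "tensor_class (frag_of (b, q))"
    have xy: "?x \<in> carrier (rat_tensor A)" "?y \<in> carrier (rat_tensor A)"
      using b(1) by (auto simp: carrier_rat_tensor)
    \<comment> \<open>By bilinearity the two classes add up to that of \<open>(\<one>, q)\<close>,
      which is zero.\<close>
    have "?x \<oplus>\<^bsub>rat_tensor A\<^esub> ?y = \<zero>\<^bsub>rat_tensor A\<^esub>"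
      using tensor_class_frag_mult[of "inv b" b q] b(1) one[of q] by simp
    moreover have "?y \<oplus>\<^bsub>rat_tensor A\<^esub> (- 1 \<odot>\<^bsub>rat_tensor A\<^esub> ?y) = \<zero>\<^bsub>rat_tensor A\<^esub>"
      using V.smult_l_distr[of 1 "- 1" ?y] V.smult_one[OF xy(2)] V.lmult_0[OF xy(2)] xy(2) by simp
    ultimately have "?x = - 1 \<odot>\<^bsub>rat_tensor A\<^esub> ?y"
      using xy by (metis V.smult_closed V.add.inv_comm V.add.inv_unique UNIV_I partial_object.select_convs(1))
    also have "?y = q \<odot>\<^bsub>rat_tensor A\<^esub> tensor_class (frag_of (b, 1))"
      by (simp add: smult_tensor_class)
    finally show ?case using smult b(2) by simp
  next
    case (eng a b)
    then have "a \<in> carrier A" "b \<in> carrier A" using generate_incl[OF B(2)] by auto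
    then show ?case using eng.IH by (simp add: tensor_class_frag_mult)
  qed
  have "tensor_class c \<in> V.span ?C" if "Poly_Mapping.keys c \<subseteq> carrier A \<times> UNIV" for c
    using that
  proof (rule free_Abelian_group_induct)
    show "tensor_class 0 \<in> V.span ?C" using W.zero_closed by (simp add: zero_rat_tensor)
  next
    fix x y :: "'a \<times> rat \<Rightarrow>\<^sub>0 int"
    assume 2: "Poly_Mapping.keys x \<subseteq> carrier A \<times> UNIV" "Poly_Mapping.keys y \<subseteq> carrier A \<times> UNIV"
      "tensor_class x \<in> V.span ?C" "tensor_class y \<in> V.span ?C"
    have "tensor_class (x - y) = tensor_class x \<oplus>\<^bsub>rat_tensor A\<^esub> (- 1 \<odot>\<^bsub>rat_tensor A\<^esub> tensor_class y)"
    proof -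
      have y: "y \<in> carrier (tensor_symbols A)" and x: "x \<in> carrier (tensor_symbols A)"
        using 2(1,2) by simp_all
      note s = scale_symbols_closed[OF y, of "- 1"]
      \<comment> \<open>Formal negation and scaling by \<open>- 1\<close> agree only modulo the
        relations: those for \<open>1 + (- 1)\<close> and for \<open>0 + 0\<close> sum to
        \<open>- y - scale_symbols (- 1) y\<close>.\<close>
      have "x - y - (x + scale_symbols (- 1) y) \<in> tensor_relations A"
        using R.m_closed[OF scale_add_tensor_relations[OF group_axioms y, of 1 "- 1"]
            scale_add_tensor_relations[OF group_axioms y, of 0 0]]
        by (simp add: algebra_simps)
      then show ?thesis
        unfolding smult_tensor_class add_tensor_class[OF x s]
        using S.m_closed[OF x s] by (intro tensor_class_eqI) (simp_all only: tensor_symbols_simps)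
    qed
    then show "tensor_class (x - y) \<in> V.span ?C" using W.m_closed smult 2 by simp
  next
    fix s :: "'a \<times> rat" assume "s \<in> carrier A \<times> UNIV"
    then show "tensor_class (frag_of s) \<in> V.span ?C" using frag B(3) by auto
  qed
  then have "V.gen_set ?C"
    using V.span_is_subset2[OF C] by (auto simp: carrier_rat_tensor)
  then show ?thesis
    using B(1) C unfolding V.fin_dim_def by blast
qed

text \<open>Sending \<open>(a, q)\<close> to \<open>q\<close> times \<open>\<phi> a\<close> is
  additive in both arguments, hence kills the relators and descends to the tensor product.\<close>

lemma rational_functional:
  assumes "\<phi> \<in> hom A integer_group"
  obtains \<psi> :: "('a \<times> rat \<Rightarrow>\<^sub>0 int) set \<Rightarrow> rat"
  where "\<And>x y. x \<in> carrier (rat_tensor A) \<Longrightarrow> y \<in> carrier (rat_tensor A) \<Longrightarrow>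
      \<psi> (x \<oplus>\<^bsub>rat_tensor A\<^esub> y) = \<psi> x + \<psi> y"
    and "\<And>p x. x \<in> carrier (rat_tensor A) \<Longrightarrow> \<psi> (p \<odot>\<^bsub>rat_tensor A\<^esub> x) = p * \<psi> x"
    and "\<And>a q. a \<in> carrier A \<Longrightarrow> \<psi> (tensor_class (frag_of (a, q))) = q * of_int (\<phi> a)"
proof -
  let ?Q = "\<lparr>carrier = UNIV, monoid.mult = (+), one = (0::rat)\<rparr>"
  interpret Q: comm_group ?Q
  proof (rule comm_groupI)
    show "\<exists>y\<in>carrier ?Q. y \<otimes>\<^bsub>?Q\<^esub> x = \<one>\<^bsub>?Q\<^esub>" for x
      by (rule bexI[of _ "- x"]) auto
  qed auto
  obtain \<theta> where \<theta>: "\<theta> \<in> hom (tensor_symbols A) ?Q"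
      and \<theta>_frag: "\<And>s. s \<in> carrier A \<times> UNIV \<Longrightarrow> \<theta> (frag_of s) = snd s * of_int (\<phi> (fst s))"
    using Q.free_Abelian_group_universal[of "\<lambda>s. snd s * of_int (\<phi> (fst s))" "carrier A \<times> UNIV"]
    unfolding tensor_symbols_def by auto
  interpret \<theta>: group_hom "tensor_symbols A" ?Q \<theta>
    using \<theta> by (intro group_hom.intro group_hom_axioms.intro S.group_axioms Q.group_axioms)
  have \<theta>_add: "\<theta> (c + d) = \<theta> c + \<theta> d"
    if "c \<in> carrier (tensor_symbols A)" "d \<in> carrier (tensor_symbols A)" for c d
    using \<theta>.hom_mult[OF that] by simp
  have minus: "c - d \<in> carrier (tensor_symbols A)"
    if "c \<in> carrier (tensor_symbols A)" "d \<in> carrier (tensor_symbols A)" for c d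
    using that keys_diff_subset unfolding tensor_symbols_simps by blast
  have \<theta>_diff: "\<theta> (c - d) = \<theta> c - \<theta> d"
    if "c \<in> carrier (tensor_symbols A)" "d \<in> carrier (tensor_symbols A)" for c d
    using \<theta>_add[OF minus[OF that] that(2)] by simp
  have \<theta>_scale: "\<theta> (scale_symbols p c) = p * \<theta> c" if "Poly_Mapping.keys c \<subseteq> carrier A \<times> UNIV" for p c
    using that
  proof (rule free_Abelian_group_induct)
    show "\<theta> (scale_symbols p 0) = p * \<theta> 0" using \<theta>.hom_one by simp
  next
    fix x y :: "'a \<times> rat \<Rightarrow>\<^sub>0 int"
    assume "Poly_Mapping.keys x \<subseteq> carrier A \<times> UNIV" "Poly_Mapping.keys y \<subseteq> carrier A \<times> UNIV"
      "\<theta> (scale_symbols p x) = p * \<theta> x" "\<theta> (scale_symbols p y) = p * \<theta> y"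
    then show "\<theta> (scale_symbols p (x - y)) = p * \<theta> (x - y)"
      using \<theta>_diff scale_symbols_closed[of _ A p] by (simp add: right_diff_distrib)
  next
    fix s :: "'a \<times> rat" assume "s \<in> carrier A \<times> UNIV"
    then show "\<theta> (scale_symbols p (frag_of s)) = p * \<theta> (frag_of s)"
      by (cases s) (simp add: \<theta>_frag)
  qed
  have mult: "\<phi> (a \<otimes> b) = \<phi> a + \<phi> b" if "a \<in> carrier A" "b \<in> carrier A" for a b
    using assms that by (simp add: hom_def)
  have three: "\<theta> (frag_of (a, p) - frag_of (b, q) - frag_of (c, r)) =
      p * of_int (\<phi> a) - q * of_int (\<phi> b) - r * of_int (\<phi> c)"
    if "a \<in> carrier A" "b \<in> carrier A" "c \<in> carrier A" for a b c p q r
    using that by (simp add: \<theta>_diff minus[unfolded tensor_symbols_simps] \<theta>_frag)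
  have "bilinear_relators A \<subseteq> kernel (tensor_symbols A) ?Q \<theta>"
  proof
    fix h assume h: "h \<in> bilinear_relators A"
    then have "\<theta> h = 0"
      by (cases rule: bilinear_relators_cases)
        (auto simp: three mult distrib_left distrib_right)
    then show "h \<in> kernel (tensor_symbols A) ?Q \<theta>"
      using bilinear_relators_closed[OF group_axioms h] by (simp add: kernel_def)
  qed
  then have "tensor_relations A \<subseteq> kernel (tensor_symbols A) ?Q \<theta>"
    unfolding tensor_relations_def
    by (intro S.generate_subgroup_incl \<theta>.subgroup_kernel)
  then obtain \<psi> where \<psi>: "\<psi> \<in> hom (tensor_symbols A Mod tensor_relations A) ?Q"
      "\<And>c. c \<in> carrier (tensor_symbols A) \<Longrightarrow> \<psi> (tensor_class c) = \<theta> c"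
    unfolding tensor_class_def using \<theta>.FactGroup_universal_kernel[OF N.normal_axioms] by blast
  show ?thesis
  proof
    fix x y assume "x \<in> carrier (rat_tensor A)" "y \<in> carrier (rat_tensor A)"
    then show "\<psi> (x \<oplus>\<^bsub>rat_tensor A\<^esub> y) = \<psi> x + \<psi> y"
      using S.m_closed by (auto simp: carrier_rat_tensor add_tensor_class \<psi>(2) \<theta>_add)
  next
    fix p x assume "x \<in> carrier (rat_tensor A)"
    then obtain c where c: "c \<in> carrier (tensor_symbols A)" "x = tensor_class c"
      by (auto simp: carrier_rat_tensor)
    then show "\<psi> (p \<odot>\<^bsub>rat_tensor A\<^esub> x) = p * \<psi> x"
      using \<psi>(2)[OF scale_symbols_closed[OF c(1), of p]] \<theta>_scale[of c p]
      by (simp add: smult_tensor_class \<psi>(2))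
  next
    fix a q assume "a \<in> carrier A"
    then show "\<psi> (tensor_class (frag_of (a, q))) = q * of_int (\<phi> a)"
      by (simp add: \<psi>(2) \<theta>_frag)
  qed
qed

lemma le_dim_rat_tensor:
  fixes g :: "nat \<Rightarrow> 'a" and \<phi> :: "nat \<Rightarrow> 'a \<Rightarrow> int"
  assumes "finite B" "B \<subseteq> carrier A" "generate A B = carrier A"
    and "\<And>i. i < m \<Longrightarrow> \<phi> i \<in> hom A integer_group" "\<And>i. i < m \<Longrightarrow> g i \<in> carrier A"
    and "\<And>i j. i < m \<Longrightarrow> j < m \<Longrightarrow> \<phi> i (g j) = 0 \<longleftrightarrow> i \<noteq> j"
  shows "m \<le> vectorspace.dim (class_ring :: rat ring) (rat_tensor A)"
proof -
  interpret V: vectorspace "class_ring :: rat ring" "rat_tensor A"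
    using group_axioms by (rule vectorspace_rat_tensor)
  have "\<forall>i. \<exists>\<psi> :: ('a \<times> rat \<Rightarrow>\<^sub>0 int) set \<Rightarrow> rat. i < m \<longrightarrow>
      (\<forall>x\<in>carrier (rat_tensor A). \<forall>y\<in>carrier (rat_tensor A). \<psi> (x \<oplus>\<^bsub>rat_tensor A\<^esub> y) = \<psi> x + \<psi> y) \<and>
      (\<forall>x\<in>carrier (rat_tensor A). \<forall>p. \<psi> (p \<odot>\<^bsub>rat_tensor A\<^esub> x) = p * \<psi> x) \<and>
      (\<forall>a\<in>carrier A. \<psi> (tensor_class (frag_of (a, 1))) = of_int (\<phi> i a))"
    using rational_functional[OF assms(4)] by (metis mult_1)
  from choice[OF this] obtain \<psi> :: "nat \<Rightarrow> ('a \<times> rat \<Rightarrow>\<^sub>0 int) set \<Rightarrow> rat" where \<psi>: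
    "\<And>i x y. i < m \<Longrightarrow> x \<in> carrier (rat_tensor A) \<Longrightarrow> y \<in> carrier (rat_tensor A) \<Longrightarrow>
      \<psi> i (x \<oplus>\<^bsub>rat_tensor A\<^esub> y) = \<psi> i x + \<psi> i y"
    "\<And>i x p. i < m \<Longrightarrow> x \<in> carrier (rat_tensor A) \<Longrightarrow> \<psi> i (p \<odot>\<^bsub>rat_tensor A\<^esub> x) = p * \<psi> i x"
    "\<And>i a. i < m \<Longrightarrow> a \<in> carrier A \<Longrightarrow> \<psi> i (tensor_class (frag_of (a, 1))) = of_int (\<phi> i a)"
    by blast
  show ?thesis
    by (rule V.le_dim_functionals[of m "\<lambda>j. tensor_class (frag_of (g j, 1))" \<psi>])
      (use \<psi> assms fin_dim_rat_tensor in \<open>auto simp: carrier_rat_tensor\<close>)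
qed

end

text \<open>A homomorphism to the integers kills commutators, so it descends to the abelianisation
  and extends to a rational functional there. The dual elements make these functionals
  independent.\<close>

lemma le_first_betti:
  fixes g :: "nat \<Rightarrow> 'a" and \<phi> :: "nat \<Rightarrow> 'a \<Rightarrow> int"
  assumes "group G" and B: "finite B" "B \<subseteq> carrier G" "generate G B = carrier G"
    and \<phi>: "\<And>i. i < m \<Longrightarrow> \<phi> i \<in> hom G integer_group" and g: "\<And>i. i < m \<Longrightarrow> g i \<in> carrier G"
    and dual: "\<And>i j. i < m \<Longrightarrow> j < m \<Longrightarrow> \<phi> i (g j) = 0 \<longleftrightarrow> i \<noteq> j"
  shows "m \<le> first_betti G"
proof -
  interpret G: group G by fact
  let ?D = "derived G (carrier G)" and ?A = "abelianization G"
  have N: "?D \<lhd> G" using G.derived_is_normal[OF G.normal_self] by simp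
  interpret N: normal ?D G by (rule N)
  interpret A: rational_tensor ?A
    unfolding rational_tensor_def abelianization_def by (rule N.factorgroup_is_group)
  define \<pi> where "\<pi> x = ?D #>\<^bsub>G\<^esub> x" for x
  interpret \<pi>: group_hom G ?A \<pi>
    unfolding \<pi>_def[abs_def] using N.r_coset_hom_Mod A.group_axioms
    by (intro group_hom.intro group_hom_axioms.intro) (simp_all add: abelianization_def)
  have surj: "\<pi> ` carrier G = carrier ?A"
    by (auto simp: abelianization_def FactGroup_def RCOSETS_def \<pi>_def)
  have "\<forall>i. \<exists>\<phi>'. i < m \<longrightarrow> \<phi>' \<in> hom ?A integer_group \<and> (\<forall>x\<in>carrier G. \<phi>' (\<pi> x) = \<phi> i x)"
  proof (intro allI)
    fix i
    show "\<exists>\<phi>'. i < m \<longrightarrow> \<phi>' \<in> hom ?A integer_group \<and> (\<forall>x\<in>carrier G. \<phi>' (\<pi> x) = \<phi> i x)"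
    proof (cases "i < m")
      case True
      interpret \<phi>: group_hom G integer_group "\<phi> i"
        by (intro group_hom.intro group_hom_axioms.intro \<phi> True G.group_axioms group_integer_group)
      have "?D \<subseteq> kernel G integer_group (\<phi> i)"
        unfolding derived_def
        by (intro G.generate_subgroup_incl \<phi>.subgroup_kernel) (auto simp: kernel_def)
      from \<phi>.FactGroup_universal_kernel[OF N this] show ?thesis
        unfolding abelianization_def \<pi>_def by metis
    qed auto
  qed
  from choice[OF this] obtain \<phi>' where \<phi>': "\<And>i. i < m \<Longrightarrow> \<phi>' i \<in> hom ?A integer_group"
      "\<And>i x. i < m \<Longrightarrow> x \<in> carrier G \<Longrightarrow> \<phi>' i (\<pi> x) = \<phi> i x" by blast
  have "generate ?A (\<pi> ` B) = carrier ?A"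
    using \<pi>.generate_img[OF B(2)] B(3) surj by simp
  then show ?thesis
    unfolding first_betti_def
    using B g \<phi>' dual by (intro A.le_dim_rat_tensor[of "\<pi> ` B" m \<phi>' "\<lambda>i. \<pi> (g i)"]) auto
qed

text \<open>Gaussian elimination without fractions: a vector \<open>e\<close> with non-zero last
  entry is the pivot, and \<open>f\<close> clears the last entry of the others. This is what reduces
  the relators of the abelianisation to finitely many.\<close>

lemma finite_subset_same_annihilator:
  fixes A :: "(nat \<Rightarrow> int) set"
  shows "\<exists>B\<subseteq>A. finite B \<and>
    (\<forall>c. (\<forall>b\<in>B. (\<Sum>i<n. c i * b i) = 0) \<longrightarrow> (\<forall>a\<in>A. (\<Sum>i<n. c i * a i) = 0))"
proof (induction n arbitrary: A)
  case 0
  show ?case by (intro exI[of _ "{}"]) auto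
next
  case (Suc n)
  show ?case
  proof (cases "\<forall>a\<in>A. a n = 0")
    case True
    then have eq: "(\<Sum>i<Suc n. c i * a i) = (\<Sum>i<n. c i * a i)" if "a \<in> A" for c a
      using that by simp
    obtain B where B: "B \<subseteq> A" "finite B"
      "\<And>c. (\<forall>b\<in>B. (\<Sum>i<n. c i * b i) = 0) \<Longrightarrow> \<forall>a\<in>A. (\<Sum>i<n. c i * a i) = 0"
      using Suc.IH[of A] by blast
    then show ?thesis
      using eq by (intro exI[of _ B]) (simp add: subset_iff del: sum.lessThan_Suc)
  next
    case False
    then obtain e where e: "e \<in> A" "e n \<noteq> 0" by blast
    define f where "f a i = e n * a i - a n * e i" for a :: "nat \<Rightarrow> int" and i
    obtain B' where B': "B' \<subseteq> f ` A" "finite B'"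
      "\<And>c. (\<forall>b\<in>B'. (\<Sum>i<n. c i * b i) = 0) \<Longrightarrow> \<forall>a\<in>f ` A. (\<Sum>i<n. c i * a i) = 0"
      using Suc.IH[of "f ` A"] by blast
    obtain B where B: "B \<subseteq> A" "finite B" "B' = f ` B"
      using finite_subset_image[OF B'(2,1)] by blast
    \<comment> \<open>The entry of \<open>f a\<close> at \<open>n\<close> is zero, so both sums on
      the right may include the index \<open>n\<close>.\<close>
    have f: "(\<Sum>i<n. c i * f a i) = e n * (\<Sum>i<Suc n. c i * a i) - a n * (\<Sum>i<Suc n. c i * e i)"
      for c a
      by (simp add: f_def sum_distrib_left sum_subtractf algebra_simps)
    show ?thesis
    proof (intro exI[of _ "insert e B"] conjI allI impI ballI)
      fix c a
      assume c: "\<forall>b\<in>insert e B. (\<Sum>i<Suc n. c i * b i) = 0" and a: "a \<in> A"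
      then have "\<forall>b\<in>B'. (\<Sum>i<n. c i * b i) = 0"
        by (simp add: B(3) f del: sum.lessThan_Suc)
      then have "(\<Sum>i<n. c i * f a i) = 0" using B'(3) a by blast
      then show "(\<Sum>i<Suc n. c i * a i) = 0"
        using c e(2) by (simp add: f del: sum.lessThan_Suc)
    qed (use B e in auto)
  qed
qed

section \<open>Exponent sums and the Betti number of a limit\<close>

definition exponent :: "'x \<Rightarrow> 'x letter list \<Rightarrow> int" where
  "exponent x = word_eval integer_group (\<lambda>y. if y = x then 1 else 0)"

lemma exponent_hom: "exponent x \<in> hom (free_group X) integer_group"
  unfolding exponent_def by (rule group.word_eval_hom[OF group_integer_group]) simp

lemma exponent_letter: "exponent x [(y, True)] = (if y = x then 1 else 0)"
  by (simp add: exponent_def word_eval_def)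

text \<open>Turns the vanishing of an integer-valued homomorphism on a word into a linear condition
  on the exponent vector of the word.\<close>

lemma word_eval_integer_group:
  "fst ` set w \<subseteq> {..<n :: nat} \<Longrightarrow> word_eval integer_group c w = (\<Sum>i<n. c i * exponent i w)"
proof (induction w)
  case (Cons l w)
  obtain j b where l: "l = (j, b)" by force
  have "(\<Sum>i<n. c i * (if j = i then 1 else 0)) = c j"
  proof -
    have "(\<Sum>i<n. c i * (if j = i then 1 else 0)) = (\<Sum>i<n. if i = j then c i else 0)"
      by (intro sum.cong) auto
    then show ?thesis using Cons.prems by (simp add: l)
  qed
  then show ?case
    using Cons by (cases b) (simp_all add: l word_eval_def exponent_def algebra_simps sum.distrib sum_subtractf)
qed (simp add: word_eval_def exponent_def)

context limit_of_free_groups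
begin

text \<open>The exponent vectors of the relators of \<open>G\<close> span a finitely generated group, so all of them
  are eventually exponent vectors of relators of the approximating free groups; hence the
  exponent sums of these free groups eventually factor through \<open>G\<close>.\<close>

lemma eventually_exponent_zero:
  "\<forall>\<^sub>F k in sequentially. \<forall>w\<in>carrier F. eval w = \<one> \<longrightarrow> (\<forall>j. exponent j (eval_approx k w) = 0)"
proof -
  let ?v = "\<lambda>w i. exponent i w"
  let ?N = "{w \<in> carrier F. eval w = \<one>}"
  obtain B where B: "B \<subseteq> ?v ` ?N" "finite B"
    "\<And>c. (\<forall>b\<in>B. (\<Sum>i<length S. c i * b i) = 0) \<Longrightarrow> \<forall>a\<in>?v ` ?N. (\<Sum>i<length S. c i * a i) = 0"
    using finite_subset_same_annihilator[of "?v ` ?N" "length S"] by blast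
  obtain W where W: "W \<subseteq> ?N" "finite W" "B = ?v ` W"
    using finite_subset_image[OF B(2,1)] by blast
  \<comment> \<open>As a function of the exponent vector of \<open>w\<close> this is a linear
    functional, so its vanishing on the finite set \<open>B\<close> settles all relators at
    once.\<close>
  have ex: "exponent j (eval_approx k w) = (\<Sum>i<length S. exponent j (T k ! i) * exponent i w)"
    if w: "w \<in> carrier F" for j k w
  proof -
    have "exponent j (eval_approx k w) = word_eval integer_group (\<lambda>i. exponent j (T k ! i)) w"
      unfolding eval_approx_def
      by (rule hom_word_eval[OF F'.group_axioms group_integer_group exponent_hom T_closed
            free_group_letters[OF w]])
    then show ?thesis using word_eval_integer_group[OF free_group_letters[OF w]] by simp
  qed
  have "\<forall>\<^sub>F k in sequentially. \<forall>w\<in>W. eval_approx k w = \<one>\<^bsub>F' k\<^esub>"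
  proof (rule eventually_ball_finite[OF W(2)], rule ballI)
    fix w assume "w \<in> W"
    then have w: "w \<in> carrier F" "eval w = \<one>" using W(1) by auto
    show "\<forall>\<^sub>F k in sequentially. eval_approx k w = \<one>\<^bsub>F' k\<^esub>"
      using eventually_eq[OF w(1) F.one_closed] by eventually_elim (simp add: w(2))
  qed
  then show ?thesis
  proof eventually_elim
    case (elim k)
    have "\<forall>b\<in>B. (\<Sum>i<length S. exponent j (T k ! i) * b i) = 0" for j
    proof
      fix b assume "b \<in> B"
      then obtain w where w: "w \<in> W" "b = (\<lambda>i. exponent i w)" using W(3) by blast
      then have "w \<in> carrier F" "eval_approx k w = []" using W(1) elim by (auto simp: one_free_group)
      then show "(\<Sum>i<length S. exponent j (T k ! i) * b i) = 0"
        using ex[of w j k] by (simp add: w(2) exponent_def word_eval_def)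
    qed
    from B(3)[OF this] show ?case by (auto simp: ex)
  qed
qed

text \<open>A single index \<open>k\<close> is chosen. The map to \<open>F' k\<close> need not
  factor through \<open>G\<close>, but its exponent sums do; they are dual to the values in
  \<open>G\<close> of preimages of the free generators of \<open>F' k\<close>.\<close>

lemma le_first_betti_if_eventually_le:
  assumes "\<forall>\<^sub>F k in sequentially. r \<le> m k"
  shows "r \<le> first_betti G"
proof -
  obtain k where k: "r \<le> m k"
    "\<And>w j. w \<in> carrier F \<Longrightarrow> eval w = \<one> \<Longrightarrow> exponent j (eval_approx k w) = 0"
    using eventually_happens'[OF sequentially_bot eventually_conj[OF assms eventually_exponent_zero]]
    by blast
  have "\<forall>x. \<exists>w. x \<in> carrier G \<longrightarrow> w \<in> carrier F \<and> eval w = x"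
    using obtain_word by metis
  from choice[OF this] obtain word where
    word: "\<And>x. x \<in> carrier G \<Longrightarrow> word x \<in> carrier F \<and> eval (word x) = x" by blast
  define \<phi> where "\<phi> j x = exponent j (eval_approx k (word x))" for j x
  interpret ex: group_hom "F' k" integer_group "exponent j" for j
    by (intro group_hom.intro group_hom_axioms.intro group_integer_group exponent_hom F'.group_axioms)
  \<comment> \<open>\<open>\<phi> j\<close> does not depend on the word chosen: two words with the
    same value differ by a relator, on which the exponent sums vanish.\<close>
  have \<phi>: "\<phi> j (eval w) = exponent j (eval_approx k w)" if w: "w \<in> carrier F" for j w
  proof -
    let ?u = "word (eval w)"
    have u: "?u \<in> carrier F" "eval ?u = eval w" using word[of "eval w"] w by auto
    then have "exponent j (eval_approx k (?u \<otimes>\<^bsub>F\<^esub> inv\<^bsub>F\<^esub> w)) = 0"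
      using w by (intro k(2)) auto
    then show ?thesis using u w by (simp add: \<phi>_def)
  qed
  have hom: "\<phi> j \<in> hom G integer_group" for j
  proof (rule homI)
    fix x y assume "x \<in> carrier G" "y \<in> carrier G"
    then have "x \<otimes> y = eval (word x \<otimes>\<^bsub>F\<^esub> word y)" "word x \<in> carrier F" "word y \<in> carrier F"
      using word by auto
    then show "\<phi> j (x \<otimes> y) = \<phi> j x \<otimes>\<^bsub>integer_group\<^esub> \<phi> j y"
      using \<phi>[of "word x \<otimes>\<^bsub>F\<^esub> word y" j] by (simp add: \<phi>_def)
  qed simp
  have "\<forall>j. \<exists>w. j < r \<longrightarrow> w \<in> carrier F \<and> eval_approx k w = [(j, True)]"
  proof (intro allI)
    fix j
    show "\<exists>w. j < r \<longrightarrow> w \<in> carrier F \<and> eval_approx k w = [(j, True)]"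
    proof (cases "j < r")
      case True
      then have "[(j, True)] \<in> eval_approx k ` carrier F"
        unfolding eval_approx_image using k(1) by simp
      then show ?thesis by (metis imageE)
    qed auto
  qed
  from choice[OF this] obtain u where u: "\<And>j. j < r \<Longrightarrow> u j \<in> carrier F \<and> eval_approx k (u j) = [(j, True)]"
    by blast
  show ?thesis
  proof (rule le_first_betti[of G "set S" r \<phi> "\<lambda>j. eval (u j)"])
    show "\<phi> i (eval (u j)) = 0 \<longleftrightarrow> i \<noteq> j" if "i < r" "j < r" for i j
      using u[OF that(2)] by (auto simp: \<phi> exponent_letter)
  qed (use marking u hom group_axioms in \<open>auto simp: marking_def\<close>)
qed

lemma first_betti_ge_1:
  assumes "carrier G \<noteq> {\<one>}"
  shows "first_betti G \<ge> 1"
proof (rule le_first_betti_if_eventually_le)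
  obtain x where x: "x \<in> carrier G" "x \<noteq> \<one>" using assms by blast
  obtain w where w: "w \<in> carrier F" "eval w = x" using x(1) by (rule obtain_word)
  show "\<forall>\<^sub>F k in sequentially. 1 \<le> m k"
    using eventually_eq[OF w(1) F.one_closed]
  proof eventually_elim
    case (elim k)
    then have "eval_approx k w \<noteq> []" 
      using w(2) x(2) by (simp add: one_free_group[of "{..<m k}", symmetric])
    moreover have "eval_approx k w \<in> carrier (F' k)" using w(1) by simp
    \<comment> \<open>The free group of rank 0 contains only the empty word.\<close>
    ultimately show ?case by (cases "m k = 0") (auto simp: free_group_def)
  qed
qed

lemma first_betti_ge_2:
  assumes "\<not> comm_group G"
  shows "first_betti G \<ge> 2"
proof (rule le_first_betti_if_eventually_le)
  obtain x y where xy: "x \<in> carrier G" "y \<in> carrier G" "x \<otimes> y \<noteq> y \<otimes> x"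
    using assms group_comm_groupI by blast
  obtain u where u: "u \<in> carrier F" "eval u = x" using xy(1) by (rule obtain_word)
  obtain v where v: "v \<in> carrier F" "eval v = y" using xy(2) by (rule obtain_word)
  show "\<forall>\<^sub>F k in sequentially. 2 \<le> m k"
    using eventually_eq[OF F.m_closed[OF u(1) v(1)] F.m_closed[OF v(1) u(1)]]
  proof eventually_elim
    case (elim k)
    then have "eval_approx k u \<otimes>\<^bsub>F' k\<^esub> eval_approx k v \<noteq> eval_approx k v \<otimes>\<^bsub>F' k\<^esub> eval_approx k u"
      using u v xy(3) by simp
    moreover have "eval_approx k u \<in> carrier (F' k)" "eval_approx k v \<in> carrier (F' k)"
      using u v by simp_all
    ultimately show ?case
      using free_group_rank_le_1_commute[of "{..<m k}"] by (force simp: mult_free_group)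
  qed
qed

text \<open>If the pair does not commute, \<open>noncommuting_free\<close> makes the evaluation of
  words in two letters injective, and its image is the subgroup generated by the pair.\<close>

lemma two_generated_subgroup:
  assumes ab: "a \<in> carrier G" "b \<in> carrier G" and "torsion_free G"
  shows "(\<exists>r\<le>2. G\<lparr>carrier := generate G {a, b}\<rparr> \<cong> free_Abelian_group {..<r::nat}) \<or>
    G\<lparr>carrier := generate G {a, b}\<rparr> \<cong> free_group {..<2::nat}"
proof (cases "a \<otimes> b = b \<otimes> a")
  case True
  then show ?thesis using commuting_pair_free_abelian[OF assms(3) ab] by blast
next
  case False
  define s where "s i = (if i = 0 then a else b)" for i :: nat
  have s: "s ` {..<2} = {a, b}"
    by (auto simp: s_def lessThan_Suc numeral_2_eq_2)
  interpret h: group_hom "free_group {..<2::nat}" G "word_eval G s"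
    using s ab by (intro group_hom.intro group_hom_axioms.intro group_free_group group_axioms word_eval_hom) auto
  have "inj_on (word_eval G s) (carrier (free_group {..<2}))"
    using noncommuting_free[of s] ab False
    by (subst h.inj_iff_trivial_ker) (auto simp: kernel_def s_def one_free_group word_eval_def)
  moreover have "word_eval G s ` carrier (free_group {..<2}) = generate G {a, b}"
  proof -
    have "word_eval G s ` generate (free_group {..<2}) ((\<lambda>i. [(i, True)]) ` {..<2}) =
        generate G (word_eval G s ` (\<lambda>i. [(i, True)]) ` {..<2})"
      by (rule h.generate_img[symmetric]) auto
    moreover have "word_eval G s ` (\<lambda>i. [(i, True)]) ` {..<2} = s ` {..<2}"
      unfolding image_image by (rule image_cong) (use ab in \<open>auto simp: word_eval_def s_def\<close>)
    ultimately show ?thesis by (simp only: generate_letters s)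
  qed
  ultimately have "word_eval G s \<in> iso (free_group {..<2}) (G\<lparr>carrier := generate G {a, b}\<rparr>)"
    using h.homh by (auto simp: iso_def bij_betw_def hom_def)
  then show ?thesis
    using group.iso_sym[OF group_free_group] by (auto simp: is_iso_def)
qed

end

theorem proposition3p1:
  fixes G :: "('a, 'm) monoid_scheme"
  assumes "limit_group G"
  shows "(torsion_free G \<and> commutative_transitive G \<and> CSA G) \<and>
    (\<forall>H. subgroup H G \<and> finitely_generated (G\<lparr>carrier := H\<rparr>) \<longrightarrow>
      limit_group (G\<lparr>carrier := H\<rparr>)) \<and>
    ((carrier G \<noteq> {\<one>\<^bsub>G\<^esub>} \<longrightarrow> first_betti G \<ge> 1) \<and>
     (\<not> comm_group G \<longrightarrow> first_betti G \<ge> 2)) \<and>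
    (\<forall>a\<in>carrier G. \<forall>b\<in>carrier G.
      (\<exists>r\<le>2. G\<lparr>carrier := generate G {a, b}\<rparr> \<cong> free_Abelian_group {..<r::nat}) \<or>
      G\<lparr>carrier := generate G {a, b}\<rparr> \<cong> free_group {..<2::nat}) \<and>
    bi_orderable G"
proof -
  obtain S m T where "limit_of_free_groups G S m T"
    using assms by (auto simp: limit_group_iff)
  then interpret limit_of_free_groups G S m T .
  obtain P where P: "positive_cone G P" using ex_positive_cone by blast
  have tf: "torsion_free G" using P by (rule positive_cone_torsion_free)
  show ?thesis
    using tf commutative_transitive CSA limit_group_subgroup first_betti_ge_1 first_betti_ge_2
      two_generated_subgroup[OF _ _ tf] positive_cone_bi_orderable[OF P] by blast
qed

end
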